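(* Let $(\mathfrak{g},\theta)$ be the contactization of a symplectic unimodular (six-dimensional, real) Lie algebra $(\mathfrak{h},\omega_0)$, and let $\varphi$ be a semi-algebraic soliton on $\mathfrak{g}$ such that $\Delta_\varphi\varphi=\lambda\varphi+D^*\varphi$, for some $\lambda\in\mathbb{R}$ and some $D\in\mathrm{Der}(\mathfrak{g})$. Let $\tau$ be the intrinsic torsion form of $\varphi$, and let $w_1,w_2^-$ be the intrinsic torsion forms of the $\mathrm{SU}(3)$-structure $(\omega,\psi_+)$ induced by $\varphi$ on $\mathfrak{h}$, with induced metric $g$. Then \[ \lambda = |w_2^-|_g^2 + 6\,|w_1|_g^2 = |\tau|_\varphi^2, \] and $\varphi$ is expanding, i.e. $\lambda>0$.
   Context: All Lie algebras are real and finite-dimensional; $d$ denotes the Chevalley-Eilenberg differential, with $d\alpha(x,y)=-\alpha([x,y])$ for 1-forms $\alpha$. Central extension and contactization: given a Lie algebra $(\mathfrak{h},[\cdot,\cdot]_{\mathfrak{h}})$ and a closed 2-form $\omega_0\in\Lambda^2\mathfrak{h}^*$, the central extension of $(\mathfrak{h},\omega_0)$ is $\mathfrak{g}=\mathfrak{h}\oplus\mathbb{R}z$ with bracket $[z,\mathfrak{h}]=0$, $[x,y]=-\omega_0(x,y)z+[x,y]_{\mathfrak{h}}$ for $x,y\in\mathfrak{h}$; $\theta\in\mathfrak{g}^*$ is defined by $\theta(z)=1$, $\theta|_{\mathfrak{h}}=0$, so $d\theta=\omega_0$. If $\omega_0$ is symplectic (closed and non-degenerate), $(\mathfrak{g},\theta)$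 is called the contactization of $(\mathfrak{h},\omega_0)$. Forms on $\mathfrak{h}$ are regarded as forms on $\mathfrak{g}$ vanishing on contraction with $z$. A 3-form $\varphi$ on a seven-dimensional vector space is definite if $\iota_w\varphi$ has rank six for each non-zero $w$. A $\mathrm{G}_2$-structure on a seven-dimensional Lie algebra $\mathfrak{g}$ is a definite $\varphi\in\Lambda^3\mathfrak{g}^*$; it is closed if $d\varphi=0$. With $b_\varphi(v,w)=\frac16\,\iota_v\varphi\wedge\iota_w\varphi\wedge\varphi$, it induces the inner product $g_\varphi=\det(b_\varphi)^{-1/9}b_\varphi$, the volume form $\mathrm{vol}_{g_\varphi}=\det(b_\varphi)^{1/9}$, the norm $|\cdot|_\varphi$ on forms ($\beta\wedge *_\varphi\beta=|\beta|^2_\varphi\,\mathrm{vol}_{g_\varphi}$) and the Hodge operator $*_\varphi$. The intrinsic torsion form of a closed $\varphi$ is the unique $\tau\in\Lambda^2\mathfrak{g}^*$ with $\tau\wedge\varphi=-*_\varphi\tau$ and $d*_\varphi\varphi=\tau\wedge\varphi$; the Hodge Laplacian is $\Delta_\varphi\varphi=d\tau$. A closed $\varphi$ is a semi-algebraic soliton if $\Delta_\varphi\varphi=\lambda\varphi+D^*\varphi$ for some $\lambda\in\mathbb{R}$, $D\in\mathrm{Der}(\mathfrak{g})$, where $A^*\beta(x_1,\ldots,x_k)=\sum_i\beta(x_1,\ldots,Ax_i,\ldots,x_k)$; it is expanding if $\lambda>0$. $\mathrm{SU}(3)$-structures: a 3-form $\rho$ on an oriented six-dimensional space $(V,\Omega)$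 is definite if $\iota_v\rho$ has rank four for all $v\neq0$; it induces the complex structure $J=(-P)^{-1/2}S_\rho$, where $\iota_v\rho\wedge\rho\wedge\eta=\eta(S_\rho(v))\Omega$ for all $\eta\in V^*$ and $S_\rho^2=P\,\mathrm{Id}$, $P<0$. An $\mathrm{SU}(3)$-structure is a pair $(\omega,\psi_+)$ of a non-degenerate 2-form and a definite 3-form with $\omega\wedge\psi_+=0$, $3\,\psi_+\wedge J\psi_+=2\,\omega^3$ and $g=\omega(\cdot,J\cdot)$ positive-definite, where $J$ is induced by $\psi_+$ and the orientation $\omega^3$; $\psi_-=J\psi_+$. Here $J$ acts on $k$-forms by $J\beta=\beta(J\cdot,\ldots,J\cdot)$. Induced $\mathrm{SU}(3)$-structure on $\mathfrak{h}$: for a closed $\mathrm{G}_2$-structure $\varphi$ on $\mathfrak{g}=\mathfrak{h}\oplus\mathbb{R}z$ set $u=g_\varphi(z,z)^{1/2}$ and $\eta=u^{-2}g_\varphi(z,\cdot)=\eta_{\mathfrak{h}}+\theta$ with $\eta_{\mathfrak{h}}\in\mathfrak{h}^*$. Then $\varphi=u\,\omega\wedge\eta+\psi_+$ for a unique $\mathrm{SU}(3)$-structure $(\omega,\psi_+)$ on $\mathfrak{h}$, inducing the metric $g$ with $g_\varphi=g+u^2\eta\otimes\eta$; moreover $d\omega=0$. Its intrinsic torsion forms are the unique $w_1\in\mathfrak{h}^*$ and $w_2^\pm\in\Lambda^2_8\mathfrak{h}^*=\{\beta\in\Lambda^2\mathfrak{h}^*\mid J\beta=\beta,\ \beta\wedge\omega^2=0\}$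 with $d\psi_+=w_2^+\wedge\omega+w_1\wedge\psi_+$ and $d\psi_-=w_2^-\wedge\omega+Jw_1\wedge\psi_+$. Norms $|\cdot|_g$ on forms satisfy $\beta\wedge*_g\beta=|\beta|_g^2\,\mathrm{vol}_g$, $\mathrm{vol}_g=\frac16\omega^3$. *)

theory Defs
  imports
    "HOL-Analysis.Product_Vector"
    "HOL-Analysis.Linear_Algebra"
    "HOL-Combinatorics.Permutations"
    "Jordan_Normal_Form.Determinant"
begin

section \<open>Exterior algebra of a real vector space\<close>

text \<open>
  A form is a function on argument lists.  A \<open>k\<close>-form vanishes by convention on lists whose
  length is not \<open>k\<close>, so that equality of forms is equality of functions and the operations
  below need no explicit degree.
\<close>

type_synonym 'a form = "'a list \<Rightarrow> real"

definition kform :: "nat \<Rightarrow> 'a::real_vector form \<Rightarrow> bool" where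
  "kform k \<alpha> \<longleftrightarrow>
     (\<forall>xs. length xs \<noteq> k \<longrightarrow> \<alpha> xs = 0) \<and>
     (\<forall>xs ys. length xs + length ys + 1 = k \<longrightarrow> linear (\<lambda>v. \<alpha> (xs @ v # ys))) \<and>
     (\<forall>xs. \<not> distinct xs \<longrightarrow> \<alpha> xs = 0)"

definition covector :: "('a \<Rightarrow> real) \<Rightarrow> 'a form" where
  "covector f xs = (if length xs = 1 then f (hd xs) else 0)"

definition interior :: "'a \<Rightarrow> 'a form \<Rightarrow> 'a form" where
  "interior v \<alpha> = (\<lambda>xs. \<alpha> (v # xs))"

text \<open>
  Normalised so that the wedge of two covectors \<open>\<alpha>\<close>, \<open>\<beta>\<close> is \<open>\<alpha>(x)\<beta>(y) - \<alpha>(y)\<beta>(x)\<close>.  For a \<open>k\<close>-form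
  \<open>\<alpha>\<close> and an \<open>l\<close>-form \<open>\<beta>\<close>, only the summand with that \<open>k\<close>, on lists of length \<open>k + l\<close>, survives.
\<close>

definition wedge :: "'a form \<Rightarrow> 'a form \<Rightarrow> 'a form"  (infixl "\<and>\<^sub>\<Lambda>" 70) where
  "(\<alpha> \<and>\<^sub>\<Lambda> \<beta>) xs =
     (\<Sum>k\<le>length xs. 1 / (fact k * fact (length xs - k)) *
        (\<Sum>\<sigma> | \<sigma> permutes {..<length xs}. of_int (sign \<sigma>) *
           \<alpha> (take k (permute_list \<sigma> xs)) * \<beta> (drop k (permute_list \<sigma> xs))))"

text \<open>Rank of a 2-form, as the codimension of its radical.\<close>

definition form_rank :: "'a::real_vector form \<Rightarrow> nat" where
  "form_rank \<beta> = dim (UNIV :: 'a set) - dim {v. \<forall>w. \<beta> [v, w] = 0}"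

definition nondegenerate :: "'a::real_vector form \<Rightarrow> bool" where
  "nondegenerate \<beta> \<longleftrightarrow> (\<forall>v. (\<forall>w. \<beta> [v, w] = 0) \<longrightarrow> v = 0)"

definition endo_act :: "('a \<Rightarrow> 'a) \<Rightarrow> 'a form \<Rightarrow> 'a form" where
  "endo_act A \<beta> xs = (\<Sum>i<length xs. \<beta> (xs[i := A (xs ! i)]))"

definition pullback :: "('a \<Rightarrow> 'b) \<Rightarrow> 'b form \<Rightarrow> 'a form" where
  "pullback f \<beta> xs = \<beta> (map f xs)"

definition orthonormal_basis :: "('a::real_vector \<Rightarrow> 'a \<Rightarrow> real) \<Rightarrow> 'a list \<Rightarrow> bool" where
  "orthonormal_basis g es \<longleftrightarrow>
     length es = dim (UNIV :: 'a set) \<and>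
     (\<forall>i<length es. \<forall>j<length es. g (es ! i) (es ! j) = (if i = j then 1 else 0))"

text \<open>
  The inner product on forms for which the increasing monomials in an orthonormal coframe are
  orthonormal; index sets of the wrong size contribute zero.
\<close>

definition form_inner :: "('a::real_vector \<Rightarrow> 'a \<Rightarrow> real) \<Rightarrow> 'a form \<Rightarrow> 'a form \<Rightarrow> real" where
  "form_inner g \<alpha> \<beta> =
     (let es = (SOME es. orthonormal_basis g es)
      in \<Sum>I\<in>Pow {..<length es}. \<alpha> (nths es I) * \<beta> (nths es I))"

definition form_norm :: "('a::real_vector \<Rightarrow> 'a \<Rightarrow> real) \<Rightarrow> 'a form \<Rightarrow> real" where
  "form_norm g \<beta> = sqrt (form_inner g \<beta> \<beta>)"

text \<open>Hodge dual of a \<open>k\<close>-form \<open>\<beta>\<close> with respect to the metric \<open>g\<close> and volume form \<open>vol\<close>.\<close>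

definition hodge :: "('a::real_vector \<Rightarrow> 'a \<Rightarrow> real) \<Rightarrow> 'a form \<Rightarrow> nat \<Rightarrow> 'a form \<Rightarrow> 'a form" where
  "hodge g vol k \<beta> =
     (THE \<gamma>. kform (dim (UNIV :: 'a set) - k) \<gamma> \<and>
        (\<forall>\<alpha>. kform k \<alpha> \<longrightarrow> \<alpha> \<and>\<^sub>\<Lambda> \<gamma> = (\<lambda>xs. form_inner g \<alpha> \<beta> * vol xs)))"


section \<open>Lie algebras\<close>

definition lie_algebra :: "('a::real_vector \<Rightarrow> 'a \<Rightarrow> 'a) \<Rightarrow> bool" where
  "lie_algebra br \<longleftrightarrow> bilinear br \<and> (\<forall>x. br x x = 0) \<and>
     (\<forall>x y z. br x (br y z) + br y (br z x) + br z (br x y) = 0)"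

definition lin_trace :: "('a::real_vector \<Rightarrow> 'a) \<Rightarrow> real" where
  "lin_trace f = (let B = extend_basis {} in \<Sum>b\<in>B. representation B (f b) b)"

definition unimodular :: "('a::real_vector \<Rightarrow> 'a \<Rightarrow> 'a) \<Rightarrow> bool" where
  "unimodular br \<longleftrightarrow> (\<forall>x. lin_trace (br x) = 0)"

definition derivation :: "('a::real_vector \<Rightarrow> 'a \<Rightarrow> 'a) \<Rightarrow> ('a \<Rightarrow> 'a) \<Rightarrow> bool" where
  "derivation br D \<longleftrightarrow> linear D \<and> (\<forall>x y. D (br x y) = br (D x) y + br x (D y))"

text \<open>Chevalley--Eilenberg differential; on covectors, \<open>d\<alpha>(x,y) = -\<alpha>([x,y])\<close>.\<close>

definition ce_diff :: "('a \<Rightarrow> 'a \<Rightarrow> 'a) \<Rightarrow> 'a form \<Rightarrow> 'a form" where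
  "ce_diff br \<alpha> xs =
     (\<Sum>j<length xs. \<Sum>i<j. (- 1) ^ (i + j) * \<alpha> (br (xs ! i) (xs ! j) # nths xs (- {i, j})))"

definition symplectic_form :: "('a::real_vector \<Rightarrow> 'a \<Rightarrow> 'a) \<Rightarrow> 'a form \<Rightarrow> bool" where
  "symplectic_form br \<omega> \<longleftrightarrow> kform 2 \<omega> \<and> ce_diff br \<omega> = (\<lambda>xs. 0) \<and> nondegenerate \<omega>"

text \<open>
  The central extension of \<open>(\<hh>, \<omega>\<^sub>0)\<close> lives on \<open>\<hh> \<times> \<real>\<close>, with \<open>z = (0, 1)\<close> and \<open>\<theta> = snd\<close>.
  When \<open>\<omega>\<^sub>0\<close> is symplectic it is the contactization.
\<close>

definition central_ext ::
  "('h::real_vector \<Rightarrow> 'h \<Rightarrow> 'h) \<Rightarrow> 'h form \<Rightarrow> 'h \<times> real \<Rightarrow> 'h \<times> real \<Rightarrow> 'h \<times> real" where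
  "central_ext br \<omega>\<^sub>0 x y = (br (fst x) (fst y), - \<omega>\<^sub>0 [fst x, fst y])"

abbreviation central_vec :: "'h::real_vector \<times> real" where
  "central_vec \<equiv> (0, 1)"


section \<open>\<open>G\<^sub>2\<close>-structures\<close>

definition g2_structure :: "'a::real_vector form \<Rightarrow> bool" where
  "g2_structure \<phi> \<longleftrightarrow> kform 3 \<phi> \<and> (\<forall>w. w \<noteq> 0 \<longrightarrow> form_rank (interior w \<phi>) = 6)"

definition closed_g2_structure :: "('a::real_vector \<Rightarrow> 'a \<Rightarrow> 'a) \<Rightarrow> 'a form \<Rightarrow> bool" where
  "closed_g2_structure br \<phi> \<longleftrightarrow> g2_structure \<phi> \<and> ce_diff br \<phi> = (\<lambda>xs. 0)"

definition g2_bilin :: "'a form \<Rightarrow> 'a \<Rightarrow> 'a \<Rightarrow> 'a form" where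
  "g2_bilin \<phi> v w = (\<lambda>xs. 1 / 6 * (interior v \<phi> \<and>\<^sub>\<Lambda> interior w \<phi> \<and>\<^sub>\<Lambda> \<phi>) xs)"

text \<open>
  The volume form \<open>det(b)\<^sup>1\<^sup>/\<^sup>9\<close>.  On seven vectors it is the (signed) ninth root of the determinant
  of the matrix of \<open>b\<close>, where the values of \<open>b\<close>, themselves 7-forms, are evaluated on the same
  seven vectors.  Applying an endomorphism \<open>A\<close> to the vectors multiplies that determinant by
  \<open>det(A)\<^sup>9\<close>, hence its ninth root by \<open>det(A)\<close>.  The metric is the ratio of \<open>b\<close> and the volume form.
\<close>

definition g2_vol :: "'a form \<Rightarrow> 'a form" where
  "g2_vol \<phi> xs =
     (if length xs = 7
      then root 9 (det (mat 7 7 (\<lambda>(i, j). g2_bilin \<phi> (xs ! i) (xs ! j) xs)))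
      else 0)"

definition g2_metric :: "'a form \<Rightarrow> 'a \<Rightarrow> 'a \<Rightarrow> real" where
  "g2_metric \<phi> v w = (THE c. g2_bilin \<phi> v w = (\<lambda>xs. c * g2_vol \<phi> xs))"

abbreviation g2_hodge :: "'a::real_vector form \<Rightarrow> nat \<Rightarrow> 'a form \<Rightarrow> 'a form" where
  "g2_hodge \<phi> \<equiv> hodge (g2_metric \<phi>) (g2_vol \<phi>)"

definition g2_torsion_form :: "('a::real_vector \<Rightarrow> 'a \<Rightarrow> 'a) \<Rightarrow> 'a form \<Rightarrow> 'a form \<Rightarrow> bool" where
  "g2_torsion_form br \<phi> \<tau> \<longleftrightarrow>
     kform 2 \<tau> \<and>
     \<tau> \<and>\<^sub>\<Lambda> \<phi> = (\<lambda>xs. - g2_hodge \<phi> 2 \<tau> xs) \<and>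
     ce_diff br (g2_hodge \<phi> 3 \<phi>) = \<tau> \<and>\<^sub>\<Lambda> \<phi>"

definition g2_laplacian :: "('a::real_vector \<Rightarrow> 'a \<Rightarrow> 'a) \<Rightarrow> 'a form \<Rightarrow> 'a form" where
  "g2_laplacian br \<phi> = ce_diff br (THE \<tau>. g2_torsion_form br \<phi> \<tau>)"

definition semi_algebraic_soliton ::
  "('a::real_vector \<Rightarrow> 'a \<Rightarrow> 'a) \<Rightarrow> 'a form \<Rightarrow> real \<Rightarrow> ('a \<Rightarrow> 'a) \<Rightarrow> bool" where
  "semi_algebraic_soliton br \<phi> lam D \<longleftrightarrow>
     closed_g2_structure br \<phi> \<and> derivation br D \<and>
     g2_laplacian br \<phi> = (\<lambda>xs. lam * \<phi> xs + endo_act D \<phi> xs)"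


section \<open>\<open>SU(3)\<close>-structures\<close>

text \<open>
  The endomorphism \<open>S\<^sub>\<rho>\<close>, the scalar \<open>P\<close> and the complex structure \<open>J\<close> of a 3-form \<open>\<rho>\<close> with
  respect to a volume form \<open>vol\<close>.
\<close>

definition hitchin_endo :: "'a::real_vector form \<Rightarrow> 'a form \<Rightarrow> 'a \<Rightarrow> 'a" where
  "hitchin_endo vol \<rho> v =
     (THE s. \<forall>f. linear f \<longrightarrow>
        interior v \<rho> \<and>\<^sub>\<Lambda> \<rho> \<and>\<^sub>\<Lambda> covector f = (\<lambda>xs. f s * vol xs))"

definition hitchin_scalar :: "'a::real_vector form \<Rightarrow> 'a form \<Rightarrow> real" where
  "hitchin_scalar vol \<rho> =
     (THE P. \<forall>v. hitchin_endo vol \<rho> (hitchin_endo vol \<rho> v) = P *\<^sub>R v)"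

definition hitchin_J :: "'a::real_vector form \<Rightarrow> 'a form \<Rightarrow> 'a \<Rightarrow> 'a" where
  "hitchin_J vol \<rho> v = (1 / sqrt (- hitchin_scalar vol \<rho>)) *\<^sub>R hitchin_endo vol \<rho> v"

definition definite3 :: "'a::real_vector form \<Rightarrow> bool" where
  "definite3 \<rho> \<longleftrightarrow> kform 3 \<rho> \<and> (\<forall>v. v \<noteq> 0 \<longrightarrow> form_rank (interior v \<rho>) = 4)"

text \<open>
  The orientation is that of \<open>\<omega>\<^sup>3\<close>; \<open>J\<close> does not change when the volume form is rescaled by a
  positive constant.
\<close>

abbreviation su3_J :: "'a::real_vector form \<Rightarrow> 'a form \<Rightarrow> 'a \<Rightarrow> 'a" where
  "su3_J \<omega> \<psi> \<equiv> hitchin_J (\<omega> \<and>\<^sub>\<Lambda> \<omega> \<and>\<^sub>\<Lambda> \<omega>) \<psi>"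

definition su3_metric :: "'a::real_vector form \<Rightarrow> 'a form \<Rightarrow> 'a \<Rightarrow> 'a \<Rightarrow> real" where
  "su3_metric \<omega> \<psi> v w = \<omega> [v, su3_J \<omega> \<psi> w]"

definition su3_structure :: "'a::real_vector form \<Rightarrow> 'a form \<Rightarrow> bool" where
  "su3_structure \<omega> \<psi> \<longleftrightarrow>
     kform 2 \<omega> \<and> nondegenerate \<omega> \<and> definite3 \<psi> \<and>
     \<omega> \<and>\<^sub>\<Lambda> \<psi> = (\<lambda>xs. 0) \<and>
     (\<forall>xs. 3 * (\<psi> \<and>\<^sub>\<Lambda> pullback (su3_J \<omega> \<psi>) \<psi>) xs = 2 * (\<omega> \<and>\<^sub>\<Lambda> \<omega> \<and>\<^sub>\<Lambda> \<omega>) xs) \<and>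
     (\<forall>v w. su3_metric \<omega> \<psi> v w = su3_metric \<omega> \<psi> w v) \<and>
     (\<forall>v. v \<noteq> 0 \<longrightarrow> su3_metric \<omega> \<psi> v v > 0)"

definition Lambda2_8 :: "'a::real_vector form \<Rightarrow> 'a form \<Rightarrow> 'a form set" where
  "Lambda2_8 \<omega> \<psi> =
     {\<beta>. kform 2 \<beta> \<and> pullback (su3_J \<omega> \<psi>) \<beta> = \<beta> \<and> \<beta> \<and>\<^sub>\<Lambda> (\<omega> \<and>\<^sub>\<Lambda> \<omega>) = (\<lambda>xs. 0)}"

definition su3_torsion_forms ::
  "('a::real_vector \<Rightarrow> 'a \<Rightarrow> 'a) \<Rightarrow> 'a form \<Rightarrow> 'a form \<Rightarrow> 'a form \<Rightarrow> 'a form \<Rightarrow> 'a form \<Rightarrow> bool" where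
  "su3_torsion_forms br \<omega> \<psi> w\<^sub>1 w\<^sub>2p w\<^sub>2m \<longleftrightarrow>
     kform 1 w\<^sub>1 \<and> w\<^sub>2p \<in> Lambda2_8 \<omega> \<psi> \<and> w\<^sub>2m \<in> Lambda2_8 \<omega> \<psi> \<and>
     (\<forall>xs. ce_diff br \<psi> xs = (w\<^sub>2p \<and>\<^sub>\<Lambda> \<omega>) xs + (w\<^sub>1 \<and>\<^sub>\<Lambda> \<psi>) xs) \<and>
     (\<forall>xs. ce_diff br (pullback (su3_J \<omega> \<psi>) \<psi>) xs =
        (w\<^sub>2m \<and>\<^sub>\<Lambda> \<omega>) xs + (pullback (su3_J \<omega> \<psi>) w\<^sub>1 \<and>\<^sub>\<Lambda> \<psi>) xs)"

definition g2_eta :: "('h::real_vector \<times> real) form \<Rightarrow> ('h \<times> real) form" where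
  "g2_eta \<phi> =
     covector (\<lambda>v. g2_metric \<phi> central_vec v / g2_metric \<phi> central_vec central_vec)"

text \<open>
  The \<open>SU(3)\<close>-structure \<open>(\<omega>, \<psi>)\<close> on \<open>\<hh>\<close> with \<open>\<phi> = u \<omega> \<and> \<eta> + \<psi>\<close>, where \<open>u\<close> is the length of the
  central vector; forms on \<open>\<hh>\<close> become forms on \<open>\<hh> \<times> \<real>\<close> by pullback along \<open>fst\<close>.
\<close>

definition induced_su3 :: "('h::real_vector \<times> real) form \<Rightarrow> 'h form \<Rightarrow> 'h form \<Rightarrow> bool" where
  "induced_su3 \<phi> \<omega> \<psi> \<longleftrightarrow>
     su3_structure \<omega> \<psi> \<and>
     (\<forall>xs. \<phi> xs = sqrt (g2_metric \<phi> central_vec central_vec) * (pullback fst \<omega> \<and>\<^sub>\<Lambda> g2_eta \<phi>) xs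
                   + pullback fst \<psi> xs)"

end

theory Submission
  imports Defs
begin

text \<open>
  Write \<open>\<phi> = \<omega> \<and> \<epsilon> + \<psi>\<close> with \<open>\<epsilon> = u \<eta>\<close>, and \<open>d\<epsilon> = F\<close>, a form on \<open>\<hh>\<close>.  Then \<open>d\<omega> = 0\<close>,
  \<open>d\<psi> = - \<omega> \<and> F\<close>, \<open>*\<phi> = \<omega>\<^sup>2/2 + J\<psi> \<and> \<epsilon>\<close> and \<open>\<tau> \<and> \<phi> = d*\<phi> = d(J\<psi>) \<and> \<epsilon> - J\<psi> \<and> F\<close>.  As \<open>\<tau> \<and> \<phi> = - *\<tau>\<close>,
  an adapted frame gives \<open>|\<tau>|\<^sup>2 = |d(J\<psi>)|\<^sup>2 + |J\<psi> \<and> F|\<^sup>2 = |w\<^sub>2\<^sup>-|\<^sup>2 + 6 |w\<^sub>1|\<^sup>2\<close>.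
  On a unimodular Lie algebra exact forms of top degree vanish.  Applied to \<open>\<tau> \<and> *\<phi>\<close> this gives
  \<open>|\<tau>|\<^sup>2 = 7 \<lambda> + 3 tr D\<close>.  The derivation preserves the centre, \<open>D z = c z\<close>, and induces on \<open>\<hh>\<close> a map acting
  on \<open>\<omega>\<^sub>0\<close> as \<open>c\<close> modulo exact forms, so \<open>tr D = 3 c + c\<close>.  Contracting the soliton equation with \<open>z\<close> and
  wedging with \<open>\<omega>\<^sup>2\<close> gives \<open>\<lambda> = - 2 c\<close>, whence \<open>|\<tau>|\<^sup>2 = \<lambda>\<close>.
  If \<open>w\<^sub>1\<close> vanished, then \<open>F = - w\<^sub>2\<^sup>+\<close> would be closed and \<open>0 = d(\<psi> \<and> F)\<close> would force \<open>F = 0\<close>, so \<open>\<omega>\<^sub>0\<close> would be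
  exact and \<open>\<omega>\<^sub>0\<^sup>3 = 0\<close>.
\<close>

section \<open>Contraction of wedge products\<close>

text \<open>The Hodge star, the metric of \<phi>, the torsion form in the Laplacian and
  \<open>J\<close> are given by definite descriptions, and \<open>form_inner\<close> by a chosen
  orthonormal basis, on a real vector space of which only the dimension is known. Each needs
  existence and uniqueness before anything can be computed. Wedge products are handled through the
  rule for contraction with a vector. It drives the inductions on degree and, iterated, evaluates a
  product on an explicit list as a polynomial in components. The constants: |\<phi>|^2 = 7; the
  pairing of the D-action on \<phi> with \<phi> is 3 tr D, as every index lies in three of the seven
  monomials of \<phi>; the factor 6 is 2 + 4, the shares of w_1 in d(J\<psi>) and in the wedge of
  J\<psi> with F.\<close>

definition alternating :: "nat \<Rightarrow> 'a form \<Rightarrow> bool" where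
  "alternating k \<alpha> \<longleftrightarrow> (\<forall>xs. length xs \<noteq> k \<longrightarrow> \<alpha> xs = 0) \<and>
     (\<forall>xs x y ys. \<alpha> (xs @ x # y # ys) = - \<alpha> (xs @ y # x # ys))"

lemma alternating_length: "alternating k \<alpha> \<Longrightarrow> length xs \<noteq> k \<Longrightarrow> \<alpha> xs = 0"
  by (simp add: alternating_def)

lemma alternating_swap: "alternating k \<alpha> \<Longrightarrow> \<alpha> (xs @ x # y # ys) = - \<alpha> (xs @ y # x # ys)"
  unfolding alternating_def by blast

lemma alternating_move:
  assumes "alternating k \<alpha>"
  shows "\<alpha> (xs @ v # ys) = (- 1) ^ length xs * \<alpha> (v # xs @ ys)"
proof (induction xs arbitrary: ys rule: rev_induct)
  case (snoc x xs)
  have "\<alpha> ((xs @ [x]) @ v # ys) = - \<alpha> (xs @ v # x # ys)"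
    using alternating_swap[OF assms, of xs x v ys] by simp
  also have "\<dots> = - ((- 1) ^ length xs * \<alpha> (v # xs @ x # ys))"
    by (simp only: snoc.IH)
  finally show ?case by simp
qed simp

lemma alternating_interior: "alternating (Suc k) \<alpha> \<Longrightarrow> alternating k (interior v \<alpha>)"
  unfolding alternating_def interior_def by (metis append_Cons length_Cons nat.inject)

text \<open>Stated for an arbitrary \<open>f\<close>, because the functional in
  \<open>g2_eta\<close> enters a wedge product before its linearity is established.\<close>

lemma alternating_covector: "alternating 1 (covector f)"
  by (auto simp: alternating_def covector_def)

lemma interior_0: "alternating 0 \<alpha> \<Longrightarrow> interior v \<alpha> = (\<lambda>xs. 0)"
  by (auto simp: alternating_def interior_def)

lemma kform_alternating:
  assumes "kform k \<alpha>"
  shows "alternating k \<alpha>"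
  unfolding alternating_def
proof (intro conjI allI impI)
  fix xs :: "'a list" assume "length xs \<noteq> k"
  then show "\<alpha> xs = 0" using assms by (simp add: kform_def)
next
  fix xs ys and x y :: 'a
  show "\<alpha> (xs @ x # y # ys) = - \<alpha> (xs @ y # x # ys)"
  proof (cases "length xs + length ys + 2 = k")
    case False
    then show ?thesis using assms by (simp add: kform_def)
  next
    case True
    have lin: "linear (\<lambda>v. \<alpha> (us @ v # vs))" if "length us + length vs + 1 = k" for us vs
      using assms that by (simp add: kform_def)
    have l1: "linear (\<lambda>v. \<alpha> (xs @ v # w # ys))" for w
      using lin[of xs "w # ys"] True by simp
    have l2: "linear (\<lambda>v. \<alpha> (xs @ w # v # ys))" for w
      using lin[of "xs @ [w]" ys] True by simp
    have z: "\<alpha> (xs @ w # w # ys) = 0" for w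
      using assms by (simp add: kform_def)
    have "0 = \<alpha> (xs @ (x + y) # (x + y) # ys)" using z by simp
    also have "\<dots> = \<alpha> (xs @ x # (x + y) # ys) + \<alpha> (xs @ y # (x + y) # ys)"
      using linear_add[OF l1] by simp
    also have "\<dots> = \<alpha> (xs @ x # y # ys) + \<alpha> (xs @ y # x # ys)"
      by (simp add: linear_add[OF l2] z)
    finally show ?thesis by simp
  qed
qed

text \<open>Permutations of n + 1 indices are sorted by the position j that is sent to 0, which is
  where the head of the permuted list ends up; a permutation of n indices remains. This is the
  recursion behind \<open>wedge_Cons\<close>.\<close>

lemma sum_permutes_Suc:
  fixes f :: "(nat \<Rightarrow> nat) \<Rightarrow> 'b::comm_monoid_add"
  shows "sum f {p. p permutes {..<Suc n}} =
    (\<Sum>j<Suc n. \<Sum>q | q permutes {..<n}. f (permutation_insert j 0 q))"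
proof -
  have U: "{p. p permutes {..<Suc n}} = (\<Union>j\<in>{..<Suc n}. {p. p permutes {..<Suc n} \<and> p j = 0})"
  proof -
    have "\<exists>j<Suc n. p j = 0" if "p permutes {..<Suc n}" for p
      using permutes_surj[OF that] permutes_in_image[OF that]
      by (metis lessThan_iff surjD zero_less_Suc)
    then show ?thesis by auto
  qed
  have fin: "finite {p. p permutes {..<Suc n}}" by (simp add: finite_permutations)
  have "sum f {p. p permutes {..<Suc n}} = (\<Sum>j<Suc n. sum f {p. p permutes {..<Suc n} \<and> p j = 0})"
  proof (subst U, rule sum.UNION_disjoint)
    show "\<forall>i\<in>{..<Suc n}. finite {p. p permutes {..<Suc n} \<and> p i = 0}"
      using fin by (auto intro: rev_finite_subset)
    show "\<forall>i\<in>{..<Suc n}. \<forall>j\<in>{..<Suc n}. i \<noteq> j \<longrightarrow>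
       {p. p permutes {..<Suc n} \<and> p i = 0} \<inter> {p. p permutes {..<Suc n} \<and> p j = 0} = {}"
    proof (intro ballI impI)
      fix i j :: nat assume "i \<noteq> j"
      then have "p i \<noteq> p j" if "p permutes {..<Suc n}" for p
        using permutes_inj[OF that] by (simp add: inj_eq)
      then show "{p. p permutes {..<Suc n} \<and> p i = 0} \<inter> {p. p permutes {..<Suc n} \<and> p j = 0} = {}"
        unfolding disjoint_iff by (metis (mono_tags, lifting) mem_Collect_eq)
    qed
  qed simp
  also have "\<dots> = (\<Sum>j<Suc n. \<Sum>q | q permutes {..<n}. f (permutation_insert j 0 q))"
  proof (rule sum.cong[OF refl])
    fix j assume "j \<in> {..<Suc n}"
    then have j: "j < Suc n" by simp
    have "{p. p permutes {..<Suc n} \<and> p j = 0} = permutation_insert j 0 ` {q. q permutes {..<n}}"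
      using permutation_fix[OF j, of 0] by (simp add: atLeast0LessThan)
    moreover have "inj_on (permutation_insert j 0) {q. q permutes {..<n}}"
      using permutation_insert_inj_on[OF j, of 0] by (simp add: atLeast0LessThan)
    ultimately show "sum f {p. p permutes {..<Suc n} \<and> p j = 0} =
        (\<Sum>q | q permutes {..<n}. f (permutation_insert j 0 q))"
      by (simp add: sum.reindex)
  qed
  finally show ?thesis .
qed

lemma permute_list_insert:
  assumes q: "q permutes {..<length xs}" and j: "j \<le> length xs"
  shows "permute_list (permutation_insert j 0 q) (v # xs) =
    take j (permute_list q xs) @ v # drop j (permute_list q xs)" (is "?l = ?r")
proof (rule nth_equalityI)
  show "length ?l = length ?r" using j by simp
  fix i assume "i < length ?l"
  then have i: "i < Suc (length xs)" by simp
  have l: "?l ! i = (v # xs) ! (permutation_insert j 0 q i)"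
    using i by (simp add: permute_list_def del: upt_Suc)
  consider "i < j" | "i = j" | "i > j" by linarith
  then show "?l ! i = ?r ! i"
  proof cases
    case 1
    then show ?thesis unfolding l using j i
      by (simp add: permutation_insert_expand nth_append permute_list_nth[OF q])
  next
    case 2
    then show ?thesis unfolding l using j by (simp add: nth_append)
  next
    case 3
    then have "i - 1 < length xs" using i by simp
    moreover have "Suc (j + (i - Suc j)) = i" using 3 by simp
    ultimately show ?thesis unfolding l using 3 j i
      by (simp add: permutation_insert_expand nth_append nth_Cons' permute_list_nth[OF q])
  qed
qed

text \<open>The list \<open>take i\<close> has length i, and \<alpha> vanishes on it unless i =
  k.\<close>

lemma wedge_alternating:
  assumes "alternating k \<alpha>"
  shows "(\<alpha> \<and>\<^sub>\<Lambda> \<beta>) xs = (if k \<le> length xs then 1 / (fact k * fact (length xs - k)) *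
     (\<Sum>\<sigma> | \<sigma> permutes {..<length xs}. of_int (sign \<sigma>) *
        \<alpha> (take k (permute_list \<sigma> xs)) * \<beta> (drop k (permute_list \<sigma> xs))) else 0)"
proof -
  let ?f = "\<lambda>i. 1 / (fact i * fact (length xs - i)) *
     (\<Sum>\<sigma> | \<sigma> permutes {..<length xs}. of_int (sign \<sigma>) *
        \<alpha> (take i (permute_list \<sigma> xs)) * \<beta> (drop i (permute_list \<sigma> xs)))"
  have "?f i = 0" if "i \<noteq> k" "i \<le> length xs" for i
    using alternating_length[OF assms] that by (simp add: sum.neutral)
  then have "(\<Sum>i\<le>length xs. ?f i) = (\<Sum>i\<le>length xs. if i = k then ?f i else 0)"
    by (intro sum.cong) (auto simp del: mult_eq_0_iff)
  then show ?thesis unfolding wedge_def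
    by (simp only: sum.delta finite_atMost atMost_iff if_True if_False)
qed

lemma wedge_length:
  assumes "alternating k \<alpha>" "alternating l \<beta>" "length xs \<noteq> k + l"
  shows "(\<alpha> \<and>\<^sub>\<Lambda> \<beta>) xs = 0"
proof (cases "k \<le> length xs")
  case True
  then have "length xs - k \<noteq> l" using assms(3) by linarith
  then show ?thesis
    using alternating_length[OF assms(2)] by (simp add: wedge_alternating[OF assms(1)])
qed (simp add: wedge_alternating[OF assms(1)])

lemma wedge_Nil: "(\<alpha> \<and>\<^sub>\<Lambda> \<beta>) [] = \<alpha> [] * \<beta> []"
  by (simp add: wedge_def sign_id)

lemma wedge_zero_left [simp]: "((\<lambda>xs. 0) \<and>\<^sub>\<Lambda> \<beta>) = (\<lambda>xs. 0)"
  by (rule ext) (simp add: wedge_def)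

lemma wedge_zero_right [simp]: "(\<alpha> \<and>\<^sub>\<Lambda> (\<lambda>xs. 0)) = (\<lambda>xs. 0)"
  by (rule ext) (simp add: wedge_def)

text \<open>Contraction is an antiderivation. Permutations are sorted by the position j of v. For j
  < k, moving v to the front of \<alpha> costs (-1)^j and cancels the sign of the insertion; for j
  \<ge> k, moving it to the front of \<beta> leaves (-1)^k. There are k positions of the first kind
  and l of the second, and these counts turn 1 / (k! l!) into the normalisation of the two
  contracted products.\<close>

lemma wedge_Cons:
  assumes a: "alternating k \<alpha>" and b: "alternating l \<beta>"
  shows "(\<alpha> \<and>\<^sub>\<Lambda> \<beta>) (v # xs) =
    (interior v \<alpha> \<and>\<^sub>\<Lambda> \<beta>) xs + (- 1) ^ k * (\<alpha> \<and>\<^sub>\<Lambda> interior v \<beta>) xs"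
proof (cases "Suc (length xs) = k + l")
  case False
  have "(interior v \<alpha> \<and>\<^sub>\<Lambda> \<beta>) xs = 0"
  proof (cases k)
    case 0 then show ?thesis using a by (simp add: interior_0)
  next
    case (Suc k')
    show ?thesis
      by (rule wedge_length[OF alternating_interior[OF a[unfolded Suc]] b]) (use False Suc in auto)
  qed
  moreover have "(\<alpha> \<and>\<^sub>\<Lambda> interior v \<beta>) xs = 0"
  proof (cases l)
    case 0 then show ?thesis using b by (simp add: interior_0)
  next
    case (Suc l')
    show ?thesis
      by (rule wedge_length[OF a alternating_interior[OF b[unfolded Suc]]]) (use False Suc in auto)
  qed
  ultimately show ?thesis using wedge_length[OF a b, of "v # xs"] False by simp
next
  case True
  define n where "n = length xs"
  have kl: "k + l = Suc n" using True n_def by simp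
  \<comment> \<open>For k = 0 the truncated k - 1 is harmless: no position satisfies j < k, and
    \<open>X\<close> enters only with the factor k.\<close>
  define X where "X = (\<Sum>q | q permutes {..<n}. of_int (sign q) *
     \<alpha> (v # take (k - 1) (permute_list q xs)) * \<beta> (drop (k - 1) (permute_list q xs)))"
  define Y where "Y = (\<Sum>q | q permutes {..<n}. of_int (sign q) *
     \<alpha> (take k (permute_list q xs)) * \<beta> (v # drop k (permute_list q xs)))"
  let ?g = "\<lambda>\<sigma>. of_int (sign \<sigma>) * \<alpha> (take k (permute_list \<sigma> (v # xs))) *
     \<beta> (drop k (permute_list \<sigma> (v # xs)))"
  have J: "(\<Sum>q | q permutes {..<n}. ?g (permutation_insert j 0 q)) =
      (if j < k then X else (- 1) ^ k * Y)" if "j < Suc n" for j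
  proof -
    have "?g (permutation_insert j 0 q) =
       (if j < k then of_int (sign q) * \<alpha> (v # take (k - 1) (permute_list q xs)) *
            \<beta> (drop (k - 1) (permute_list q xs))
        else (- 1) ^ k * (of_int (sign q) *
            \<alpha> (take k (permute_list q xs)) * \<beta> (v # drop k (permute_list q xs))))"
      if "q permutes {..<n}" for q
    proof -
      define ys where "ys = permute_list q xs"
      have len: "length ys = n" by (simp add: ys_def n_def)
      have pl: "permute_list (permutation_insert j 0 q) (v # xs) = take j ys @ v # drop j ys"
        using permute_list_insert[of q xs j v] that \<open>j < Suc n\<close> by (simp add: ys_def n_def)
      have sg: "of_int (sign (permutation_insert j 0 q)) = (- 1) ^ j * (of_int (sign q) :: real)"
        using signof_permutation_insert[of q n j 0] that \<open>j < Suc n\<close> by (simp add: atLeast0LessThan)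
      have len_j: "length (take j ys) = j" using len \<open>j < Suc n\<close> by simp
      show ?thesis
      proof (cases "j < k")
        case True
        have t: "take k (take j ys @ v # drop j ys) = take j ys @ v # take (k - 1 - j) (drop j ys)"
          using True len kl \<open>j < Suc n\<close> by (simp add: take_Cons' min_def)
        have d: "drop k (take j ys @ v # drop j ys) = drop (k - 1) ys"
          using True len \<open>j < Suc n\<close> by (simp add: drop_Cons' min_def)
        have "take j ys @ take (k - 1 - j) (drop j ys) = take (k - 1) ys"
          using True take_add[of j "k - 1 - j" ys] by simp
        then have "\<alpha> (take j ys @ v # take (k - 1 - j) (drop j ys)) = (- 1) ^ j * \<alpha> (v # take (k - 1) ys)"
          using alternating_move[OF a, of "take j ys" v] len_j by simp
        moreover have "(- 1 :: real) ^ j * ((- 1) ^ j * c) = c" for c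
          by (simp flip: power_add mult.assoc)
        ultimately show ?thesis using True unfolding pl sg t d ys_def[symmetric]
          by (simp add: mult.assoc mult.left_commute[of "of_int (sign q)"])
      next
        case False
        have t: "take k (take j ys @ v # drop j ys) = take k ys"
          using False len \<open>j < Suc n\<close> by (simp add: min_def)
        have d: "drop k (take j ys @ v # drop j ys) = drop k (take j ys) @ v # drop j ys"
          using False len \<open>j < Suc n\<close> by simp
        have "drop k (take j ys) @ drop j ys = drop k ys"
          using False by (metis append_take_drop_id drop_take le_add_diff_inverse2
              drop_drop linorder_not_less)
        moreover have "length (drop k (take j ys)) = j - k" using len \<open>j < Suc n\<close> by simp
        ultimately have "\<beta> (drop k (take j ys) @ v # drop j ys) = (- 1) ^ (j - k) * \<beta> (v # drop k ys)"
          using alternating_move[OF b, of "drop k (take j ys)" v "drop j ys"] by simp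
        moreover have "(- 1 :: real) ^ j * (- 1) ^ (j - k) = (- 1) ^ k"
        proof -
          obtain m where "j = k + m" using False le_Suc_ex not_less by blast
          then show ?thesis by (simp add: power_add flip: power_mult_distrib)
        qed
        ultimately show ?thesis using False unfolding pl sg t d ys_def[symmetric]
          by (simp add: mult.assoc)
      qed
    qed
    then show ?thesis unfolding X_def Y_def sum_distrib_left by (auto intro!: sum.cong)
  qed
  have "(\<Sum>\<sigma> | \<sigma> permutes {..<length (v # xs)}. ?g \<sigma>) =
      (\<Sum>j<Suc n. if j < k then X else (- 1) ^ k * Y)"
    using J by (simp add: sum_permutes_Suc n_def del: sum.lessThan_Suc)
  also have "\<dots> = real k * X + real l * ((- 1) ^ k * Y)"
  proof -
    have "{..<Suc n} \<inter> {j. j < k} = {..<k}" "{..<Suc n} \<inter> - {j. j < k} = {k..<Suc n}"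
      using kl by auto
    moreover have "Suc n - k = l" using kl by simp
    ultimately show ?thesis by (simp add: sum.If_cases del: sum.lessThan_Suc)
  qed
  finally have S: "(\<Sum>\<sigma> | \<sigma> permutes {..<length (v # xs)}. ?g \<sigma>) = real k * X + real l * ((- 1) ^ k * Y)" .
  have L: "(\<alpha> \<and>\<^sub>\<Lambda> \<beta>) (v # xs) = 1 / (fact k * fact l) * (real k * X + real l * ((- 1) ^ k * Y))"
  proof -
    have "length (v # xs) - k = l" "k \<le> length (v # xs)" using kl n_def by auto
    then show ?thesis by (simp only: wedge_alternating[OF a] S) simp
  qed
  have RX: "(interior v \<alpha> \<and>\<^sub>\<Lambda> \<beta>) xs = 1 / (fact k * fact l) * (real k * X)"
  proof (cases k)
    case 0 then show ?thesis using a by (simp add: interior_0)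
  next
    case (Suc k')
    have "length xs - k' = l" "k' \<le> length xs" using kl n_def Suc by auto
    then show ?thesis
      by (subst wedge_alternating[OF alternating_interior[OF a[unfolded Suc]]])
        (simp add: X_def Suc interior_def n_def del: of_nat_Suc)
  qed
  have RY: "(\<alpha> \<and>\<^sub>\<Lambda> interior v \<beta>) xs = 1 / (fact k * fact l) * (real l * Y)"
  proof (cases l)
    case 0 then show ?thesis using b by (simp add: interior_0)
  next
    case (Suc l')
    have "length xs - k = l'" "k \<le> length xs" using kl n_def Suc by auto
    then show ?thesis
      by (subst wedge_alternating[OF a]) (simp add: Y_def Suc interior_def n_def del: of_nat_Suc)
  qed
  show ?thesis unfolding L RX RY by (simp add: algebra_simps)
qed

section \<open>Forms, derivations and the Chevalley--Eilenberg differential\<close>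

lemma kform_length: "kform k \<alpha> \<Longrightarrow> length xs \<noteq> k \<Longrightarrow> \<alpha> xs = 0"
  by (simp add: kform_def)

lemma kform_linear:
  assumes "kform k \<alpha>"
  shows "linear (\<lambda>v. \<alpha> (xs @ v # ys))"
proof (cases "length xs + length ys + 1 = k")
  case True
  then show ?thesis using assms by (simp add: kform_def)
next
  case False
  then have "(\<lambda>v. \<alpha> (xs @ v # ys)) = (\<lambda>v. 0)"
    using kform_length[OF assms] by (intro ext) simp
  then show ?thesis by (simp add: linear_iff)
qed

lemma kform_linear_Cons: "kform k \<alpha> \<Longrightarrow> linear (\<lambda>v. \<alpha> (v # xs))"
  using kform_linear[of k \<alpha> "[]" xs] by simp

lemma kform_repeat: "kform k \<alpha> \<Longrightarrow> \<alpha> (v # v # xs) = 0"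
  by (simp add: kform_def)

lemma kform_swap: "kform k \<alpha> \<Longrightarrow> \<alpha> (v # w # xs) = - \<alpha> (w # v # xs)"
  using alternating_swap[OF kform_alternating, of k \<alpha> "[]" v w xs] by simp

lemma kform_zero: "kform k (\<lambda>xs. 0)"
  by (simp add: kform_def linear_iff)

lemma kform_add: "kform k \<alpha> \<Longrightarrow> kform k \<beta> \<Longrightarrow> kform k (\<lambda>xs. \<alpha> xs + \<beta> xs)"
  unfolding kform_def by (simp add: linear_compose_add)

lemma kform_scale: "kform k \<alpha> \<Longrightarrow> kform k (\<lambda>xs. c * \<alpha> xs)"
  unfolding kform_def by (auto simp: linear_iff algebra_simps)

lemma kform_minus: "kform k \<alpha> \<Longrightarrow> kform k (\<lambda>xs. - \<alpha> xs)"
  using kform_scale[of k \<alpha> "- 1"] by simp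

lemma kform_diff: "kform k \<alpha> \<Longrightarrow> kform k \<beta> \<Longrightarrow> kform k (\<lambda>xs. \<alpha> xs - \<beta> xs)"
  using kform_add[of k \<alpha> "\<lambda>xs. - \<beta> xs"] kform_minus[of k \<beta>] by simp

lemma kform_sum: "(\<And>i. i \<in> I \<Longrightarrow> kform k (f i)) \<Longrightarrow> kform k (\<lambda>xs. \<Sum>i\<in>I. f i xs)"
proof (induction I rule: infinite_finite_induct)
  case (insert i I)
  then show ?case by (simp add: kform_add)
qed (simp_all add: kform_zero)

lemma kform_interior:
  assumes "kform (Suc k) \<alpha>"
  shows "kform k (interior v \<alpha>)"
  unfolding kform_def interior_def
proof (intro conjI allI impI)
  fix xs ys :: "'a list" assume "length xs + length ys + 1 = k"
  show "linear (\<lambda>w. \<alpha> (v # xs @ w # ys))" using kform_linear[OF assms, of "v # xs" ys] by simp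
qed (use assms in \<open>simp_all add: kform_def\<close>)

lemma kform_interior_0: "kform 0 \<alpha> \<Longrightarrow> interior v \<alpha> = (\<lambda>xs. 0)"
  by (simp add: interior_0 kform_alternating)

lemma interior_interior: "kform k \<alpha> \<Longrightarrow> interior v (interior w \<alpha>) = (\<lambda>xs. - interior w (interior v \<alpha>) xs)"
  by (rule ext) (simp add: interior_def kform_swap[of k \<alpha> w v])

lemma interior_twice: "kform k \<alpha> \<Longrightarrow> interior v (interior v \<alpha>) = (\<lambda>xs. 0)"
  by (rule ext) (simp add: interior_def kform_repeat)

lemma interior_add: "kform k \<alpha> \<Longrightarrow> interior (v + w) \<alpha> = (\<lambda>xs. interior v \<alpha> xs + interior w \<alpha> xs)"
  by (rule ext) (simp add: interior_def linear_add[OF kform_linear_Cons])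

lemma interior_scale: "kform k \<alpha> \<Longrightarrow> interior (c *\<^sub>R v) \<alpha> = (\<lambda>xs. c * interior v \<alpha> xs)"
  by (rule ext) (simp add: interior_def linear_scale[OF kform_linear_Cons])

text \<open>The induction step for being a form. A repetition inside the tail is caught by the
  contraction. If the head recurs in the tail, polarising \<open>rep\<close> allows the first two
  entries to be exchanged, which puts the repetition into the tail or makes the first two entries
  equal.\<close>

lemma kform_SucI:
  assumes "\<And>v. kform k (interior v \<alpha>)" "\<alpha> [] = 0"
    and lin: "\<And>xs. linear (\<lambda>v. \<alpha> (v # xs))" and rep: "\<And>v xs. \<alpha> (v # v # xs) = 0"
  shows "kform (Suc k) \<alpha>"
  unfolding kform_def
proof (intro conjI allI impI)
  fix xs :: "'a list" assume "length xs \<noteq> Suc k"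
  then show "\<alpha> xs = 0"
    using assms(2) kform_length[OF assms(1)] by (cases xs) (auto simp: interior_def)
next
  fix xs ys :: "'a list"
  show "linear (\<lambda>v. \<alpha> (xs @ v # ys))"
  proof (cases xs)
    case Nil then show ?thesis using lin by simp
  next
    case (Cons a as)
    then show ?thesis using kform_linear[OF assms(1)[of a], of as ys] by (simp add: interior_def)
  qed
next
  fix xs :: "'a list" assume nd: "\<not> distinct xs"
  have swap: "\<alpha> (v # w # ys) = - \<alpha> (w # v # ys)" for v w ys
  proof -
    have l: "\<alpha> (x # (v + w) # ys) = \<alpha> (x # v # ys) + \<alpha> (x # w # ys)" for x
      using linear_add[OF kform_linear_Cons[OF assms(1)[of x]]] by (simp add: interior_def)
    have "0 = \<alpha> ((v + w) # (v + w) # ys)" by (simp add: rep)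
    also have "\<dots> = \<alpha> (v # (v + w) # ys) + \<alpha> (w # (v + w) # ys)"
      using linear_add[OF lin] by simp
    finally show ?thesis by (simp add: l rep)
  qed
  have tail: "\<alpha> (v # ys) = 0" if "\<not> distinct ys" for v ys
    using assms(1)[of v] that by (simp add: kform_def interior_def)
  obtain v ys where xs: "xs = v # ys" using nd by (cases xs) auto
  show "\<alpha> xs = 0"
  proof (cases "distinct ys")
    case False
    then show ?thesis using tail xs by simp
  next
    case True
    then have "v \<in> set ys" using nd xs by simp
    then obtain a as where ys: "ys = a # as" by (cases ys) auto
    show ?thesis
    proof (cases "a = v")
      case False
      then have "\<not> distinct (v # as)" using \<open>v \<in> set ys\<close> ys by simp
      then show ?thesis using tail swap[of v a as] unfolding xs ys by simp
    qed (simp add: xs ys rep)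
  qed
qed

lemma kform_0I: "(\<And>xs. xs \<noteq> [] \<Longrightarrow> \<alpha> xs = 0) \<Longrightarrow> kform 0 \<alpha>"
  unfolding kform_def by (metis add_is_0 distinct.simps(1) length_0_conv one_neq_zero)

lemma form_ext:
  assumes "\<alpha> [] = \<beta> []" "\<And>v. interior v \<alpha> = interior v \<beta>"
  shows "\<alpha> = \<beta>"
proof
  fix xs show "\<alpha> xs = \<beta> xs"
    using assms(1) fun_cong[OF assms(2)] by (cases xs) (auto simp: interior_def)
qed

lemma kform_covector: "linear f \<Longrightarrow> kform 1 (covector f)"
  unfolding kform_def covector_def by (auto simp: length_Suc_conv)

section \<open>Bilinearity and degree of the wedge product\<close>

lemma wedge_add_left: "(\<lambda>xs. \<alpha> xs + \<beta> xs) \<and>\<^sub>\<Lambda> \<gamma> = (\<lambda>xs. (\<alpha> \<and>\<^sub>\<Lambda> \<gamma>) xs + (\<beta> \<and>\<^sub>\<Lambda> \<gamma>) xs)"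
  by (rule ext) (simp add: wedge_def distrib_left distrib_right sum.distrib)

lemma wedge_add_right: "\<gamma> \<and>\<^sub>\<Lambda> (\<lambda>xs. \<alpha> xs + \<beta> xs) = (\<lambda>xs. (\<gamma> \<and>\<^sub>\<Lambda> \<alpha>) xs + (\<gamma> \<and>\<^sub>\<Lambda> \<beta>) xs)"
  by (rule ext) (simp add: wedge_def distrib_left distrib_right sum.distrib)

lemma wedge_scale_left: "(\<lambda>xs. c * \<alpha> xs) \<and>\<^sub>\<Lambda> \<gamma> = (\<lambda>xs. c * (\<alpha> \<and>\<^sub>\<Lambda> \<gamma>) xs)"
  by (rule ext) (simp add: wedge_def sum_distrib_left mult_ac)

lemma wedge_scale_right: "\<gamma> \<and>\<^sub>\<Lambda> (\<lambda>xs. c * \<alpha> xs) = (\<lambda>xs. c * (\<gamma> \<and>\<^sub>\<Lambda> \<alpha>) xs)"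
  by (rule ext) (simp add: wedge_def sum_distrib_left mult_ac)

lemma wedge_minus_left: "(\<lambda>xs. - \<alpha> xs) \<and>\<^sub>\<Lambda> \<gamma> = (\<lambda>xs. - (\<alpha> \<and>\<^sub>\<Lambda> \<gamma>) xs)"
  using wedge_scale_left[of "- 1" \<alpha> \<gamma>] by simp

lemma wedge_minus_right: "\<gamma> \<and>\<^sub>\<Lambda> (\<lambda>xs. - \<alpha> xs) = (\<lambda>xs. - (\<gamma> \<and>\<^sub>\<Lambda> \<alpha>) xs)"
  using wedge_scale_right[of \<gamma> "- 1" \<alpha>] by simp

lemma wedge_diff_left: "(\<lambda>xs. \<alpha> xs - \<beta> xs) \<and>\<^sub>\<Lambda> \<gamma> = (\<lambda>xs. (\<alpha> \<and>\<^sub>\<Lambda> \<gamma>) xs - (\<beta> \<and>\<^sub>\<Lambda> \<gamma>) xs)"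
  using wedge_add_left[of \<alpha> "\<lambda>xs. - \<beta> xs" \<gamma>] by (simp add: wedge_minus_left)

lemma wedge_diff_right: "\<gamma> \<and>\<^sub>\<Lambda> (\<lambda>xs. \<alpha> xs - \<beta> xs) = (\<lambda>xs. (\<gamma> \<and>\<^sub>\<Lambda> \<alpha>) xs - (\<gamma> \<and>\<^sub>\<Lambda> \<beta>) xs)"
  using wedge_add_right[of \<gamma> \<alpha> "\<lambda>xs. - \<beta> xs"] by (simp add: wedge_minus_right)

lemma wedge_sum_left: "(\<lambda>xs. \<Sum>i\<in>I. c i * f i xs) \<and>\<^sub>\<Lambda> \<gamma> = (\<lambda>xs. \<Sum>i\<in>I. c i * (f i \<and>\<^sub>\<Lambda> \<gamma>) xs)"
proof (induction I rule: infinite_finite_induct)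
  case (insert i I)
  then show ?case by (simp add: wedge_add_left wedge_scale_left)
qed simp_all

lemma wedge_sum_right: "\<gamma> \<and>\<^sub>\<Lambda> (\<lambda>xs. \<Sum>i\<in>I. c i * f i xs) = (\<lambda>xs. \<Sum>i\<in>I. c i * (\<gamma> \<and>\<^sub>\<Lambda> f i) xs)"
proof (induction I rule: infinite_finite_induct)
  case (insert i I)
  then show ?case by (simp add: wedge_add_right wedge_scale_right)
qed simp_all

lemmas wedge_linear = wedge_add_left wedge_add_right wedge_diff_left wedge_diff_right
  wedge_minus_left wedge_minus_right wedge_scale_left wedge_scale_right

lemma interior_wedge:
  assumes "kform k \<alpha>" "kform l \<beta>"
  shows "interior v (\<alpha> \<and>\<^sub>\<Lambda> \<beta>) =
    (\<lambda>xs. (interior v \<alpha> \<and>\<^sub>\<Lambda> \<beta>) xs + (- 1) ^ k * (\<alpha> \<and>\<^sub>\<Lambda> interior v \<beta>) xs)"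
  using wedge_Cons[OF assms[THEN kform_alternating]] by (simp add: interior_def fun_eq_iff)

text \<open>The contracted factor has degree k - 1, whence the sign. Writing it with k keeps the
  formula valid for k = 0, where both sides vanish.\<close>

lemma wedge_interior_Cons:
  assumes "kform k \<alpha>" "kform l \<beta>"
  shows "(interior v \<alpha> \<and>\<^sub>\<Lambda> \<beta>) (w # xs) =
    (interior w (interior v \<alpha>) \<and>\<^sub>\<Lambda> \<beta>) xs - (- 1) ^ k * (interior v \<alpha> \<and>\<^sub>\<Lambda> interior w \<beta>) xs"
proof (cases k)
  case 0
  then have "interior v \<alpha> = (\<lambda>xs. 0)" using assms kform_interior_0 by blast
  then show ?thesis by (simp add: interior_def)
next
  case (Suc k')
  show ?thesis
    using wedge_Cons[OF kform_alternating[OF kform_interior[OF assms(1)[unfolded Suc]]]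
        kform_alternating[OF assms(2)]] Suc by simp
qed

lemma wedge_Cons_interior:
  assumes "kform k \<alpha>" "kform l \<beta>"
  shows "(\<alpha> \<and>\<^sub>\<Lambda> interior v \<beta>) (w # xs) =
    (interior w \<alpha> \<and>\<^sub>\<Lambda> interior v \<beta>) xs + (- 1) ^ k * (\<alpha> \<and>\<^sub>\<Lambda> interior w (interior v \<beta>)) xs"
proof (cases l)
  case 0
  then have "interior v \<beta> = (\<lambda>xs. 0)" using assms kform_interior_0 by blast
  then show ?thesis by (simp add: interior_def)
next
  case (Suc l')
  show ?thesis
    using wedge_Cons[OF kform_alternating[OF assms(1)]
        kform_alternating[OF kform_interior[OF assms(2)[unfolded Suc]]]] by simp
qed

text \<open>Induction on the total degree, since a contraction of the product is a sum of products
  of smaller total degree. When v is inserted twice, the two mixed products of contractions occur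
  with opposite signs.\<close>

lemma kform_wedge:
  assumes "kform k \<alpha>" "kform l \<beta>"
  shows "kform (k + l) (\<alpha> \<and>\<^sub>\<Lambda> \<beta>)"
  using assms
proof (induction "k + l" arbitrary: k l \<alpha> \<beta>)
  case 0
  show ?case
    using wedge_length[OF 0(2,3)[THEN kform_alternating]] 0(1) by (simp add: kform_0I)
next
  case (Suc n)
  note a = Suc.prems(1) and b = Suc.prems(2)
  have "kform n (interior v \<alpha> \<and>\<^sub>\<Lambda> \<beta>)" for v
  proof (cases k)
    case 0 then show ?thesis using a by (simp add: kform_interior_0 kform_zero)
  next
    case (Suc k')
    have "kform (k' + l) (interior v \<alpha> \<and>\<^sub>\<Lambda> \<beta>)"
      using Suc.hyps(2) Suc a b by (intro Suc.hyps(1) kform_interior) auto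
    then show ?thesis using Suc Suc.hyps(2) by simp
  qed
  moreover have "kform n (\<alpha> \<and>\<^sub>\<Lambda> interior v \<beta>)" for v
  proof (cases l)
    case 0 then show ?thesis using b by (simp add: kform_interior_0 kform_zero)
  next
    case (Suc l')
    have "kform (k + l') (\<alpha> \<and>\<^sub>\<Lambda> interior v \<beta>)"
      using Suc.hyps(2) Suc a b by (intro Suc.hyps(1) kform_interior) auto
    then show ?thesis using Suc Suc.hyps(2) by simp
  qed
  ultimately have I: "kform n (interior v (\<alpha> \<and>\<^sub>\<Lambda> \<beta>))" for v
    unfolding interior_wedge[OF a b] by (intro kform_add kform_scale)
  have "kform (Suc n) (\<alpha> \<and>\<^sub>\<Lambda> \<beta>)"
  proof (rule kform_SucI[OF I])
    show "(\<alpha> \<and>\<^sub>\<Lambda> \<beta>) [] = 0"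
      using wedge_length[OF a[THEN kform_alternating] b[THEN kform_alternating], of "[]"] Suc.hyps(2)
      by (cases k) auto
    show "linear (\<lambda>v. (\<alpha> \<and>\<^sub>\<Lambda> \<beta>) (v # xs))" for xs
      by (rule linearI)
        (simp_all add: wedge_Cons[OF a[THEN kform_alternating] b[THEN kform_alternating]]
          interior_add[OF a] interior_add[OF b] interior_scale[OF a] interior_scale[OF b]
          wedge_linear algebra_simps)
    show "(\<alpha> \<and>\<^sub>\<Lambda> \<beta>) (v # v # xs) = 0" for v xs
      by (simp add: wedge_Cons[OF a[THEN kform_alternating] b[THEN kform_alternating]]
          wedge_interior_Cons[OF a b] wedge_Cons_interior[OF a b]
          interior_twice[OF a] interior_twice[OF b] algebra_simps)
  qed
  then show ?case using Suc.hyps(2) by simp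
qed

section \<open>Endomorphisms acting on forms as derivations\<close>

lemma endo_act_Cons: "endo_act A \<alpha> (v # xs) = \<alpha> (A v # xs) + endo_act A (interior v \<alpha>) xs"
  by (simp add: endo_act_def interior_def sum.lessThan_Suc_shift del: sum.lessThan_Suc)

lemma endo_act_Nil: "endo_act A \<alpha> [] = 0"
  by (simp add: endo_act_def)

lemma interior_endo_act:
  "interior v (endo_act A \<alpha>) = (\<lambda>xs. interior (A v) \<alpha> xs + endo_act A (interior v \<alpha>) xs)"
  by (rule ext) (simp add: interior_def endo_act_Cons)

lemma endo_act_zero [simp]: "endo_act A (\<lambda>xs. 0) = (\<lambda>xs. 0)"
  by (rule ext) (simp add: endo_act_def)

lemma endo_act_add: "endo_act A (\<lambda>xs. \<alpha> xs + \<beta> xs) = (\<lambda>xs. endo_act A \<alpha> xs + endo_act A \<beta> xs)"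
  by (rule ext) (simp add: endo_act_def sum.distrib)

lemma endo_act_scale: "endo_act A (\<lambda>xs. c * \<alpha> xs) = (\<lambda>xs. c * endo_act A \<alpha> xs)"
  by (rule ext) (simp add: endo_act_def sum_distrib_left)

lemma kform_endo_act:
  assumes "linear A" "kform k \<alpha>"
  shows "kform k (endo_act A \<alpha>)"
  using assms(2)
proof (induction k arbitrary: \<alpha>)
  case 0
  then show ?case by (intro kform_0I) (simp add: endo_act_def kform_length[OF 0])
next
  case (Suc k)
  note a = Suc.prems
  have l: "linear (\<lambda>v. \<alpha> (A v # xs))" for xs
    using linear_compose[OF assms(1) kform_linear_Cons[OF a]] by (simp add: o_def)
  show ?case
  proof (rule kform_SucI)
    show "kform k (interior v (endo_act A \<alpha>))" for v
      unfolding interior_endo_act by (intro kform_add kform_interior a Suc.IH)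
    show "linear (\<lambda>v. endo_act A \<alpha> (v # xs))" for xs
      by (rule linearI) (simp_all add: endo_act_Cons linear_add[OF l] linear_scale[OF l]
          interior_add[OF a] interior_scale[OF a] endo_act_add endo_act_scale algebra_simps)
    show "endo_act A \<alpha> (v # v # xs) = 0" for v xs
      using kform_swap[OF a, of "A v" v xs]
      by (simp add: endo_act_Cons interior_twice[OF a]) (simp add: interior_def)
  qed (simp add: endo_act_def)
qed

text \<open>Contracting with v after the action of \<open>A\<close> differs from contracting before
  it by the contraction with \<open>A v\<close>. Hence both sides have the same contractions by
  induction on the total degree.\<close>

lemma endo_act_wedge:
  assumes "linear A" "kform k \<alpha>" "kform l \<beta>"
  shows "endo_act A (\<alpha> \<and>\<^sub>\<Lambda> \<beta>) = (\<lambda>xs. (endo_act A \<alpha> \<and>\<^sub>\<Lambda> \<beta>) xs + (\<alpha> \<and>\<^sub>\<Lambda> endo_act A \<beta>) xs)"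
  using assms(2,3)
proof (induction "k + l" arbitrary: k l \<alpha> \<beta> rule: less_induct)
  case less
  note a = less.prems(1) and b = less.prems(2)
  have L: "endo_act A (interior v \<alpha> \<and>\<^sub>\<Lambda> \<beta>) =
      (\<lambda>xs. (endo_act A (interior v \<alpha>) \<and>\<^sub>\<Lambda> \<beta>) xs + (interior v \<alpha> \<and>\<^sub>\<Lambda> endo_act A \<beta>) xs)" for v
  proof (cases k)
    case 0 then show ?thesis using a by (simp add: kform_interior_0)
  next
    case (Suc k')
    show ?thesis using Suc a b by (intro less.hyps[of k' l] kform_interior) auto
  qed
  have R: "endo_act A (\<alpha> \<and>\<^sub>\<Lambda> interior v \<beta>) =
      (\<lambda>xs. (endo_act A \<alpha> \<and>\<^sub>\<Lambda> interior v \<beta>) xs + (\<alpha> \<and>\<^sub>\<Lambda> endo_act A (interior v \<beta>)) xs)" for v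
  proof (cases l)
    case 0 then show ?thesis using b by (simp add: kform_interior_0)
  next
    case (Suc l')
    show ?thesis using Suc a b by (intro less.hyps[of k l'] kform_interior) auto
  qed
  show ?case
  proof (rule form_ext)
    show "endo_act A (\<alpha> \<and>\<^sub>\<Lambda> \<beta>) [] = (endo_act A \<alpha> \<and>\<^sub>\<Lambda> \<beta>) [] + (\<alpha> \<and>\<^sub>\<Lambda> endo_act A \<beta>) []"
      by (simp add: endo_act_def wedge_Nil)
    have add: "interior v (\<lambda>xs. \<gamma> xs + \<delta> xs) = (\<lambda>xs. interior v \<gamma> xs + interior v \<delta> xs)"
      for v and \<gamma> \<delta> :: "'a form" by (simp add: interior_def)
    show "interior v (endo_act A (\<alpha> \<and>\<^sub>\<Lambda> \<beta>)) =
        interior v (\<lambda>xs. (endo_act A \<alpha> \<and>\<^sub>\<Lambda> \<beta>) xs + (\<alpha> \<and>\<^sub>\<Lambda> endo_act A \<beta>) xs)" for v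
      unfolding add interior_endo_act interior_wedge[OF a b] endo_act_add endo_act_scale L R
        interior_wedge[OF kform_endo_act[OF assms(1) a] b] wedge_linear
        interior_wedge[OF a kform_endo_act[OF assms(1) b]]
      by (simp add: algebra_simps)
  qed
qed

section \<open>Cartan's formula and the Leibniz rule\<close>

lemma nths_Compl_nth: "j < length xs \<Longrightarrow> nths xs (- {j}) = take j xs @ drop (Suc j) xs"
proof (induction xs arbitrary: j)
  case (Cons x xs)
  show ?case
  proof (cases j)
    case 0
    have "nths xs {j. Suc j \<noteq> 0} = xs" by (simp add: nths_all)
    then show ?thesis using 0 by (simp add: nths_Cons)
  next
    case (Suc i)
    have "{j. Suc j \<noteq> Suc i} = - {i}" by auto
    then show ?thesis using Suc Cons by (simp add: nths_Cons)
  qed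
qed simp

text \<open>Cartan's formula \<open>\<iota>\<^sub>x d + d \<iota>\<^sub>x = L\<^sub>x\<close>, where \<open>L\<^sub>x = - (ad x)\<^sup>*\<close> on forms.\<close>

lemma interior_ce_diff:
  assumes "kform k \<alpha>"
  shows "interior x (ce_diff br \<alpha>) = (\<lambda>xs. - endo_act (br x) \<alpha> xs - ce_diff br (interior x \<alpha>) xs)"
proof
  fix ys :: "'a list"
  let ?n = "length ys"
  let ?T = "\<lambda>i j. (- 1) ^ (i + j) *
    \<alpha> (br ((x # ys) ! i) ((x # ys) ! j) # nths (x # ys) (- {i, j}))"
  \<comment> \<open>Pairs containing the new head x: the bracket stands first, and carrying it back
    to slot j costs (-1)^j, which leaves minus a summand of \<open>endo_act\<close>.\<close>
  have T0: "?T 0 (Suc j) = - \<alpha> (ys[j := br x (ys ! j)])" if "j < ?n" for j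
  proof -
    have "{i. Suc i \<noteq> 0 \<and> Suc i \<noteq> Suc j} = - {j}" by auto
    then have "nths (x # ys) (- {0, Suc j}) = take j ys @ drop (Suc j) ys"
      using nths_Compl_nth[OF that] by (simp add: nths_Cons)
    moreover have "\<alpha> (ys[j := br x (ys ! j)]) = (- 1) ^ j * \<alpha> (br x (ys ! j) # take j ys @ drop (Suc j) ys)"
      using alternating_move[OF kform_alternating[OF assms], of "take j ys"] that
      by (simp add: upd_conv_take_nth_drop min_def)
    ultimately show ?thesis by simp
  qed
  \<comment> \<open>Both indices shift by one, so their parity is kept; the minus sign comes from
    exchanging x with the bracket.\<close>
  have T1: "?T (Suc i) (Suc j) = - ((- 1) ^ (i + j) *
     interior x \<alpha> (br (ys ! i) (ys ! j) # nths ys (- {i, j})))" for i j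
  proof -
    have "{k. Suc k \<noteq> Suc i \<and> Suc k \<noteq> Suc j} = - {i, j}" by auto
    then show ?thesis
      using kform_swap[OF assms, of x "br (ys ! i) (ys ! j)"] by (simp add: nths_Cons interior_def)
  qed
  have "ce_diff br \<alpha> (x # ys) = (\<Sum>j<Suc ?n. \<Sum>i<j. ?T i j)"
    unfolding ce_diff_def by simp
  also have "\<dots> = (\<Sum>j<?n. ?T 0 (Suc j) + (\<Sum>i<j. ?T (Suc i) (Suc j)))"
    unfolding sum.lessThan_Suc_shift by (simp only: sum.lessThan_Suc_shift lessThan_0 sum.empty add_0_left)
  also have "\<dots> = (\<Sum>j<?n. - \<alpha> (ys[j := br x (ys ! j)]) + (\<Sum>i<j. - ((- 1) ^ (i + j) *
     interior x \<alpha> (br (ys ! i) (ys ! j) # nths ys (- {i, j})))))"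
    using T0 T1 by (intro sum.cong refl arg_cong2[where f = plus]) auto
  also have "\<dots> = - endo_act (br x) \<alpha> ys - ce_diff br (interior x \<alpha>) ys"
    by (simp add: endo_act_def ce_diff_def sum.distrib sum_negf sum_subtractf)
  finally show "interior x (ce_diff br \<alpha>) ys = - endo_act (br x) \<alpha> ys - ce_diff br (interior x \<alpha>) ys"
    by (simp add: interior_def)
qed

lemma ce_diff_Nil: "ce_diff br \<alpha> [] = 0"
  by (simp add: ce_diff_def)

lemma ce_diff_zero [simp]: "ce_diff br (\<lambda>xs. 0) = (\<lambda>xs. 0)"
  by (rule ext) (simp add: ce_diff_def)

lemma ce_diff_add: "ce_diff br (\<lambda>xs. \<alpha> xs + \<beta> xs) = (\<lambda>xs. ce_diff br \<alpha> xs + ce_diff br \<beta> xs)"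
  by (rule ext) (simp add: ce_diff_def sum.distrib distrib_left)

lemma ce_diff_scale: "ce_diff br (\<lambda>xs. c * \<alpha> xs) = (\<lambda>xs. c * ce_diff br \<alpha> xs)"
  by (rule ext) (simp add: ce_diff_def sum_distrib_left mult_ac)

lemma linear_right_bilinear: "bilinear br \<Longrightarrow> linear (br x)"
  by (simp add: bilinear_def)

text \<open>Cartan's formula expresses the differential through \<open>endo_act\<close> and the
  differential of a contraction, so multilinearity follows by induction on the degree. On v, v it is
  applied twice: the terms with \<open>endo_act (br v)\<close> cancel, and [v, v] = 0 removes what
  is left.\<close>

lemma kform_ce_diff:
  assumes br: "bilinear br" "\<And>x. br x x = 0" and "kform k \<alpha>"
  shows "kform (Suc k) (ce_diff br \<alpha>)"
proof -
  have step: "kform (Suc k) (ce_diff br \<alpha>)"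
    if a: "kform k \<alpha>" and I: "\<And>v. kform k (ce_diff br (interior v \<alpha>))" for k \<alpha>
  proof -
  have C: "ce_diff br \<alpha> (v # xs) = - endo_act (br v) \<alpha> xs - ce_diff br (interior v \<alpha>) xs" for v xs
    using interior_ce_diff[OF a, of v br] by (simp add: interior_def fun_eq_iff)
  have lin: "linear (\<lambda>v. endo_act (br v) \<alpha> xs)" for xs
    unfolding endo_act_def
  proof (rule linear_compose_sum, rule ballI)
    fix i assume "i \<in> {..<length xs}"
    then have "i < length xs" by simp
    have "linear (\<lambda>v. br v (xs ! i))" using br(1) by (simp add: bilinear_def)
    from linear_compose[OF this kform_linear[OF a]] \<open>i < length xs\<close>
    show "linear (\<lambda>v. \<alpha> (xs[i := br v (xs ! i)]))" by (simp add: o_def upd_conv_take_nth_drop)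
  qed
  show ?thesis
  proof (rule kform_SucI)
    show "kform k (interior v (ce_diff br \<alpha>))" for v
      unfolding interior_ce_diff[OF a]
      by (intro kform_diff kform_minus kform_endo_act a I linear_right_bilinear br(1))
    show "linear (\<lambda>v. ce_diff br \<alpha> (v # xs))" for xs
      by (rule linearI) (simp_all add: C linear_add[OF lin] linear_scale[OF lin] interior_add[OF a]
          interior_scale[OF a] ce_diff_add ce_diff_scale algebra_simps)
    show "ce_diff br \<alpha> (v # v # xs) = 0" for v xs
    proof (cases k)
      case 0
      then have z: "interior u \<alpha> = (\<lambda>xs. 0)" for u using a kform_interior_0 by blast
      then have "\<alpha> (u # xs) = 0" for u xs using z[of u] by (simp add: interior_def fun_eq_iff)
      then show ?thesis by (simp add: C z endo_act_Cons)
    next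
      case (Suc k')
      have "ce_diff br (interior v \<alpha>) (v # xs) = - endo_act (br v) (interior v \<alpha>) xs"
        using fun_cong[OF interior_ce_diff[OF kform_interior[OF a[unfolded Suc]]], of v br v xs]
        by (simp add: interior_twice[OF a]) (simp add: interior_def)
      then show ?thesis
        using linear_0[OF kform_linear_Cons[OF a]] by (simp add: C endo_act_Cons br(2))
    qed
  qed (simp add: ce_diff_Nil)
  qed
  show ?thesis using assms(3)
  proof (induction k arbitrary: \<alpha>)
    case 0
    show ?case by (rule step[OF 0]) (simp add: kform_interior_0[OF 0] kform_zero)
  next
    case (Suc k)
    show ?case by (rule step[OF Suc.prems Suc.IH[OF kform_interior[OF Suc.prems]]])
  qed
qed

text \<open>By Cartan's formula the contractions of both sides reduce to the claim in lower total
  degree; the Lie derivative terms agree because \<open>endo_act\<close> is a derivation of the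
  wedge product.\<close>

lemma ce_diff_wedge:
  assumes br: "bilinear br" "\<And>x. br x x = 0" and "kform k \<alpha>" "kform l \<beta>"
  shows "ce_diff br (\<alpha> \<and>\<^sub>\<Lambda> \<beta>) =
    (\<lambda>xs. (ce_diff br \<alpha> \<and>\<^sub>\<Lambda> \<beta>) xs + (- 1) ^ k * (\<alpha> \<and>\<^sub>\<Lambda> ce_diff br \<beta>) xs)"
  using assms(3,4)
proof (induction "k + l" arbitrary: k l \<alpha> \<beta> rule: less_induct)
  case less
  note a = less.prems(1) and b = less.prems(2)
  have L: "ce_diff br (interior v \<alpha> \<and>\<^sub>\<Lambda> \<beta>) =
      (\<lambda>xs. (ce_diff br (interior v \<alpha>) \<and>\<^sub>\<Lambda> \<beta>) xs -
         (- 1) ^ k * (interior v \<alpha> \<and>\<^sub>\<Lambda> ce_diff br \<beta>) xs)" for v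
  proof (cases k)
    case 0 then show ?thesis using a by (simp add: kform_interior_0)
  next
    case (Suc k')
    then have "ce_diff br (interior v \<alpha> \<and>\<^sub>\<Lambda> \<beta>) =
      (\<lambda>xs. (ce_diff br (interior v \<alpha>) \<and>\<^sub>\<Lambda> \<beta>) xs +
         (- 1) ^ k' * (interior v \<alpha> \<and>\<^sub>\<Lambda> ce_diff br \<beta>) xs)"
      using a b by (intro less.hyps[of k' l] kform_interior) auto
    then show ?thesis using Suc by simp
  qed
  have R: "ce_diff br (\<alpha> \<and>\<^sub>\<Lambda> interior v \<beta>) =
      (\<lambda>xs. (ce_diff br \<alpha> \<and>\<^sub>\<Lambda> interior v \<beta>) xs +
         (- 1) ^ k * (\<alpha> \<and>\<^sub>\<Lambda> ce_diff br (interior v \<beta>)) xs)" for v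
  proof (cases l)
    case 0 then show ?thesis using b by (simp add: kform_interior_0)
  next
    case (Suc l')
    then show ?thesis using a b by (intro less.hyps[of k l'] kform_interior) auto
  qed
  show ?case
  proof (rule form_ext)
    show "ce_diff br (\<alpha> \<and>\<^sub>\<Lambda> \<beta>) [] =
        (ce_diff br \<alpha> \<and>\<^sub>\<Lambda> \<beta>) [] + (- 1) ^ k * (\<alpha> \<and>\<^sub>\<Lambda> ce_diff br \<beta>) []"
      by (simp add: ce_diff_Nil wedge_Nil)
    have add: "interior v (\<lambda>xs. \<gamma> xs + c * \<delta> xs) = (\<lambda>xs. interior v \<gamma> xs + c * interior v \<delta> xs)"
      for v c and \<gamma> \<delta> :: "'a form" by (simp add: interior_def)
    show "interior v (ce_diff br (\<alpha> \<and>\<^sub>\<Lambda> \<beta>)) =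
        interior v (\<lambda>xs. (ce_diff br \<alpha> \<and>\<^sub>\<Lambda> \<beta>) xs + (- 1) ^ k * (\<alpha> \<and>\<^sub>\<Lambda> ce_diff br \<beta>) xs)" for v
      unfolding add interior_ce_diff[OF kform_wedge[OF a b]] interior_wedge[OF a b]
        ce_diff_add ce_diff_scale L R endo_act_wedge[OF linear_right_bilinear[OF br(1)] a b]
        interior_wedge[OF kform_ce_diff[OF br a] b] interior_wedge[OF a kform_ce_diff[OF br b]]
        interior_ce_diff[OF a] interior_ce_diff[OF b] wedge_linear
      by (simp add: algebra_simps flip: power_mult_distrib)
  qed
qed

section \<open>Bases, traces and top-degree forms\<close>

definition basis_list :: "'a::real_vector list \<Rightarrow> bool" where
  "basis_list es \<longleftrightarrow> distinct es \<and> independent (set es) \<and> span (set es) = UNIV"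

definition coord :: "'a::real_vector list \<Rightarrow> nat \<Rightarrow> 'a \<Rightarrow> real" where
  "coord es i x = representation (set es) x (es ! i)"

lemma basis_list_length:
  fixes es :: "'a::real_vector list"
  shows "basis_list es \<Longrightarrow> length es = dim (UNIV :: 'a set)"
  unfolding basis_list_def using real_vector.dim_eq_card[of "set es" UNIV] distinct_card[of es] by simp

lemma coord_expand:
  assumes "basis_list es"
  shows "(\<Sum>i<length es. coord es i x *\<^sub>R es ! i) = x"
proof -
  have "(\<Sum>i<length es. coord es i x *\<^sub>R es ! i) = (\<Sum>b\<in>set es. representation (set es) x b *\<^sub>R b)"
    unfolding coord_def
    by (rule sum.reindex_bij_betw[where g = "\<lambda>b. representation (set es) x b *\<^sub>R b"])
      (use assms in \<open>simp add: basis_list_def bij_betw_nth\<close>)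
  also have "\<dots> = x"
    by (rule real_vector.sum_representation_eq) (use assms in \<open>auto simp: basis_list_def\<close>)
  finally show ?thesis .
qed

lemma linear_coord: "basis_list es \<Longrightarrow> linear (coord es i)"
  unfolding coord_def basis_list_def
  by (rule linearI) (simp_all add: real_vector.representation_add real_vector.representation_scale)

lemma coord_nth:
  "basis_list es \<Longrightarrow> i < length es \<Longrightarrow> j < length es \<Longrightarrow> coord es i (es ! j) = (if i = j then 1 else 0)"
  unfolding coord_def basis_list_def
  by (simp add: real_vector.representation_basis nth_eq_iff_index_eq)

text \<open>\<open>dim\<close> is the cardinality of a basis and \<open>card\<close> is 0 on
  infinite sets, so a positive dimension is a finite one.\<close>

lemma finite_basis_exists:
  assumes "dim (UNIV :: 'a::real_vector set) > 0"
  obtains B :: "'a::real_vector set" where "finite B" "independent B" "span B = UNIV" "card B = dim (UNIV :: 'a::real_vector set)"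
proof -
  obtain B :: "'a set" where "independent B" "UNIV \<subseteq> span B" "card B = dim (UNIV :: 'a set)"
    using real_vector.basis_exists[of UNIV] by metis
  moreover from this have "finite B" using assms card_ge_0_finite by metis
  ultimately show ?thesis using that by blast
qed

lemma basis_listI:
  fixes es :: "'a::real_vector list"
  assumes "dim (UNIV :: 'a set) = length es" "es \<noteq> []" "distinct es" "independent (set es)"
  shows "basis_list es"
proof -
  have "span (set es) = UNIV"
  proof (rule ccontr)
    assume "span (set es) \<noteq> UNIV"
    then obtain x where x: "x \<notin> span (set es)" by blast
    obtain B :: "'a set" where B: "finite B" "span B = UNIV" "card B = dim (UNIV :: 'a set)"
      using finite_basis_exists assms by (metis length_greater_0_conv)
    have "independent (insert x (set es))"
      using assms(4) x by (simp add: real_vector.independent_insert)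
    then have "card (insert x (set es)) \<le> card B"
      using real_vector.independent_span_bound[OF B(1)] B(2) by blast
    moreover have "x \<notin> set es" using x real_vector.span_base by blast
    ultimately show False using B(3) assms(1,3) by (simp add: distinct_card)
  qed
  then show ?thesis using assms by (simp add: basis_list_def)
qed

lemma exists_not_in_span:
  fixes S :: "'a::real_vector set"
  assumes "card S < dim (UNIV :: 'a set)" "finite S"
  shows "\<exists>x. x \<notin> span S"
proof (rule ccontr)
  assume "\<nexists>x. x \<notin> span S"
  then have "UNIV \<subseteq> span S" by blast
  then show False using real_vector.dim_le_card[of UNIV S] assms by simp
qed

lemma independent_basis_list_extend:
  fixes S :: "'a::real_vector list"
  assumes "independent (set S)" "distinct S" "dim (UNIV :: 'a set) > 0"
  shows "\<exists>T. basis_list (S @ T)"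
proof -
  obtain B :: "'a set" where B: "finite B" "span B = UNIV"
    using finite_basis_exists assms(3) by metis
  obtain C where C: "set S \<subseteq> C" "C \<subseteq> set S \<union> B" "independent C" "set S \<union> B \<subseteq> span C"
    using real_vector.maximal_independent_subset_extend[of "set S" "set S \<union> B"] assms(1) by auto
  have "span C = UNIV"
    using B(2) C(4) by (metis Un_subset_iff real_vector.span_mono real_vector.span_span top.extremum_uniqueI)
  moreover have "finite C" using C(2) B(1) finite_subset by blast
  then obtain T where "set T = C - set S" "distinct T"
    using finite_distinct_list[of "C - set S"] by auto
  ultimately have "basis_list (S @ T)"
    using assms(2) C by (auto simp: basis_list_def Un_absorb1)
  then show ?thesis by blast
qed

text \<open>\<open>lin_trace\<close> uses whichever basis \<open>extend_basis {}\<close> selects.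
  Expanding f b in the e i, and each e i in that basis, and exchanging the sums gives the trace in
  any other coordinates.\<close>

lemma lin_trace_coords:
  fixes f :: "'a::real_vector \<Rightarrow> 'a"
  assumes "finite I" "linear f" "\<And>i. i \<in> I \<Longrightarrow> linear (\<epsilon> i)" "\<And>x. (\<Sum>i\<in>I. \<epsilon> i x *\<^sub>R e i) = x"
  shows "lin_trace f = (\<Sum>i\<in>I. \<epsilon> i (f (e i)))"
proof -
  define B :: "'a set" where "B = extend_basis {}"
  have ind: "independent B" and sp: "span B = UNIV"
    using real_vector.independent_extend_basis[of "{}"] real_vector.span_extend_basis[of "{}"]
    by (auto simp: B_def real_vector.independent_empty)
  have "x \<in> span (e ` I)" for x
  proof -
    have "(\<Sum>i\<in>I. \<epsilon> i x *\<^sub>R e i) \<in> span (e ` I)"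
      by (intro real_vector.span_sum real_vector.span_scale real_vector.span_base) auto
    then show ?thesis using assms(4) by simp
  qed
  then have fin: "finite B"
    using real_vector.independent_span_bound[of "e ` I" B] ind assms(1) by blast
  have lin_r: "linear (\<lambda>x. representation B x b)" for b
    by (rule linearI) (simp_all add: real_vector.representation_add real_vector.representation_scale ind sp)
  have "lin_trace f = (\<Sum>b\<in>B. representation B (\<Sum>i\<in>I. \<epsilon> i (f b) *\<^sub>R e i) b)"
    unfolding lin_trace_def Let_def B_def[symmetric] using assms(4) by simp
  also have "\<dots> = (\<Sum>b\<in>B. \<Sum>i\<in>I. \<epsilon> i (f b) * representation B (e i) b)"
    by (simp add: linear_sum[OF lin_r] linear_scale[OF lin_r])
  also have "\<dots> = (\<Sum>i\<in>I. \<Sum>b\<in>B. \<epsilon> i (f b) * representation B (e i) b)"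
    by (rule sum.swap)
  also have "\<dots> = (\<Sum>i\<in>I. \<epsilon> i (f (e i)))"
  proof (rule sum.cong[OF refl])
    fix i assume "i \<in> I"
    then have l: "linear (\<lambda>x. \<epsilon> i (f x))"
      using linear_compose[OF assms(2), of "\<epsilon> i"] assms(3) by (simp add: o_def)
    have "\<epsilon> i (f (e i)) = \<epsilon> i (f (\<Sum>b\<in>B. representation B (e i) b *\<^sub>R b))"
      by (subst real_vector.sum_representation_eq) (use ind sp fin in auto)
    also have "\<dots> = (\<Sum>b\<in>B. \<epsilon> i (f b) * representation B (e i) b)"
      by (simp add: linear_sum[OF l] linear_scale[OF l] mult.commute)
    finally show "(\<Sum>b\<in>B. \<epsilon> i (f b) * representation B (e i) b) = \<epsilon> i (f (e i))" by simp
  qed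
  finally show ?thesis .
qed

lemma lin_trace_basis_list:
  "basis_list es \<Longrightarrow> linear f \<Longrightarrow> lin_trace f = (\<Sum>i<length es. coord es i (f (es ! i)))"
  by (rule lin_trace_coords) (auto simp: linear_coord coord_expand)

section \<open>Forms determined by their values on a spanning list\<close>

lemma kform_interior_ex: "kform k \<alpha> \<Longrightarrow> \<exists>j. kform j (interior v \<alpha>)"
proof (cases k)
  case 0
  assume "kform k \<alpha>"
  then show ?thesis using 0 kform_interior_0[of \<alpha> v] kform_zero[of 0] by auto
next
  case (Suc j)
  assume "kform k \<alpha>"
  then show ?thesis using Suc kform_interior by blast
qed

text \<open>Agreement on every sublist of \<open>es\<close> in the given order, that is, in all
  components with increasing indices. The recursion unfolds by simplification on an explicit
  frame.\<close>

primrec forms_agree :: "'a list \<Rightarrow> 'a form \<Rightarrow> 'a form \<Rightarrow> bool" where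
  "forms_agree [] \<alpha> \<beta> \<longleftrightarrow> \<alpha> [] = \<beta> []"
| "forms_agree (e # es) \<alpha> \<beta> \<longleftrightarrow> forms_agree es \<alpha> \<beta> \<and> forms_agree es (interior e \<alpha>) (interior e \<beta>)"

lemma forms_agree_diff:
  "forms_agree es \<alpha> \<beta> \<longleftrightarrow> forms_agree es (\<lambda>xs. \<alpha> xs - \<beta> xs) (\<lambda>xs. 0)"
proof (induction es arbitrary: \<alpha> \<beta>)
  case (Cons e es)
  show ?case unfolding forms_agree.simps interior_def
    using Cons[of \<alpha> \<beta>] Cons[of "\<lambda>xs. \<alpha> (e # xs)" "\<lambda>xs. \<beta> (e # xs)"] by simp
qed simp

text \<open>Every argument is a multiple of e plus an element of S. By multilinearity only entries e
  and entries from S matter; one e can be brought to the front, and a second one gives zero.\<close>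

lemma kform_vanish_insert:
  assumes "subspace S" "kform k \<alpha>"
    "\<And>xs. set xs \<subseteq> S \<Longrightarrow> \<alpha> xs = 0" "\<And>xs. set xs \<subseteq> S \<Longrightarrow> \<alpha> (e # xs) = 0"
    "\<And>x. x \<in> set xs \<Longrightarrow> \<exists>c. x - c *\<^sub>R e \<in> S"
  shows "\<alpha> xs = 0"
  using assms(2-)
proof (induction xs arbitrary: k \<alpha>)
  case (Cons x xs)
  note a = Cons.prems(1) and S0 = Cons.prems(2) and S1 = Cons.prems(3)
  obtain c where c: "x - c *\<^sub>R e \<in> S" using Cons.prems(4) by force
  define s where "s = x - c *\<^sub>R e"
  have x: "x = c *\<^sub>R e + s" by (simp add: s_def)
  have tail: "\<exists>c. y - c *\<^sub>R e \<in> S" if "y \<in> set xs" for y using that Cons.prems(4) by simp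
  have e: "\<alpha> (e # xs) = 0"
  proof -
    obtain j where "kform j (interior e \<alpha>)" using kform_interior_ex[OF a] by blast
    from Cons.IH[OF this] have "interior e \<alpha> xs = 0"
      using S1 tail kform_repeat[OF a] by (simp add: interior_def)
    then show ?thesis by (simp add: interior_def)
  qed
  have s: "\<alpha> (s # xs) = 0"
  proof -
    obtain j where "kform j (interior s \<alpha>)" using kform_interior_ex[OF a] by blast
    from Cons.IH[OF this] have "interior s \<alpha> xs = 0"
      using S0 S1 tail kform_swap[OF a, of s e] c by (simp add: interior_def s_def)
    then show ?thesis by (simp add: interior_def)
  qed
  show ?case unfolding x
    using e s linear_add[OF kform_linear_Cons[OF a]] linear_scale[OF kform_linear_Cons[OF a]] by simp
qed (auto dest: spec[of _ "[]"])

lemma kform_vanish_span: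
  assumes "kform k \<alpha>" "forms_agree es \<alpha> (\<lambda>xs. 0)" "set xs \<subseteq> span (set es)"
  shows "\<alpha> xs = 0"
  using assms
proof (induction es arbitrary: k \<alpha> xs)
  case Nil
  show ?case
  proof (cases xs)
    case (Cons x ys)
    then have "x = 0" using Nil by simp
    then show ?thesis using Cons linear_0[OF kform_linear_Cons[OF Nil(1)]] by simp
  qed (use Nil in simp)
next
  case (Cons e es)
  have z: "interior e (\<lambda>xs. 0) = (\<lambda>xs. 0)" by (simp add: interior_def)
  obtain j where j: "kform j (interior e \<alpha>)" using kform_interior_ex[OF Cons.prems(1)] by blast
  have "\<alpha> (e # ys) = 0" if "set ys \<subseteq> span (set es)" for ys
    using Cons.IH[OF j _ that] Cons.prems(2) z by (simp add: interior_def)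
  moreover have "\<alpha> ys = 0" if "set ys \<subseteq> span (set es)" for ys
    using Cons.IH[OF Cons.prems(1) _ that] Cons.prems(2) by simp
  moreover have "\<exists>c. x - c *\<^sub>R e \<in> span (set es)" if "x \<in> set xs" for x
    using that Cons.prems(3) real_vector.span_breakdown_eq[of x e "set es"] by auto
  ultimately show ?case
    using kform_vanish_insert[OF real_vector.subspace_span Cons.prems(1)] by blast
qed

lemma kform_eqI:
  assumes "kform k \<alpha>" "kform k \<beta>" "span (set es) = UNIV" "forms_agree es \<alpha> \<beta>"
  shows "\<alpha> = \<beta>"
proof
  fix xs
  have "\<alpha> xs - \<beta> xs = 0"
    using kform_vanish_span[OF kform_diff[OF assms(1,2)], of es xs] assms(3,4) forms_agree_diff by blast
  then show "\<alpha> xs = \<beta> xs" by simp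
qed

lemma forms_agree_short:
  "(\<And>xs. length xs \<le> length es \<Longrightarrow> \<alpha> xs = \<beta> xs) \<Longrightarrow> forms_agree es \<alpha> \<beta>"
  by (induction es arbitrary: \<alpha> \<beta>) (simp_all add: interior_def)

lemma forms_agree_top:
  "(\<And>xs. length xs < length es \<Longrightarrow> \<alpha> xs = \<beta> xs) \<Longrightarrow> \<alpha> es = \<beta> es \<Longrightarrow> forms_agree es \<alpha> \<beta>"
  by (induction es arbitrary: \<alpha> \<beta>) (simp_all add: interior_def forms_agree_short)

lemma top_form_eqI:
  assumes "kform (length es) \<alpha>" "kform (length es) \<beta>" "span (set es) = UNIV" "\<alpha> es = \<beta> es"
  shows "\<alpha> = \<beta>"
proof (rule kform_eqI[OF assms(1-3)], rule forms_agree_top)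
  show "\<alpha> xs = \<beta> xs" if "length xs < length es" for xs
    using kform_length[OF assms(1), of xs] kform_length[OF assms(2), of xs] that by simp
qed fact

lemma kform_above_dim:
  fixes es :: "'a::real_vector list" and \<alpha> :: "'a form"
  assumes "kform k \<alpha>" "span (set es) = UNIV" "length es < k"
  shows "\<alpha> = (\<lambda>xs. 0)"
proof (rule kform_eqI[OF assms(1) kform_zero assms(2)])
  show "forms_agree es \<alpha> (\<lambda>xs. 0)"
    using assms(3) kform_length[OF assms(1)] by (intro forms_agree_short) auto
qed

text \<open>In slot i only the component of A (e_i) along e_i survives: any other basis vector would
  be repeated.\<close>

lemma endo_act_top:
  fixes es :: "'a::real_vector list" and A :: "'a \<Rightarrow> 'a"
  assumes "basis_list es" "linear A" "kform (length es) \<alpha>"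
  shows "endo_act A \<alpha> = (\<lambda>xs. lin_trace A * \<alpha> xs)"
proof (rule top_form_eqI[of es])
  show "kform (length es) (endo_act A \<alpha>)" "kform (length es) (\<lambda>xs. lin_trace A * \<alpha> xs)"
    using assms(2,3) by (simp_all add: kform_endo_act kform_scale)
  show "span (set es) = UNIV" using assms(1) by (simp add: basis_list_def)
  have "\<alpha> (es[i := A (es ! i)]) = coord es i (A (es ! i)) * \<alpha> es" if i: "i < length es" for i
  proof -
    have l: "linear (\<lambda>v. \<alpha> (es[i := v]))"
      using kform_linear[OF assms(3), of "take i es" "drop (Suc i) es"] i
      by (simp add: upd_conv_take_nth_drop)
    have z: "\<alpha> (es[i := es ! j]) = (if j = i then \<alpha> es else 0)" if "j < length es" for j
    proof (cases "j = i")
      case False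
      then have "\<not> distinct (es[i := es ! j])"
        using i that by (metis distinct_conv_nth length_list_update nth_list_update_eq nth_list_update_neq)
      then show ?thesis using False assms(3) by (simp add: kform_def)
    qed simp
    have "\<alpha> (es[i := A (es ! i)]) = \<alpha> (es[i := \<Sum>j<length es. coord es j (A (es ! i)) *\<^sub>R es ! j])"
      by (simp add: coord_expand[OF assms(1)])
    also have "\<dots> = (\<Sum>j<length es. coord es j (A (es ! i)) * \<alpha> (es[i := es ! j]))"
      by (simp add: linear_sum[OF l] linear_scale[OF l])
    also have "\<dots> = (\<Sum>j<length es. if j = i then coord es j (A (es ! i)) * \<alpha> es else 0)"
      by (intro sum.cong refl) (simp add: z)
    also have "\<dots> = coord es i (A (es ! i)) * \<alpha> es" using i by simp
    finally show ?thesis .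
  qed
  then show "endo_act A \<alpha> es = lin_trace A * \<alpha> es"
    by (simp add: endo_act_def lin_trace_basis_list[OF assms(1,2)] sum_distrib_right)
qed

lemma kform_append: "kform (length us + m) V \<Longrightarrow> kform m (\<lambda>ys. V (us @ ys))"
proof (induction us arbitrary: V)
  case (Cons u us)
  then have "kform (length us + m) (interior u V)" by (intro kform_interior) simp
  from Cons.IH[OF this] show ?case by (simp add: interior_def)
qed simp

lemma interior_append: "interior x (\<lambda>ys. V (us @ ys)) = (\<lambda>ys. V ((us @ [x]) @ ys))"
  by (simp add: interior_def)

lemma alternating_interior_ex: "alternating k \<alpha> \<Longrightarrow> \<exists>j. alternating j (interior v \<alpha>)"
proof (cases k)
  case 0
  assume "alternating k \<alpha>"
  then have "interior v \<alpha> = (\<lambda>xs. 0)" using 0 interior_0[of \<alpha> v] by simp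
  then have "alternating 0 (interior v \<alpha>)" by (simp add: alternating_def)
  then show ?thesis ..
next
  case (Suc j)
  assume "alternating k \<alpha>"
  then show ?thesis using alternating_interior[of j \<alpha> v] Suc by auto
qed

lemma wedge_0_left:
  assumes "alternating 0 \<alpha>" "alternating l \<beta>"
  shows "\<alpha> \<and>\<^sub>\<Lambda> \<beta> = (\<lambda>xs. \<alpha> [] * \<beta> xs)"
proof
  fix xs show "(\<alpha> \<and>\<^sub>\<Lambda> \<beta>) xs = \<alpha> [] * \<beta> xs"
    using assms(2)
  proof (induction xs arbitrary: l \<beta>)
    case (Cons y ys)
    obtain j where "alternating j (interior y \<beta>)"
      using alternating_interior_ex[OF Cons.prems] by blast
    from Cons.IH[OF this] show ?case
      using wedge_Cons[OF assms(1) Cons.prems] interior_0[OF assms(1)] by (simp add: interior_def)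
  qed (simp add: wedge_Nil)
qed

text \<open>Contractions of a volume form are dual to evaluation. While x has not yet been
  contracted, the product has degree one more than the dimension and vanishes; contracting this zero
  with x moves x from \<open>V\<close> to \<alpha>. Hodge duals are built from this
  identity.\<close>

lemma wedge_append_top:
  fixes es us :: "'a::real_vector list"
  assumes sp: "span (set es) = UNIV" and V: "kform (length es) V"
    and "kform (length us) \<alpha>" "length us \<le> length es"
  shows "\<alpha> \<and>\<^sub>\<Lambda> (\<lambda>ys. V (us @ ys)) = (\<lambda>ys. \<alpha> us * V ys)"
  using assms(3,4)
proof (induction us arbitrary: \<alpha> rule: rev_induct)
  case Nil
  then show ?case using wedge_0_left[OF kform_alternating kform_alternating[OF V]] by simp
next
  case (snoc x us)
  let ?W = "\<lambda>ys. V (us @ ys)"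
  define m where "m = length es - Suc (length us)"
  have a: "kform (Suc (length us)) \<alpha>" and lm: "length es = length us + Suc m"
    using snoc.prems by (auto simp: m_def)
  have W: "kform (Suc m) ?W" using kform_append[of us "Suc m" V] V lm by simp
  have "\<alpha> \<and>\<^sub>\<Lambda> ?W = (\<lambda>ys. 0)"
    by (rule kform_above_dim[OF kform_wedge[OF a W] sp]) (simp add: lm)
  then have "0 = interior x (\<alpha> \<and>\<^sub>\<Lambda> ?W) ys" for ys by (simp add: interior_def)
  then have "(\<alpha> \<and>\<^sub>\<Lambda> interior x ?W) ys = (- 1) ^ length us * (interior x \<alpha> \<and>\<^sub>\<Lambda> ?W) ys" for ys
    by (cases "even (length us)")
      (simp_all add: interior_wedge[OF a W] algebra_simps eq_neg_iff_add_eq_0)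
  moreover have "interior x \<alpha> \<and>\<^sub>\<Lambda> ?W = (\<lambda>ys. interior x \<alpha> us * V ys)"
    by (rule snoc.IH) (use a snoc.prems in \<open>auto intro: kform_interior\<close>)
  moreover have "(- 1) ^ length us * (interior x \<alpha> us * V ys) = \<alpha> (us @ [x]) * V ys" for ys
    using alternating_move[OF kform_alternating[OF a], of us x "[]"] by (simp add: interior_def)
  ultimately show ?case unfolding interior_append by (intro ext) simp
qed

section \<open>Hodge duals and inner products of forms\<close>

lemma wedge_0_right:
  assumes "kform l \<beta>" "kform 0 \<gamma>"
  shows "\<beta> \<and>\<^sub>\<Lambda> \<gamma> = (\<lambda>xs. \<gamma> [] * \<beta> xs)"
proof
  fix xs show "(\<beta> \<and>\<^sub>\<Lambda> \<gamma>) xs = \<gamma> [] * \<beta> xs"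
    using assms(1)
  proof (induction xs arbitrary: l \<beta>)
    case (Cons y ys)
    obtain j where "kform j (interior y \<beta>)" using kform_interior_ex[OF Cons.prems] by blast
    from Cons.IH[OF this] show ?case
      using wedge_Cons[OF kform_alternating[OF Cons.prems] kform_alternating[OF assms(2)]]
        kform_interior_0[OF assms(2)]
      by (simp add: interior_def)
  qed (simp add: wedge_Nil)
qed

text \<open>The same argument with the factors exchanged. It serves only to detect zeros, so the
  sign stays an unspecified nonzero s; entries are peeled off at the end, which reverses
  \<open>us\<close>.\<close>

lemma append_top_wedge:
  fixes es us :: "'a::real_vector list"
  assumes sp: "span (set es) = UNIV" and V: "kform (length es) V"
    and "kform (length us) \<gamma>" "length us \<le> length es"
  shows "\<exists>s. s \<noteq> 0 \<and> (\<lambda>ys. V (us @ ys)) \<and>\<^sub>\<Lambda> \<gamma> = (\<lambda>ys. s * \<gamma> (rev us) * V ys)"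
  using assms(3,4)
proof (induction us arbitrary: \<gamma> rule: rev_induct)
  case Nil
  have "V \<and>\<^sub>\<Lambda> \<gamma> = (\<lambda>ys. \<gamma> [] * V ys)"
    using wedge_0_right[OF V] Nil by simp
  then show ?case by (intro exI[of _ 1]) simp
next
  case (snoc x us)
  let ?W = "\<lambda>ys. V (us @ ys)"
  define m where "m = length es - Suc (length us)"
  have g: "kform (Suc (length us)) \<gamma>" and lm: "length es = length us + Suc m"
    using snoc.prems by (auto simp: m_def)
  have W: "kform (Suc m) ?W" using kform_append[of us "Suc m" V] V lm by simp
  have "?W \<and>\<^sub>\<Lambda> \<gamma> = (\<lambda>ys. 0)"
    by (rule kform_above_dim[OF kform_wedge[OF W g] sp]) (simp add: lm)
  then have "0 = interior x (?W \<and>\<^sub>\<Lambda> \<gamma>) ys" for ys by (simp add: interior_def)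
  then have e: "(interior x ?W \<and>\<^sub>\<Lambda> \<gamma>) ys = (- 1) ^ m * (?W \<and>\<^sub>\<Lambda> interior x \<gamma>) ys" for ys
    by (simp add: interior_wedge[OF W g])
  obtain s where s: "s \<noteq> 0" "?W \<and>\<^sub>\<Lambda> interior x \<gamma> = (\<lambda>ys. s * interior x \<gamma> (rev us) * V ys)"
    using snoc.IH[of "interior x \<gamma>"] g snoc.prems(2) kform_interior by auto
  show ?case unfolding interior_append[symmetric]
    by (rule exI[of _ "(- 1) ^ m * s"]) (use s e in \<open>auto simp: interior_def\<close>)
qed

text \<open>Wedging \<gamma> with the contraction of \<open>V\<close> by the reversed
  \<open>xs\<close> gives a nonzero multiple of \<gamma> xs times \<open>V\<close>. Hence the wedge
  pairing is nondegenerate, which is what makes Hodge duals unique.\<close>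

lemma form_eq_0_if_wedge_0:
  fixes es :: "'a::real_vector list" and \<gamma> :: "'a form"
  assumes sp: "span (set es) = UNIV" and V: "kform (length es) V" "V es \<noteq> 0"
    and g: "kform l \<gamma>" and kl: "k + l = length es"
    and w: "\<And>\<alpha>. kform k \<alpha> \<Longrightarrow> \<alpha> \<and>\<^sub>\<Lambda> \<gamma> = (\<lambda>xs. 0)"
  shows "\<gamma> = (\<lambda>xs. 0)"
proof
  fix xs show "\<gamma> xs = 0"
  proof (cases "length xs = l")
    case True
    have "kform k (\<lambda>ys. V (rev xs @ ys))" using kform_append[of "rev xs" k V] V kl True by (simp add: add.commute)
    moreover obtain s where "s \<noteq> 0" "(\<lambda>ys. V (rev xs @ ys)) \<and>\<^sub>\<Lambda> \<gamma> = (\<lambda>ys. s * \<gamma> xs * V ys)"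
      using append_top_wedge[OF sp V(1), of "rev xs" \<gamma>] g kl True by auto
    ultimately show ?thesis using w V(2) by (metis mult_eq_0_iff)
  qed (use g kform_length in blast)
qed

lemma
  fixes es :: "'a::real_vector list" and \<beta> :: "'a form"
  assumes sp: "span (set es) = UNIV" and V: "kform (length es) V" "V es \<noteq> 0"
    and dim: "dim (UNIV :: 'a set) = length es"
    and b: "kform k \<beta>" and k: "k \<le> length es"
  shows kform_hodge: "kform (length es - k) (hodge g V k \<beta>)"
    and wedge_hodge: "\<And>\<alpha>. kform k \<alpha> \<Longrightarrow> \<alpha> \<and>\<^sub>\<Lambda> hodge g V k \<beta> = (\<lambda>xs. form_inner g \<alpha> \<beta> * V xs)"
    and hodge_eqI: "\<And>\<gamma>. kform (length es - k) \<gamma> \<Longrightarrow>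
       (\<And>\<alpha>. kform k \<alpha> \<Longrightarrow> \<alpha> \<and>\<^sub>\<Lambda> \<gamma> = (\<lambda>xs. form_inner g \<alpha> \<beta> * V xs)) \<Longrightarrow> hodge g V k \<beta> = \<gamma>"
proof -
  define fs where "fs = (SOME es. orthonormal_basis g es)"
  let ?P = "\<lambda>\<gamma>. kform (length es - k) \<gamma> \<and>
     (\<forall>\<alpha>. kform k \<alpha> \<longrightarrow> \<alpha> \<and>\<^sub>\<Lambda> \<gamma> = (\<lambda>xs. form_inner g \<alpha> \<beta> * V xs))"
  \<comment> \<open>The candidate dual runs over the same index sets as \<open>form_inner\<close>,
    so the defining identity holds summand by summand; index sets of size other than k are killed by
    the factor \<beta>.\<close>
  define \<gamma>0 where "\<gamma>0 = (\<lambda>ys. \<Sum>I\<in>Pow {..<length fs}. \<beta> (nths fs I) * V (nths fs I @ ys))"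
  have k0: "kform (length es - k) (\<lambda>ys. \<beta> (nths fs I) * V (nths fs I @ ys))" for I
  proof (cases "length (nths fs I) = k")
    case True
    then show ?thesis using V(1) k by (intro kform_scale kform_append) simp
  qed (simp add: kform_length[OF b] kform_zero)
  have w0: "\<alpha> \<and>\<^sub>\<Lambda> \<gamma>0 = (\<lambda>xs. form_inner g \<alpha> \<beta> * V xs)" if a: "kform k \<alpha>" for \<alpha>
  proof -
    have H: "\<beta> (nths fs I) * (\<alpha> \<and>\<^sub>\<Lambda> (\<lambda>ys. V (nths fs I @ ys))) xs =
        \<alpha> (nths fs I) * \<beta> (nths fs I) * V xs" for I xs
    proof (cases "length (nths fs I) = k")
      case True
      then show ?thesis using wedge_append_top[OF sp V(1), of "nths fs I" \<alpha>] a k by simp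
    qed (simp add: kform_length[OF b])
    show ?thesis unfolding \<gamma>0_def wedge_sum_right form_inner_def Let_def fs_def[symmetric]
      by (simp only: H sum_distrib_right)
  qed
  have P0: "?P \<gamma>0" using w0 k0 by (auto simp: \<gamma>0_def intro: kform_sum)
  have uniq: "\<gamma> = \<gamma>'" if "?P \<gamma>" "?P \<gamma>'" for \<gamma> \<gamma>'
  proof -
    have "(\<lambda>xs. \<gamma> xs - \<gamma>' xs) = (\<lambda>xs. 0)"
      by (rule form_eq_0_if_wedge_0[OF sp V kform_diff])
        (use that k in \<open>auto simp: wedge_linear\<close>)
    then show ?thesis by (simp add: fun_eq_iff)
  qed
  have H: "hodge g V k \<beta> = (THE \<gamma>. ?P \<gamma>)" unfolding hodge_def dim ..
  have "hodge g V k \<beta> = \<gamma>0" unfolding H using P0 uniq by (intro the_equality) blast+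
  then show "kform (length es - k) (hodge g V k \<beta>)"
    "\<And>\<alpha>. kform k \<alpha> \<Longrightarrow> \<alpha> \<and>\<^sub>\<Lambda> hodge g V k \<beta> = (\<lambda>xs. form_inner g \<alpha> \<beta> * V xs)"
    using P0 by auto
  show "hodge g V k \<beta> = \<gamma>" if "kform (length es - k) \<gamma>"
    "\<And>\<alpha>. kform k \<alpha> \<Longrightarrow> \<alpha> \<and>\<^sub>\<Lambda> \<gamma> = (\<lambda>xs. form_inner g \<alpha> \<beta> * V xs)" for \<gamma>
    unfolding H using that uniq by (intro the_equality) blast+
qed

text \<open>Every form of degree one below the top is the contraction of \<open>V\<close> with some
  x. As dV = 0 by degree, Cartan's formula turns its differential into minus the action of ad x on
  \<open>V\<close>, which is multiplication by - tr (ad x) = 0.\<close>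

lemma ce_diff_top_exact:
  fixes br :: "'a::real_vector \<Rightarrow> 'a \<Rightarrow> 'a" and es :: "'a list" and \<beta> V :: "'a form"
  assumes br: "bilinear br" "\<And>x. br x x = 0" "unimodular br"
    and es: "basis_list es" and V: "kform (length es) V" "V es \<noteq> 0"
    and b: "kform m \<beta>" and m: "length es = Suc m"
  shows "ce_diff br \<beta> = (\<lambda>xs. 0)"
proof -
  have sp: "span (set es) = UNIV" using es by (simp add: basis_list_def)
  let ?n = "length es"
  let ?e = "\<lambda>i. covector (coord es i)"
  \<comment> \<open>The i-th coordinate of x is forced by wedging \<beta> = \<iota>_x V with the
    i-th dual covector.\<close>
  define x where "x = (\<Sum>i<?n. ((?e i \<and>\<^sub>\<Lambda> \<beta>) es / V es) *\<^sub>R es ! i)"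
  have ix: "kform m (interior x V)" using V(1) m by (intro kform_interior) simp
  have "\<alpha> \<and>\<^sub>\<Lambda> (\<lambda>xs. \<beta> xs - interior x V xs) = (\<lambda>xs. 0)" if a: "kform 1 \<alpha>" for \<alpha>
  proof -
    have l: "linear (\<lambda>v. \<alpha> [v])" using kform_linear_Cons[OF a] .
    define c where "c i = \<alpha> [es ! i]" for i
    have S: "\<alpha> = (\<lambda>xs. \<Sum>i<?n. c i * ?e i xs)"
    proof
      fix xs show "\<alpha> xs = (\<Sum>i<?n. c i * ?e i xs)"
      proof (cases "length xs = 1")
        case True
        then obtain y where y: "xs = [y]" by (auto simp: length_Suc_conv)
        have "\<alpha> [y] = \<alpha> [\<Sum>i<?n. coord es i y *\<^sub>R es ! i]" by (simp add: coord_expand[OF es])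
        also have "\<dots> = (\<Sum>i<?n. c i * coord es i y)"
          by (simp add: linear_sum[OF l] linear_scale[OF l] mult.commute c_def)
        finally show ?thesis by (simp add: y covector_def)
      qed (simp add: kform_length[OF a] covector_def)
    qed
    have "(\<alpha> \<and>\<^sub>\<Lambda> \<beta>) es = (\<Sum>i<?n. c i * (?e i \<and>\<^sub>\<Lambda> \<beta>) es)"
      by (subst S, subst wedge_sum_left) (rule refl)
    also have "\<dots> = \<alpha> [x] * V es" unfolding x_def c_def
      using V(2) by (simp add: linear_sum[OF l] linear_scale[OF l] mult.commute flip: sum_divide_distrib)
    finally have "(\<alpha> \<and>\<^sub>\<Lambda> \<beta>) es = \<alpha> [x] * V es" .
    moreover have "\<alpha> \<and>\<^sub>\<Lambda> interior x V = (\<lambda>xs. \<alpha> [x] * V xs)"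
      using wedge_append_top[OF sp V(1), of "[x]" \<alpha>] a m by (simp add: interior_def)
    ultimately have "(\<alpha> \<and>\<^sub>\<Lambda> (\<lambda>xs. \<beta> xs - interior x V xs)) es = 0"
      by (simp add: wedge_linear)
    moreover have "kform ?n (\<alpha> \<and>\<^sub>\<Lambda> (\<lambda>xs. \<beta> xs - interior x V xs))"
      using kform_wedge[OF a kform_diff[OF b ix]] m by simp
    ultimately show ?thesis by (intro top_form_eqI[of es]) (use sp kform_zero in auto)
  qed
  then have "(\<lambda>xs. \<beta> xs - interior x V xs) = (\<lambda>xs. 0)"
    by (intro form_eq_0_if_wedge_0[OF sp V kform_diff[OF b ix], of 1]) (use m in auto)
  then have beta: "\<beta> = interior x V" by (simp add: fun_eq_iff)
  have "kform (Suc ?n) (ce_diff br V)" by (rule kform_ce_diff[OF br(1,2) V(1)])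
  then have "ce_diff br V = (\<lambda>xs. 0)" using kform_above_dim[OF _ sp] by simp
  then have "(\<lambda>xs. 0) = (\<lambda>xs. - endo_act (br x) V xs - ce_diff br \<beta> xs)"
    using interior_ce_diff[OF V(1), of x br] beta by (simp add: interior_def)
  moreover have "endo_act (br x) V = (\<lambda>xs. 0)"
    using endo_act_top[OF es linear_right_bilinear[OF br(1)] V(1)] br(3) by (simp add: unimodular_def)
  ultimately show ?thesis by (simp add: fun_eq_iff)
qed

section \<open>Inner products of forms in an orthonormal list\<close>

primrec list_inner :: "'a list \<Rightarrow> 'a form \<Rightarrow> 'a form \<Rightarrow> real" where
  "list_inner [] \<alpha> \<beta> = \<alpha> [] * \<beta> []"
| "list_inner (e # es) \<alpha> \<beta> = list_inner es \<alpha> \<beta> + list_inner es (interior e \<alpha>) (interior e \<beta>)"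

text \<open>Index sets are split by whether they contain 0. This replaces the sum over a power set
  by a recursion that unfolds on an explicit frame.\<close>

lemma list_inner_Pow:
  "(\<Sum>I\<in>Pow {..<length es}. \<alpha> (nths es I) * \<beta> (nths es I)) = list_inner es \<alpha> \<beta>"
proof (induction es arbitrary: \<alpha> \<beta>)
  case (Cons e es)
  let ?P = "Pow {..<length es}"
  have inj: "inj_on ((`) Suc) A" for A by (rule inj_on_subset[OF inj_on_image_Pow[of Suc UNIV]]) auto
  have inj2: "inj_on (\<lambda>I. insert 0 (Suc ` I)) A" for A
    by (rule inj_onI) (metis Diff_insert_absorb Zero_not_Suc image_iff inj_Suc inj_image_eq_iff)
  have "Pow {..<length (e # es)} = (`) Suc ` ?P \<union> (\<lambda>I. insert 0 (Suc ` I)) ` ?P"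
  proof -
    have "Pow (Suc ` {..<length es}) = (`) Suc ` ?P"
      using image_Pow_surj[of Suc "{..<length es}"] by simp
    then show ?thesis
      unfolding length_Cons lessThan_Suc_eq_insert_0 Pow_insert by (simp only: image_image)
  qed
  moreover have "(`) Suc ` ?P \<inter> (\<lambda>I. insert 0 (Suc ` I)) ` ?P = {}" by auto
  moreover have "{j. Suc j \<in> Suc ` I} = I" "{j. Suc j \<in> insert 0 (Suc ` I)} = I" for I by auto
  then have "nths (e # es) (Suc ` I) = nths es I" "nths (e # es) (insert 0 (Suc ` I)) = e # nths es I" for I
    by (simp_all add: nths_Cons)
  ultimately show ?case
    by (simp add: sum.union_disjoint sum.reindex[OF inj] sum.reindex[OF inj2] Cons
        interior_def flip: Cons)
qed simp

lemma list_inner_add_left: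
  "list_inner es (\<lambda>xs. \<alpha> xs + \<alpha>' xs) \<beta> = list_inner es \<alpha> \<beta> + list_inner es \<alpha>' \<beta>"
  by (induction es arbitrary: \<alpha> \<alpha>' \<beta>) (simp_all add: interior_def algebra_simps)

lemma list_inner_scale_left:
  "list_inner es (\<lambda>xs. c * \<alpha> xs) \<beta> = c * list_inner es \<alpha> \<beta>"
  by (induction es arbitrary: \<alpha> \<beta>) (simp_all add: interior_def algebra_simps)

lemma list_inner_commute: "list_inner es \<alpha> \<beta> = list_inner es \<beta> \<alpha>"
  by (induction es arbitrary: \<alpha> \<beta>) simp_all

lemma list_inner_zero [simp]: "list_inner es (\<lambda>xs. 0) \<beta> = 0" "list_inner es \<beta> (\<lambda>xs. 0) = 0"
proof -
  show "list_inner es (\<lambda>xs. 0) \<beta> = 0"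
    using list_inner_scale_left[of es 0 \<beta> \<beta>] by simp
  then show "list_inner es \<beta> (\<lambda>xs. 0) = 0" using list_inner_commute[of es \<beta> "\<lambda>xs. 0"] by metis
qed

lemma list_inner_add_right:
  "list_inner es \<beta> (\<lambda>xs. \<alpha> xs + \<alpha>' xs) = list_inner es \<beta> \<alpha> + list_inner es \<beta> \<alpha>'"
  by (simp add: list_inner_commute[of es \<beta>] list_inner_add_left)

lemma list_inner_scale_right: "list_inner es \<beta> (\<lambda>xs. c * \<alpha> xs) = c * list_inner es \<beta> \<alpha>"
  by (simp add: list_inner_commute[of es \<beta>] list_inner_scale_left)

lemma list_inner_0:
  "kform 0 \<alpha> \<Longrightarrow> kform 0 \<beta> \<Longrightarrow> list_inner es \<alpha> \<beta> = \<alpha> [] * \<beta> []"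
  by (induction es) (simp_all add: kform_interior_0)

text \<open>Each nonempty index set is counted once for every choice of a first element.\<close>

lemma list_inner_interior_sum:
  assumes "kform k \<alpha>" "kform k \<beta>"
  shows "(\<Sum>x\<leftarrow>fs. list_inner fs (interior x \<alpha>) (interior x \<beta>)) = real k * list_inner fs \<alpha> \<beta>"
  using assms
proof (induction fs arbitrary: k \<alpha> \<beta>)
  case Nil
  then show ?case by (cases k) (simp_all add: kform_length)
next
  case (Cons e fs)
  note a = Cons.prems(1) and b = Cons.prems(2)
  have sw: "list_inner fs (interior e (interior x \<alpha>)) (interior e (interior x \<beta>)) =
      list_inner fs (interior x (interior e \<alpha>)) (interior x (interior e \<beta>))" for x
    unfolding interior_interior[OF a, of e x] interior_interior[OF b, of e x]
    using list_inner_scale_left[of fs "- 1"] list_inner_scale_right[of fs _ "- 1"] by simp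
  have tail: "(\<Sum>x\<leftarrow>fs. list_inner fs (interior x (interior e \<alpha>)) (interior x (interior e \<beta>))) =
      (real k - 1) * list_inner fs (interior e \<alpha>) (interior e \<beta>)"
  proof (cases k)
    case 0
    then have "interior u \<alpha> = (\<lambda>xs. 0)" for u using a kform_interior_0 by blast
    then show ?thesis by (simp add: interior_def)
  next
    case (Suc j)
    then show ?thesis using Cons.IH[of j "interior e \<alpha>" "interior e \<beta>"] a b kform_interior by auto
  qed
  show ?case
    by (simp add: sum_list_addf interior_twice[OF a] sw tail Cons.IH[OF a b] algebra_simps)
qed

lemma orthonormal_list_independent:
  fixes g :: "'a::real_vector \<Rightarrow> 'a \<Rightarrow> real"
  assumes g: "bilinear g"
    and on: "\<And>i j. i < length es \<Longrightarrow> j < length es \<Longrightarrow> g (es ! i) (es ! j) = (if i = j then 1 else 0)"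
  shows "distinct es" "independent (set es)"
proof -
  show d: "distinct es"
    unfolding distinct_conv_nth
  proof (intro allI impI)
    fix i j assume "i < length es" "j < length es" "i \<noteq> j"
    then have "g (es ! i) (es ! j) = 0" "g (es ! i) (es ! i) = 1" using on by simp_all
    then show "es ! i \<noteq> es ! j" by auto
  qed
  show "independent (set es)"
  proof
    assume "dependent (set es)"
    then obtain u v where uv: "v \<in> set es" "u v \<noteq> 0" "(\<Sum>w\<in>set es. u w *\<^sub>R w) = 0"
      using real_vector.dependent_finite[of "set es"] by auto
    have l: "linear (\<lambda>x. g x v)" using g by (simp add: bilinear_def)
    have "0 = g (\<Sum>w\<in>set es. u w *\<^sub>R w) v" using uv(3) linear_0[OF l] by simp
    also have "\<dots> = (\<Sum>w\<in>set es. u w * g w v)" by (simp add: linear_sum[OF l] linear_scale[OF l])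
    also have "\<dots> = (\<Sum>w\<in>set es. if w = v then u v else 0)"
      using uv(1) on by (intro sum.cong refl) (auto simp: in_set_conv_nth split: if_splits)
    also have "\<dots> = u v" using uv(1) by simp
    finally show False using uv(2) by simp
  qed
qed

lemma orthonormal_basis_basis_list:
  assumes "bilinear g" "orthonormal_basis g es" "dim (UNIV :: 'a::real_vector set) > 0"
  shows "basis_list (es :: 'a list)"
  using orthonormal_list_independent[OF assms(1), of es] assms(2,3)
  by (intro basis_listI) (auto simp: orthonormal_basis_def)

lemma orthonormal_basis_coord:
  assumes "bilinear g" "orthonormal_basis g es" "basis_list es" "i < length es"
  shows "coord es i x = g x (es ! i)"
proof -
  have l: "linear (\<lambda>x. g x (es ! i))" using assms(1) by (simp add: bilinear_def)
  have "g x (es ! i) = g (\<Sum>j<length es. coord es j x *\<^sub>R es ! j) (es ! i)"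
    by (simp add: coord_expand[OF assms(3)])
  also have "\<dots> = (\<Sum>j<length es. coord es j x * g (es ! j) (es ! i))"
    by (simp add: linear_sum[OF l] linear_scale[OF l])
  also have "\<dots> = (\<Sum>j<length es. if j = i then coord es j x else 0)"
    using assms(2,4) by (intro sum.cong refl) (simp add: orthonormal_basis_def)
  also have "\<dots> = coord es i x" using assms(4) by simp
  finally show ?thesis by simp
qed

lemma orthonormal_basis_parseval:
  assumes "bilinear g" "orthonormal_basis g es" "basis_list es" "\<And>x y. g x y = g y x"
  shows "(\<Sum>i<length es. g x (es ! i) * g y (es ! i)) = g x y"
proof -
  have l: "linear (\<lambda>x. g x y)" using assms(1) by (simp add: bilinear_def)
  have "g x y = g (\<Sum>i<length es. coord es i x *\<^sub>R es ! i) y" by (simp add: coord_expand[OF assms(3)])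
  also have "\<dots> = (\<Sum>i<length es. coord es i x * g (es ! i) y)"
    by (simp add: linear_sum[OF l] linear_scale[OF l])
  also have "\<dots> = (\<Sum>i<length es. g x (es ! i) * g y (es ! i))"
    by (intro sum.cong refl) (simp add: orthonormal_basis_coord[OF assms(1-3)] assms(4)[of y])
  finally show ?thesis by simp
qed

text \<open>The trace of \<open>F\<close> relative to g does not depend on the orthonormal basis:
  after expanding \<open>es\<close> in \<open>fs\<close>, the sum over \<open>es\<close> of the
  products of coefficients is g (fs_i, fs_j) by Parseval's identity.\<close>

lemma orthonormal_trace_eq:
  fixes F :: "'a::real_vector \<Rightarrow> 'a \<Rightarrow> real"
  assumes g: "bilinear g" "\<And>x y. g x y = g y x" and F: "bilinear F"
    and es: "orthonormal_basis g es" "basis_list es" and fs: "orthonormal_basis g fs" "basis_list fs"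
  shows "(\<Sum>x\<leftarrow>es. F x x) = (\<Sum>x\<leftarrow>fs. F x x)"
proof -
  have e: "F x x = (\<Sum>i<length fs. \<Sum>j<length fs. g x (fs ! i) * g x (fs ! j) * F (fs ! i) (fs ! j))" for x
  proof -
    have l: "linear (\<lambda>x. F x z)" "linear (F z)" for z using F by (simp_all add: bilinear_def)
    have x: "(\<Sum>i<length fs. g x (fs ! i) *\<^sub>R fs ! i) = x"
      using coord_expand[OF fs(2), of x] by (simp add: orthonormal_basis_coord[OF g(1) fs])
    have "F x x = F (\<Sum>i<length fs. g x (fs ! i) *\<^sub>R fs ! i) (\<Sum>j<length fs. g x (fs ! j) *\<^sub>R fs ! j)"
      by (simp only: x)
    also have "\<dots> = (\<Sum>i<length fs. \<Sum>j<length fs. g x (fs ! i) * g x (fs ! j) * F (fs ! i) (fs ! j))"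
      by (subst sum.swap) (simp add: linear_sum[OF l(1)] linear_scale[OF l(1)] linear_sum[OF l(2)]
          linear_scale[OF l(2)] sum_distrib_left mult_ac)
    finally show ?thesis .
  qed
  have "(\<Sum>x\<leftarrow>es. F x x) = (\<Sum>k<length es. F (es ! k) (es ! k))"
    by (simp add: sum_list_sum_nth atLeast0LessThan)
  also have "\<dots> = (\<Sum>k<length es. \<Sum>i<length fs. \<Sum>j<length fs.
      g (es ! k) (fs ! i) * g (es ! k) (fs ! j) * F (fs ! i) (fs ! j))"
    by (subst e) simp
  also have "\<dots> = (\<Sum>i<length fs. \<Sum>j<length fs. \<Sum>k<length es.
      g (es ! k) (fs ! i) * g (es ! k) (fs ! j) * F (fs ! i) (fs ! j))"
    by (subst sum.swap) (intro sum.cong refl sum.swap)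
  also have "\<dots> = (\<Sum>i<length fs. \<Sum>j<length fs. g (fs ! i) (fs ! j) * F (fs ! i) (fs ! j))"
  proof (intro sum.cong refl)
    fix i j
    show "(\<Sum>k<length es. g (es ! k) (fs ! i) * g (es ! k) (fs ! j) * F (fs ! i) (fs ! j)) =
        g (fs ! i) (fs ! j) * F (fs ! i) (fs ! j)"
      using orthonormal_basis_parseval[OF g(1) es g(2), of "fs ! i" "fs ! j"]
      by (simp add: g(2)[of "es ! _"] flip: sum_distrib_right)
  qed
  also have "\<dots> = (\<Sum>i<length fs. \<Sum>j<length fs. if j = i then F (fs ! i) (fs ! j) else 0)"
    using fs(1) by (intro sum.cong refl) (simp add: orthonormal_basis_def)
  also have "\<dots> = (\<Sum>i<length fs. F (fs ! i) (fs ! i))" by simp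
  also have "\<dots> = (\<Sum>x\<leftarrow>fs. F x x)" by (simp add: sum_list_sum_nth atLeast0LessThan)
  finally show ?thesis .
qed

text \<open>Induction on the degree. By \<open>list_inner_interior_sum\<close> the inner product is,
  up to the factor k, the trace of a bilinear form made of inner products of contractions, and such
  traces do not depend on the basis.\<close>

lemma list_inner_orthonormal_eq:
  assumes g: "bilinear g" "\<And>x y. g x y = g y x"
    and es: "orthonormal_basis g es" "basis_list es" and fs: "orthonormal_basis g fs" "basis_list fs"
    and "kform k \<alpha>" "kform k \<beta>"
  shows "list_inner es \<alpha> \<beta> = list_inner fs \<alpha> \<beta>"
  using assms(7,8)
proof (induction k arbitrary: \<alpha> \<beta>)
  case 0
  then show ?case by (simp add: list_inner_0)
next
  case (Suc k)
  let ?F = "\<lambda>x y. list_inner fs (interior x \<alpha>) (interior y \<beta>)"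
  have F: "bilinear ?F"
    unfolding bilinear_def
    by (intro allI conjI linearI) (simp_all add: interior_add[OF Suc.prems(1)] interior_add[OF Suc.prems(2)]
        interior_scale[OF Suc.prems(1)] interior_scale[OF Suc.prems(2)] list_inner_add_left
        list_inner_add_right list_inner_scale_left list_inner_scale_right)
  have "real (Suc k) * list_inner es \<alpha> \<beta> =
      (\<Sum>x\<leftarrow>es. list_inner es (interior x \<alpha>) (interior x \<beta>))"
    by (rule list_inner_interior_sum[OF Suc.prems, symmetric])
  also have "\<dots> = (\<Sum>x\<leftarrow>es. ?F x x)"
    using Suc.IH[OF kform_interior[OF Suc.prems(1)] kform_interior[OF Suc.prems(2)]] by simp
  also have "\<dots> = (\<Sum>x\<leftarrow>fs. ?F x x)" by (rule orthonormal_trace_eq[OF g F es fs])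
  also have "\<dots> = real (Suc k) * list_inner fs \<alpha> \<beta>" by (rule list_inner_interior_sum[OF Suc.prems])
  finally show ?case by (simp del: of_nat_Suc)
qed

text \<open>Removes the choice from \<open>form_inner\<close>: any orthonormal basis at hand may be
  used instead of the selected one.\<close>

lemma form_inner_eq_list_inner:
  fixes es :: "'a::real_vector list"
  assumes g: "bilinear g" "\<And>x y. g x y = g y x" and es: "orthonormal_basis g es"
    and dim: "dim (UNIV :: 'a set) > 0" and "kform k \<alpha>" "kform k \<beta>"
  shows "form_inner g \<alpha> \<beta> = list_inner es \<alpha> \<beta>"
proof -
  define fs where "fs = (SOME es. orthonormal_basis g es)"
  have fs: "orthonormal_basis g fs" unfolding fs_def using es by (rule someI)
  have "form_inner g \<alpha> \<beta> = list_inner fs \<alpha> \<beta>"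
    unfolding form_inner_def fs_def[symmetric] Let_def by (rule list_inner_Pow)
  also have "\<dots> = list_inner es \<alpha> \<beta>"
    by (rule list_inner_orthonormal_eq[OF g fs _ es _ assms(5,6)])
      (use orthonormal_basis_basis_list g(1) es fs dim in blast)+
  finally show ?thesis .
qed

section \<open>Hitchin's endomorphism in dimension six\<close>

text \<open>The wedge product as a sum over shuffles, obtained by iterating the contraction rule. On
  an explicit list it simplifies to a polynomial in components without any sum over
  permutations.\<close>

fun shuffle_sum :: "nat \<Rightarrow> 'a form \<Rightarrow> 'a form \<Rightarrow> 'a form" where
  "shuffle_sum 0 \<alpha> \<beta> xs = \<alpha> [] * \<beta> xs"
| "shuffle_sum (Suc k) \<alpha> \<beta> [] = 0"
| "shuffle_sum (Suc k) \<alpha> \<beta> (x # xs) =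
     shuffle_sum k (interior x \<alpha>) \<beta> xs + (- 1) ^ Suc k * shuffle_sum (Suc k) \<alpha> (interior x \<beta>) xs"

lemma wedge_alternating_shuffle_sum:
  assumes "alternating k \<alpha>" "alternating l \<beta>"
  shows "(\<alpha> \<and>\<^sub>\<Lambda> \<beta>) xs = shuffle_sum k \<alpha> \<beta> xs"
  using assms
proof (induction k \<alpha> \<beta> xs arbitrary: l rule: shuffle_sum.induct)
  case (1 \<alpha> \<beta> xs)
  then show ?case by (simp add: wedge_0_left)
next
  case (2 k \<alpha> \<beta>)
  then show ?case by (simp add: wedge_Nil alternating_length)
next
  case (3 k \<alpha> \<beta> x xs)
  obtain j where "alternating j (interior x \<beta>)" using alternating_interior_ex[OF 3(4)] by blast
  then show ?case
    using 3(1)[OF alternating_interior[OF 3(3)] 3(4)] 3(2)[OF 3(3)] wedge_Cons[OF 3(3,4)] by simp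
qed

lemmas wedge_eq_shuffle_sum = wedge_alternating_shuffle_sum[OF kform_alternating kform_alternating]

lemma interior_apply: "interior v \<alpha> xs = \<alpha> (v # xs)"
  by (simp add: interior_def)

text \<open>Frame vectors are indexed by numbers so that the condition i < j orients these rewrites:
  together they sort the arguments of a form by index and stop.\<close>

lemma kform_sort:
  assumes "kform k \<alpha>" "(i::nat) < j"
  shows "\<alpha> (e j # e i # xs) = - \<alpha> (e i # e j # xs)"
    "\<alpha> (x # e j # e i # xs) = - \<alpha> (x # e i # e j # xs)"
    "\<alpha> (x # y # e j # e i # xs) = - \<alpha> (x # y # e i # e j # xs)"
  using alternating_swap[OF kform_alternating[OF assms(1)], of "[]" "e j" "e i" xs]
    alternating_swap[OF kform_alternating[OF assms(1)], of "[x]" "e j" "e i" xs]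
    alternating_swap[OF kform_alternating[OF assms(1)], of "[x, y]" "e j" "e i" xs] by simp_all

lemma kform_repeated:
  assumes "kform k \<alpha>"
  shows "\<alpha> (v # v # xs) = 0" "\<alpha> (x # v # v # xs) = 0" "\<alpha> (x # y # v # v # xs) = 0"
  using assms by (simp_all add: kform_def)

text \<open>A cubic identity in the components of \<rho>. With \<open>S\<close> Hitchin's
  endomorphism and \<open>V\<close> the volume form, the left side is \<rho> [e 2, S (e 1), e 1]
  times \<open>V\<close> on the frame; the coefficients of e 1 and e 2 drop out by
  alternation.\<close>

lemma hitchin_identity_3:
  assumes r: "kform 3 \<rho>"
  shows "- (interior (e 1) \<rho> \<and>\<^sub>\<Lambda> \<rho>) [e 1, e 2, e 4, e 5, e 6] * \<rho> [e 2, e 3, e 1] +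
   (interior (e 1) \<rho> \<and>\<^sub>\<Lambda> \<rho>) [e 1, e 2, e 3, e 5, e 6] * \<rho> [e 2, e 4, e 1] -
   (interior (e 1) \<rho> \<and>\<^sub>\<Lambda> \<rho>) [e 1, e 2, e 3, e 4, e 6] * \<rho> [e 2, e 5, e (1::nat)] +
   (interior (e 1) \<rho> \<and>\<^sub>\<Lambda> \<rho>) [e 1, e 2, e 3, e 4, e 5] * \<rho> [e 2, e 6, e 1] = 0"
proof -
  have "kform (Suc (Suc 0)) (interior v \<rho>)" for v
    using kform_interior[of 2 \<rho>] r by (simp add: numeral_3_eq_3 numeral_2_eq_2)
  note W = wedge_eq_shuffle_sum[OF this r]
  show ?thesis
    by (simp add: W interior_apply kform_sort[OF r] kform_repeated[OF r] del: One_nat_def)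
      (simp add: algebra_simps)
qed

text \<open>A quartic identity in the components of \<rho>. Up to the square of the value of the
  volume form on the frame, the left side is the component along e 2 of S (S (e 1)), so it expresses
  that \<open>S\<close> squared has no off-diagonal entry.\<close>

lemma hitchin_identity_4:
  assumes r: "kform 3 \<rho>"
  shows "- (interior (e 1) \<rho> \<and>\<^sub>\<Lambda> \<rho>) [e 2, e 3, e 4, e 5, e 6] * (interior (e 1) \<rho> \<and>\<^sub>\<Lambda> \<rho>) [e 1, e 3, e 4, e 5, e 6] +
   (interior (e 1) \<rho> \<and>\<^sub>\<Lambda> \<rho>) [e 1, e 3, e 4, e 5, e 6] * (interior (e 2) \<rho> \<and>\<^sub>\<Lambda> \<rho>) [e 1, e 3, e 4, e 5, e 6] -
   (interior (e 1) \<rho> \<and>\<^sub>\<Lambda> \<rho>) [e 1, e 2, e 4, e 5, e 6] * (interior (e 3) \<rho> \<and>\<^sub>\<Lambda> \<rho>) [e 1, e 3, e 4, e 5, e 6] +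
   (interior (e 1) \<rho> \<and>\<^sub>\<Lambda> \<rho>) [e 1, e 2, e 3, e 5, e 6] * (interior (e 4) \<rho> \<and>\<^sub>\<Lambda> \<rho>) [e 1, e 3, e 4, e 5, e 6] -
   (interior (e 1) \<rho> \<and>\<^sub>\<Lambda> \<rho>) [e 1, e 2, e 3, e 4, e 6] * (interior (e 5) \<rho> \<and>\<^sub>\<Lambda> \<rho>) [e 1, e 3, e 4, e 5, e (6::nat)] +
   (interior (e 1) \<rho> \<and>\<^sub>\<Lambda> \<rho>) [e 1, e 2, e 3, e 4, e 5] * (interior (e 6) \<rho> \<and>\<^sub>\<Lambda> \<rho>) [e 1, e 3, e 4, e 5, e 6] = 0"
proof -
  have "kform (Suc (Suc 0)) (interior v \<rho>)" for v
    using kform_interior[of 2 \<rho>] r by (simp add: numeral_3_eq_3 numeral_2_eq_2)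
  note W = wedge_eq_shuffle_sum[OF this r]
  show ?thesis
    by (simp add: W interior_apply kform_sort[OF r] kform_repeated[OF r] del: One_nat_def)
      (simp add: algebra_simps)
qed


lemma list6_indexed:
  assumes "length xs = 6"
  shows "\<exists>e. xs = [e 1, e 2, e 3, e 4, e 5, e (6::nat)]"
proof -
  obtain a b c d p q where "xs = [a, b, c, d, p, q]"
    using assms by (auto simp: numeral_eq_Suc length_Suc_conv)
  then show ?thesis by (intro exI[of _ "\<lambda>i. xs ! (i - 1)"]) simp
qed

lemma wedge_covector_5:
  assumes "kform 5 \<kappa>" "linear f"
  shows "(\<kappa> \<and>\<^sub>\<Lambda> covector f) [e1, e2, e3, e4, e5, e6] =
    - \<kappa> [e2, e3, e4, e5, e6] * f e1 + \<kappa> [e1, e3, e4, e5, e6] * f e2 - \<kappa> [e1, e2, e4, e5, e6] * f e3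
    + \<kappa> [e1, e2, e3, e5, e6] * f e4 - \<kappa> [e1, e2, e3, e4, e6] * f e5 + \<kappa> [e1, e2, e3, e4, e5] * f e6"
proof -
  have k: "kform (Suc (Suc (Suc (Suc (Suc 0))))) \<kappa>" using assms(1) by (simp add: numeral_eq_Suc)
  show ?thesis
    by (simp add: wedge_eq_shuffle_sum[OF k kform_covector[OF assms(2)]] interior_apply covector_def)
qed

lemma kform_contract_wedge: "kform 3 \<rho> \<Longrightarrow> kform 5 (interior v \<rho> \<and>\<^sub>\<Lambda> \<rho>)"
  using kform_wedge[of 2 "interior v \<rho>" 3 \<rho>] kform_interior[of 2 \<rho> v] by simp

lemma linear_eqI:
  fixes s :: "'a::real_vector" and es :: "'a list"
  assumes "basis_list es" "\<And>f. linear f \<Longrightarrow> f s = (f t :: real)"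
  shows "s = t"
proof -
  have "s = (\<Sum>i<length es. coord es i s *\<^sub>R es ! i)" by (rule coord_expand[OF assms(1), symmetric])
  also have "\<dots> = (\<Sum>i<length es. coord es i t *\<^sub>R es ! i)"
    using assms(2)[OF linear_coord[OF assms(1)]] by simp
  also have "\<dots> = t" by (rule coord_expand[OF assms(1)])
  finally show ?thesis .
qed

lemma length_list6: "length [a, b, c, d, p, q] = 6"
  by simp

lemma top_form_nonzero_basis:
  assumes "basis_list es" "kform (length es) V" "V xs \<noteq> 0"
  shows "V es \<noteq> 0"
proof
  assume "V es = 0"
  then have "V = (\<lambda>xs. 0)"
    using assms by (intro top_form_eqI[of es]) (auto simp: kform_zero basis_list_def)
  then show False using assms(3) by simp
qed

context
  fixes V \<rho> :: "'h::real_vector form"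
  assumes dim6: "dim (UNIV :: 'h set) = 6" and V: "kform 6 V" and V0: "\<exists>xs. V xs \<noteq> 0"
    and rho: "kform 3 \<rho>"
begin

lemma basis_list_six:
  assumes "independent (set us)" "distinct us"
  shows "\<exists>e :: nat \<Rightarrow> 'h. basis_list [e 1, e 2, e 3, e 4, e 5, e 6] \<and>
    (\<exists>T. us @ T = [e 1, e 2, e 3, e 4, e 5, e 6]) \<and> V [e 1, e 2, e 3, e 4, e 5, e 6] \<noteq> 0"
proof -
  obtain T where T: "basis_list (us @ T)"
    using independent_basis_list_extend[OF assms] dim6 by auto
  have len: "length (us @ T) = 6" using basis_list_length[OF T] dim6 by simp
  then have "V (us @ T) \<noteq> 0" using top_form_nonzero_basis[OF T] V V0 by auto
  then show ?thesis using T list6_indexed[OF len] by metis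
qed

lemma hitchin_endo_eq:
  assumes "linear f"
  shows "interior v \<rho> \<and>\<^sub>\<Lambda> \<rho> \<and>\<^sub>\<Lambda> covector f = (\<lambda>xs. f (hitchin_endo V \<rho> v) * V xs)"
proof -
  obtain e :: "nat \<Rightarrow> 'h" where b: "basis_list [e 1, e 2, e 3, e 4, e 5, e 6]"
    and nz: "V [e 1, e 2, e 3, e 4, e 5, e 6] \<noteq> 0"
    using basis_list_six[of "[]"] real_vector.independent_empty by auto
  let ?\<kappa> = "interior v \<rho> \<and>\<^sub>\<Lambda> \<rho>"
  let ?m = "V [e 1, e 2, e 3, e 4, e 5, e 6]"
  \<comment> \<open>The coefficients are read off from \<open>wedge_covector_5\<close>. Uniqueness
    holds because linear functionals separate points.\<close>
  define s where "s = (1 / ?m) *\<^sub>R (- ?\<kappa> [e 2, e 3, e 4, e 5, e 6] *\<^sub>R e 1 + ?\<kappa> [e 1, e 3, e 4, e 5, e 6] *\<^sub>R e 2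
    - ?\<kappa> [e 1, e 2, e 4, e 5, e 6] *\<^sub>R e 3 + ?\<kappa> [e 1, e 2, e 3, e 5, e 6] *\<^sub>R e 4
    - ?\<kappa> [e 1, e 2, e 3, e 4, e 6] *\<^sub>R e 5 + ?\<kappa> [e 1, e 2, e 3, e 4, e 5] *\<^sub>R e 6)"
  have s: "?\<kappa> \<and>\<^sub>\<Lambda> covector f = (\<lambda>xs. f s * V xs)" if f: "linear f" for f
  proof (rule top_form_eqI[of "[e 1, e 2, e 3, e 4, e 5, e 6]"])
    show "kform (length [e 1, e 2, e 3, e 4, e 5, e 6]) (?\<kappa> \<and>\<^sub>\<Lambda> covector f)"
      unfolding length_list6 using kform_wedge[OF kform_contract_wedge[OF rho] kform_covector[OF f]] by simp
    show "kform (length [e 1, e 2, e 3, e 4, e 5, e 6]) (\<lambda>xs. f s * V xs)"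
      unfolding length_list6 by (rule kform_scale[OF V])
    show "span (set [e 1, e 2, e 3, e 4, e 5, e 6]) = UNIV" using b by (simp only: basis_list_def)
    show "(?\<kappa> \<and>\<^sub>\<Lambda> covector f) [e 1, e 2, e 3, e 4, e 5, e 6] = f s * ?m"
      unfolding wedge_covector_5[OF kform_contract_wedge[OF rho] f] s_def
      using nz by (simp add: linear_add[OF f] linear_diff[OF f] linear_scale[OF f] linear_neg[OF f] del: One_nat_def)
  qed
  have "hitchin_endo V \<rho> v = s"
    unfolding hitchin_endo_def
  proof (rule the_equality)
    show "\<forall>f. linear f \<longrightarrow> ?\<kappa> \<and>\<^sub>\<Lambda> covector f = (\<lambda>xs. f s * V xs)" using s by blast
    fix t assume t: "\<forall>f. linear f \<longrightarrow> ?\<kappa> \<and>\<^sub>\<Lambda> covector f = (\<lambda>xs. f t * V xs)"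
    show "t = s"
    proof (rule linear_eqI[OF b])
      fix f :: "'h \<Rightarrow> real" assume "linear f"
      then have "(\<lambda>xs. f t * V xs) = (\<lambda>xs. f s * V xs)" using s t by metis
      then show "f t = f s" using nz by (metis mult_right_cancel)
    qed
  qed
  then show ?thesis using s assms by simp
qed

lemma hitchin_endo_expand:
  assumes "linear f"
  shows "f (hitchin_endo V \<rho> v) * V [e 1, e 2, e 3, e 4, e 5, e (6::nat)] =
    - (interior v \<rho> \<and>\<^sub>\<Lambda> \<rho>) [e 2, e 3, e 4, e 5, e 6] * f (e 1)
    + (interior v \<rho> \<and>\<^sub>\<Lambda> \<rho>) [e 1, e 3, e 4, e 5, e 6] * f (e 2)
    - (interior v \<rho> \<and>\<^sub>\<Lambda> \<rho>) [e 1, e 2, e 4, e 5, e 6] * f (e 3)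
    + (interior v \<rho> \<and>\<^sub>\<Lambda> \<rho>) [e 1, e 2, e 3, e 5, e 6] * f (e 4)
    - (interior v \<rho> \<and>\<^sub>\<Lambda> \<rho>) [e 1, e 2, e 3, e 4, e 6] * f (e 5)
    + (interior v \<rho> \<and>\<^sub>\<Lambda> \<rho>) [e 1, e 2, e 3, e 4, e 5] * f (e 6)"
  unfolding wedge_covector_5[OF kform_contract_wedge[OF rho] assms, symmetric] hitchin_endo_eq[OF assms] ..

lemma linear_contract_wedge: "linear (\<lambda>v. (interior v \<rho> \<and>\<^sub>\<Lambda> \<rho>) xs)"
  by (rule linearI) (simp_all add: interior_add[OF rho] interior_scale[OF rho] wedge_linear)

lemma linear_hitchin_endo: "linear (hitchin_endo V \<rho>)"
proof -
  obtain e :: "nat \<Rightarrow> 'h" where b: "basis_list [e 1, e 2, e 3, e 4, e 5, e 6]"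
    and nz: "V [e 1, e 2, e 3, e 4, e 5, e 6] \<noteq> 0"
    using basis_list_six[of "[]"] real_vector.independent_empty by auto
  have l: "linear (\<lambda>v. f (hitchin_endo V \<rho> v))" if f: "linear f" for f :: "'h \<Rightarrow> real"
  proof -
    have "f (hitchin_endo V \<rho> v) = (interior v \<rho> \<and>\<^sub>\<Lambda> \<rho> \<and>\<^sub>\<Lambda> covector f) [e 1, e 2, e 3, e 4, e 5, e 6]
        / V [e 1, e 2, e 3, e 4, e 5, e 6]" for v
      using hitchin_endo_eq[OF f] nz by simp
    then show ?thesis
      by (intro linearI) (simp_all add: interior_add[OF rho] interior_scale[OF rho] wedge_linear add_divide_distrib)
  qed
  show ?thesis
  proof (rule linearI)
    fix x y c
    show "hitchin_endo V \<rho> (x + y) = hitchin_endo V \<rho> x + hitchin_endo V \<rho> y"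
      by (rule linear_eqI[OF b]) (simp add: linear_add[OF l] linear_add)
    show "hitchin_endo V \<rho> (c *\<^sub>R x) = c *\<^sub>R hitchin_endo V \<rho> x"
      by (rule linear_eqI[OF b]) (simp add: linear_scale[OF l] linear_scale)
  qed
qed

text \<open>For independent v and w this is \<open>hitchin_identity_3\<close> in a basis starting
  with v, w; otherwise alternation suffices. Polarised, it allows \<open>J\<close> to move between
  the slots of \<rho>.\<close>

lemma hitchin_endo_repeat: "\<rho> [w, hitchin_endo V \<rho> v, v] = 0"
proof (cases "w \<in> span {v} \<or> v = 0")
  case True
  then have "w \<in> span {v} \<or> \<rho> [w, hitchin_endo V \<rho> v, v] = 0"
    using linear_0[OF kform_linear[OF rho, of "[w, hitchin_endo V \<rho> v]" "[]"]] by auto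
  moreover have "\<rho> [c *\<^sub>R v, hitchin_endo V \<rho> v, v] = 0" for c
  proof -
    have "\<rho> [v, hitchin_endo V \<rho> v, v] = 0" using rho by (simp add: kform_def)
    then show ?thesis using linear_scale[OF kform_linear_Cons[OF rho]] by simp
  qed
  ultimately show ?thesis by (auto simp: real_vector.span_singleton)
next
  case False
  then have "independent (set [v, w])" "distinct [v, w]"
    using real_vector.span_base[of v "{v}"]
    by (auto simp: insert_commute[of v w] real_vector.independent_insert)
  then obtain e :: "nat \<Rightarrow> 'h" where e: "e 1 = v" "e 2 = w" and nz: "V [e 1, e 2, e 3, e 4, e 5, e 6] \<noteq> 0"
    using basis_list_six[of "[v, w]"] by auto
  have "linear (\<lambda>x. \<rho> [e 2, x, e 1])" using kform_linear[OF rho, of "[e 2]" "[e 1]"] by simp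
  from hitchin_endo_expand[OF this, of "e 1" e] hitchin_identity_3[OF rho, of e]
  have "\<rho> [e 2, hitchin_endo V \<rho> (e 1), e 1] * V [e 1, e 2, e 3, e 4, e 5, e 6] = 0"
    using rho kform_repeated[OF rho] by (simp add: kform_def del: One_nat_def)
  then show ?thesis using nz e by simp
qed

text \<open>If S (S v) were independent of v, it could serve as the second vector of a basis
  starting with v. Its component along itself is 1, but \<open>hitchin_identity_4\<close> makes it
  0.\<close>

lemma hitchin_endo_square_span: "hitchin_endo V \<rho> (hitchin_endo V \<rho> v) \<in> span {v}"
proof (rule ccontr)
  define w where "w = hitchin_endo V \<rho> (hitchin_endo V \<rho> v)"
  assume "hitchin_endo V \<rho> (hitchin_endo V \<rho> v) \<notin> span {v}"
  then have "w \<notin> span {v}" by (simp add: w_def)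
  moreover from this have "v \<noteq> 0"
    using linear_0[OF linear_hitchin_endo] by (auto simp: w_def)
  ultimately have "independent (set [v, w])" "distinct [v, w]"
    using real_vector.span_base[of v "{v}"]
    by (auto simp: insert_commute[of v w] real_vector.independent_insert)
  then obtain e :: "nat \<Rightarrow> 'h" where b: "basis_list [e 1, e 2, e 3, e 4, e 5, e 6]"
    and e: "e 1 = v" "e 2 = w" and nz: "V [e 1, e 2, e 3, e 4, e 5, e 6] \<noteq> 0"
    using basis_list_six[of "[v, w]"] by auto
  let ?es = "[e 1, e 2, e 3, e 4, e 5, e 6]"
  let ?h = "\<lambda>x. (interior x \<rho> \<and>\<^sub>\<Lambda> \<rho>) [e 1, e 3, e 4, e 5, e 6]"
  let ?f = "coord ?es 1"
  have f: "?f (e 1) = 0" "?f (e 2) = 1" "?f (e 3) = 0" "?f (e 4) = 0" "?f (e 5) = 0" "?f (e 6) = 0"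
    using coord_nth[OF b, of 1 0] coord_nth[OF b, of 1 1] coord_nth[OF b, of 1 2]
      coord_nth[OF b, of 1 3] coord_nth[OF b, of 1 4] coord_nth[OF b, of 1 5] by simp_all
  have "?f w * V ?es = ?h (hitchin_endo V \<rho> v)"
    using hitchin_endo_expand[OF linear_coord[OF b], of 1 "hitchin_endo V \<rho> v" e] f
    by (simp add: w_def del: One_nat_def)
  moreover have "?h (hitchin_endo V \<rho> (e 1)) * V ?es = 0"
    using hitchin_endo_expand[OF linear_contract_wedge[of "[e 1, e 3, e 4, e 5, e 6]"], of "e 1" e]
      hitchin_identity_4[OF rho, of e] by simp
  ultimately show False using f(2) e nz by simp
qed

text \<open>A linear map for which every vector is an eigenvector is a scalar: for independent u and
  v the eigenvalues are compared through u + v.\<close>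

lemma hitchin_endo_square: "\<exists>P. \<forall>v. hitchin_endo V \<rho> (hitchin_endo V \<rho> v) = P *\<^sub>R v"
proof -
  let ?S = "hitchin_endo V \<rho>"
  have "\<forall>v. \<exists>p. ?S (?S v) = p *\<^sub>R v"
    using hitchin_endo_square_span by (auto simp: real_vector.span_singleton)
  then obtain p where p: "\<And>v. ?S (?S v) = p v *\<^sub>R v" by metis
  obtain u :: 'h where u: "u \<notin> span {}"
    using exists_not_in_span[of "{} :: 'h set"] dim6 by auto
  then have u0: "u \<noteq> 0" by auto
  have "?S (?S v) = p u *\<^sub>R v" for v
  proof (cases "v \<in> span {u}")
    case True
    then obtain c where "v = c *\<^sub>R u" by (auto simp: real_vector.span_singleton)
    then show ?thesis using p[of u] linear_scale[OF linear_hitchin_endo] by simp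
  next
    case False
    have "p (u + v) *\<^sub>R (u + v) = p u *\<^sub>R u + p v *\<^sub>R v"
      using linear_add[OF linear_hitchin_endo] p by metis
    then have *: "(p (u + v) - p v) *\<^sub>R v = (p u - p (u + v)) *\<^sub>R u" by (simp add: algebra_simps)
    have pv: "p (u + v) = p v"
    proof (rule ccontr)
      assume ne: "p (u + v) \<noteq> p v"
      have "v = (1 / (p (u + v) - p v)) *\<^sub>R ((p (u + v) - p v) *\<^sub>R v)" using ne by simp
      then have "v = ((p u - p (u + v)) / (p (u + v) - p v)) *\<^sub>R u" unfolding * by simp
      then show False using False by (auto simp: real_vector.span_singleton)
    qed
    then have "p u = p v" using * u0 by simp
    then show ?thesis using p by simp
  qed
  then show ?thesis by blast
qed

end

section \<open>Adapted frames of \<open>SU(3)\<close>-structures\<close>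

lemma form2_commute: "kform 2 \<omega> \<Longrightarrow> \<omega> [y, x] = - \<omega> [x, y]"
  using kform_swap[of 2 \<omega> y x "[]"] by simp

lemma linear_form2:
  assumes "kform 2 \<omega>"
  shows "linear (\<lambda>x. \<omega> [x, y])" "linear (\<lambda>y. \<omega> [x, y])"
  using kform_linear[OF assms, of "[]" "[y]"] kform_linear[OF assms, of "[x]" "[]"] by simp_all

text \<open>One round of symplectic Gram-Schmidt. \<open>P\<close> assigns to each vector a
  component that is \<omega>-orthogonal to \<open>S\<close>, and \<open>Q\<close> does the same for
  the enlarged set, so rounds can be chained.\<close>

lemma symplectic_pair_extend:
  fixes \<omega> :: "'h::real_vector form"
  assumes om: "kform 2 \<omega>" "nondegenerate \<omega>" and S: "finite S" "card S < dim (UNIV :: 'h set)"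
    and P: "\<And>x. x - P x \<in> span S" "\<And>x s. s \<in> S \<Longrightarrow> \<omega> [P x, s] = 0"
  shows "\<exists>u v Q. \<omega> [u, v] = 1 \<and> (\<forall>s\<in>S. \<omega> [u, s] = 0 \<and> \<omega> [v, s] = 0) \<and>
    (\<forall>x. x - Q x \<in> span (insert u (insert v S))) \<and>
    (\<forall>x. \<forall>s\<in>insert u (insert v S). \<omega> [Q x, s] = 0)"
proof -
  note l = linear_form2[OF om(1)]
  obtain x where x: "x \<notin> span S" using exists_not_in_span[OF S(2,1)] by blast
  define u where "u = P x"
  have "u \<noteq> 0" using x P(1)[of x] by (auto simp: u_def)
  then obtain y where y: "\<omega> [u, y] \<noteq> 0" using om(2) by (auto simp: nondegenerate_def)
  have uS: "\<omega> [u, w] = 0" if "w \<in> span S" for w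
    using that
  proof (induction rule: real_vector.span_induct_alt)
    case base show ?case using linear_0[OF l(2)] .
  next
    case (step c z w)
    then show ?case using P(2)[of z x] by (simp add: u_def linear_add[OF l(2)] linear_scale[OF l(2)])
  qed
  define v where "v = (1 / \<omega> [u, y]) *\<^sub>R P y"
  have "\<omega> [u, y] = \<omega> [u, P y]"
    using uS[OF P(1)[of y]] by (simp add: linear_diff[OF l(2)])
  then have uv: "\<omega> [u, v] = 1" using y by (simp add: v_def linear_scale[OF l(2)])
  have us: "\<omega> [u, s] = 0" "\<omega> [v, s] = 0" if "s \<in> S" for s
    using P(2)[OF that] by (simp_all add: u_def v_def linear_scale[OF l(1)])
  have uu: "\<omega> [w, w] = 0" for w using om(1) by (simp add: kform_def)
  \<comment> \<open>Subtracts the components along the new pair; the signs differ because \<omega>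
    [u, v] = 1 and \<omega> [v, u] = - 1.\<close>
  define Q where "Q x = P x - \<omega> [P x, v] *\<^sub>R u + \<omega> [P x, u] *\<^sub>R v" for x
  have "\<omega> [Q x, s] = 0" if "s \<in> insert u (insert v S)" for x s
    using that us P(2)[of s x] uv form2_commute[OF om(1), of v u]
    by (auto simp: Q_def linear_add[OF l(1)] linear_diff[OF l(1)] linear_scale[OF l(1)] uu)
  moreover have "x - Q x \<in> span (insert u (insert v S))" for x
  proof -
    have "x - P x \<in> span (insert u (insert v S))"
      using P(1)[of x] real_vector.span_mono[of S "insert u (insert v S)"] by blast
    moreover have "u \<in> span (insert u (insert v S))" "v \<in> span (insert u (insert v S))"
      by (auto intro: real_vector.span_base)
    ultimately have "(x - P x) + \<omega> [P x, v] *\<^sub>R u - \<omega> [P x, u] *\<^sub>R v \<in> span (insert u (insert v S))"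
      using real_vector.span_diff[OF real_vector.span_add[OF _ real_vector.span_scale] real_vector.span_scale]
      by blast
    moreover have "(x - P x) + \<omega> [P x, v] *\<^sub>R u - \<omega> [P x, u] *\<^sub>R v = x - Q x" by (simp add: Q_def)
    ultimately show ?thesis by simp
  qed
  ultimately show ?thesis using uv us by blast
qed

section \<open>Pullbacks and explicit products of low degree\<close>

lemma kform_pullback:
  assumes "linear f" "kform k \<beta>"
  shows "kform k (pullback f \<beta>)"
  unfolding kform_def pullback_def
proof (intro conjI allI impI)
  show "linear (\<lambda>v. \<beta> (map f (xs @ v # ys)))" for xs ys
    using linear_compose[OF assms(1) kform_linear[OF assms(2), of "map f xs" "map f ys"]] by (simp add: o_def)
  show "\<beta> (map f xs) = 0" if "\<not> distinct xs" for xs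
    using assms(2) that by (simp add: kform_def distinct_map)
qed (simp add: kform_length[OF assms(2)])

lemma pullback_wedge: "pullback f (\<alpha> \<and>\<^sub>\<Lambda> \<beta>) = pullback f \<alpha> \<and>\<^sub>\<Lambda> pullback f \<beta>"
  by (intro ext, simp only: pullback_def wedge_def length_map,
      intro sum.cong refl arg_cong2[where f = "(*)"])
    (simp_all add: permute_list_map take_map drop_map)

lemma kform_2_Suc: "kform 2 \<omega> \<Longrightarrow> kform (Suc (Suc 0)) \<omega>"
  by (simp add: numeral_2_eq_2)

lemma kform_3_Suc: "kform 3 \<omega> \<Longrightarrow> kform (Suc (Suc (Suc 0))) \<omega>"
  by (simp add: numeral_3_eq_3)

lemma kform_4_Suc: "kform 4 \<omega> \<Longrightarrow> kform (Suc (Suc (Suc (Suc 0)))) \<omega>"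
  by (simp add: numeral_eq_Suc)

lemma wedge_22:
  assumes "kform 2 \<alpha>" "kform 2 \<beta>"
  shows "(\<alpha> \<and>\<^sub>\<Lambda> \<beta>) [a, b, c, d] = \<alpha> [a, b] * \<beta> [c, d] - \<alpha> [a, c] * \<beta> [b, d] + \<alpha> [a, d] * \<beta> [b, c]
    + \<alpha> [b, c] * \<beta> [a, d] - \<alpha> [b, d] * \<beta> [a, c] + \<alpha> [c, d] * \<beta> [a, b]"
  by (simp add: wedge_eq_shuffle_sum[OF kform_2_Suc[OF assms(1)] assms(2)] interior_apply)

lemma wedge_11:
  assumes "linear p" "linear q"
  shows "(covector p \<and>\<^sub>\<Lambda> covector q) [x, y] = p x * q y - p y * q x"
  using wedge_eq_shuffle_sum[OF kform_covector[OF assms(1)] kform_covector[OF assms(2)], of "[x, y]"]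
  by (simp add: interior_apply covector_def)

lemma wedge_covector_2:
  assumes "alternating 2 \<alpha>"
  shows "(\<alpha> \<and>\<^sub>\<Lambda> covector h) [x, y, z] = \<alpha> [x, y] * h z - \<alpha> [x, z] * h y + \<alpha> [y, z] * h x"
proof -
  have "alternating (Suc (Suc 0)) \<alpha>" using assms by (simp add: numeral_2_eq_2)
  from wedge_alternating_shuffle_sum[OF this alternating_covector[of h], of "[x, y, z]"]
  show ?thesis by (simp add: interior_apply covector_def)
qed

lemma wedge_covector_3:
  assumes "kform 3 \<alpha>" "linear h"
  shows "(\<alpha> \<and>\<^sub>\<Lambda> covector h) [a, b, c, d] =
    \<alpha> [a, b, c] * h d - \<alpha> [a, b, d] * h c + \<alpha> [a, c, d] * h b - \<alpha> [b, c, d] * h a"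
  using wedge_eq_shuffle_sum[OF kform_3_Suc[OF assms(1)] kform_covector[OF assms(2)], of "[a, b, c, d]"]
  by (simp add: interior_apply covector_def)

lemma wedge_covector_4:
  assumes "kform 4 \<alpha>" "linear h"
  shows "(\<alpha> \<and>\<^sub>\<Lambda> covector h) [a, b, c, d, e] =
    \<alpha> [a, b, c, d] * h e - \<alpha> [a, b, c, e] * h d + \<alpha> [a, b, d, e] * h c - \<alpha> [a, c, d, e] * h b + \<alpha> [b, c, d, e] * h a"
  using wedge_eq_shuffle_sum[OF kform_4_Suc[OF assms(1)] kform_covector[OF assms(2)], of "[a, b, c, d, e]"]
  by (simp add: interior_apply covector_def)

lemma kform_cube:
  assumes "kform 2 \<omega>"
  shows "kform 4 (\<omega> \<and>\<^sub>\<Lambda> \<omega>)" "kform 6 (\<omega> \<and>\<^sub>\<Lambda> \<omega> \<and>\<^sub>\<Lambda> \<omega>)"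
  using kform_wedge[OF assms assms] kform_wedge[OF kform_wedge[OF assms assms] assms] by simp_all

lemma cube_symplectic_basis:
  assumes om: "kform 2 \<omega>"
    and "\<omega> [a, b] = 1" "\<omega> [c, d] = 1" "\<omega> [p, q] = 1"
    "\<omega> [a, c] = 0" "\<omega> [a, d] = 0" "\<omega> [b, c] = 0" "\<omega> [b, d] = 0"
    "\<omega> [a, p] = 0" "\<omega> [a, q] = 0" "\<omega> [b, p] = 0" "\<omega> [b, q] = 0"
    "\<omega> [c, p] = 0" "\<omega> [c, q] = 0" "\<omega> [d, p] = 0" "\<omega> [d, q] = 0"
  shows "(\<omega> \<and>\<^sub>\<Lambda> \<omega> \<and>\<^sub>\<Lambda> \<omega>) [a, b, c, d, p, q] = 6"
  by (simp add: wedge_eq_shuffle_sum[OF kform_4_Suc[OF kform_cube(1)[OF om]] om]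
      wedge_eq_shuffle_sum[OF kform_2_Suc[OF om] om] interior_apply assms)

text \<open>Three rounds of symplectic Gram-Schmidt give a Darboux basis, on which the cube is 3!.
  Applied to \<omega> it provides the orientation for \<open>J\<close>, applied to
  \<open>\<omega>\<^sub>0\<close> a volume form.\<close>

lemma nondegenerate_cube:
  fixes \<omega> :: "'h::real_vector form"
  assumes dim6: "dim (UNIV :: 'h set) = 6" and om: "kform 2 \<omega>" "nondegenerate \<omega>"
  shows "\<exists>xs. (\<omega> \<and>\<^sub>\<Lambda> \<omega> \<and>\<^sub>\<Lambda> \<omega>) xs \<noteq> 0"
proof -
  have c: "card (set xs) < dim (UNIV :: 'h set)" if "length xs < 6" for xs :: "'h list"
    using card_length[of xs] that dim6 by simp
  obtain a b P where 1: "\<omega> [a, b] = 1" "\<forall>x. x - P x \<in> span (set [a, b])"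
    "\<forall>x. \<forall>s\<in>set [a, b]. \<omega> [P x, s] = 0"
    using symplectic_pair_extend[OF om, of "set []" "\<lambda>x. x"] c[of "[]"]
    by (simp add: real_vector.span_zero) blast
  obtain u v Q where 2: "\<omega> [u, v] = 1" "\<forall>s\<in>set [a, b]. \<omega> [u, s] = 0 \<and> \<omega> [v, s] = 0"
    "\<forall>x. x - Q x \<in> span (set [u, v, a, b])" "\<forall>x. \<forall>s\<in>set [u, v, a, b]. \<omega> [Q x, s] = 0"
    using symplectic_pair_extend[OF om finite_set c, of "[a, b]" P] 1(2,3) by (simp del: ball_simps) blast
  obtain p q where 3: "\<omega> [p, q] = 1" "\<forall>s\<in>set [u, v, a, b]. \<omega> [p, s] = 0 \<and> \<omega> [q, s] = 0"
    using symplectic_pair_extend[OF om finite_set c, of "[u, v, a, b]" Q] 2(3,4) by (simp del: ball_simps) blast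
  have "(\<omega> \<and>\<^sub>\<Lambda> \<omega> \<and>\<^sub>\<Lambda> \<omega>) [p, q, u, v, a, b] = 6"
    by (rule cube_symplectic_basis[OF om(1)]) (use 1 2 3 in simp_all)
  then show ?thesis by (intro exI[of _ "[p, q, u, v, a, b]"]) simp
qed

lemma orthonormal_extend:
  fixes g :: "'h::real_vector \<Rightarrow> 'h \<Rightarrow> real"
  assumes g: "bilinear g" "\<And>v. v \<noteq> 0 \<Longrightarrow> g v v > 0"
    and S: "finite S" "card S < dim (UNIV :: 'h set)"
    and on: "\<And>s t. s \<in> S \<Longrightarrow> t \<in> S \<Longrightarrow> g s t = (if s = t then 1 else 0)"
  shows "\<exists>u. g u u = 1 \<and> (\<forall>s\<in>S. g u s = 0)"
proof -
  obtain x where x: "x \<notin> span S" using exists_not_in_span[OF S(2,1)] by blast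
  define y where "y = x - (\<Sum>s\<in>S. g x s *\<^sub>R s)"
  have "(\<Sum>s\<in>S. g x s *\<^sub>R s) \<in> span S"
    by (intro real_vector.span_sum real_vector.span_scale real_vector.span_base)
  then have "y \<noteq> 0" using x by (auto simp: y_def)
  then have pos: "g y y > 0" by (rule g(2))
  have "g y t = 0" if t: "t \<in> S" for t
  proof -
    have l: "linear (\<lambda>x. g x t)" using g(1) by (simp add: bilinear_def)
    have "(\<Sum>s\<in>S. g x s * g s t) = (\<Sum>s\<in>S. if s = t then g x t else 0)"
      using on t by (intro sum.cong) auto
    then show ?thesis using S(1) t
      by (simp add: y_def linear_diff[OF l] linear_sum[OF l] linear_scale[OF l])
  qed
  moreover have "g ((1 / sqrt (g y y)) *\<^sub>R y) ((1 / sqrt (g y y)) *\<^sub>R y) = 1"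
    using pos by (simp add: bilinear_lmul[OF g(1)] bilinear_rmul[OF g(1)])
  ultimately show ?thesis
    by (intro exI[of _ "(1 / sqrt (g y y)) *\<^sub>R y"]) (simp add: bilinear_lmul[OF g(1)])
qed

text \<open>The standard model: \<omega> = e12 + e34 + e56, and \<psi> = e135 - e146 - e236 - e245
  is the real part of (e1 + i e2)(e3 + i e4)(e5 + i e6). Only increasing indices are listed.
  \<open>J\<close> is a parameter, so computations in the frame do not see its construction.\<close>

locale su3_frame =
  fixes \<omega> \<psi> :: "'h::real_vector form" and J :: "'h \<Rightarrow> 'h" and e :: "nat \<Rightarrow> 'h"
  assumes dim6: "dim (UNIV :: 'h set) = 6"
    and kform_om: "kform 2 \<omega>" and kform_ps: "kform 3 \<psi>"
    and linear_J: "linear J" and metric_commute: "\<omega> [v, J w] = \<omega> [w, J v]"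
    and J_e: "J (e 1) = e 2" "J (e 2) = - e 1" "J (e 3) = e 4" "J (e 4) = - e 3"
      "J (e 5) = e 6" "J (e 6) = - e 5"
    and om_e: "\<omega> [e 1, e 2] = 1" "\<omega> [e 1, e 3] = 0" "\<omega> [e 1, e 4] = 0" "\<omega> [e 1, e 5] = 0" "\<omega> [e 1, e 6] = 0"
      "\<omega> [e 2, e 3] = 0" "\<omega> [e 2, e 4] = 0" "\<omega> [e 2, e 5] = 0" "\<omega> [e 2, e 6] = 0"
      "\<omega> [e 3, e 4] = 1" "\<omega> [e 3, e 5] = 0" "\<omega> [e 3, e 6] = 0"
      "\<omega> [e 4, e 5] = 0" "\<omega> [e 4, e 6] = 0" "\<omega> [e 5, e 6] = 1"
    and ps_e: "\<psi> [e 1, e 2, e 3] = 0" "\<psi> [e 1, e 2, e 4] = 0" "\<psi> [e 1, e 2, e 5] = 0" "\<psi> [e 1, e 2, e 6] = 0"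
      "\<psi> [e 1, e 3, e 4] = 0" "\<psi> [e 1, e 3, e 5] = 1" "\<psi> [e 1, e 3, e 6] = 0"
      "\<psi> [e 1, e 4, e 5] = 0" "\<psi> [e 1, e 4, e 6] = - 1" "\<psi> [e 1, e 5, e 6] = 0"
      "\<psi> [e 2, e 3, e 4] = 0" "\<psi> [e 2, e 3, e 5] = 0" "\<psi> [e 2, e 3, e 6] = - 1"
      "\<psi> [e 2, e 4, e 5] = - 1" "\<psi> [e 2, e 4, e 6] = 0" "\<psi> [e 2, e 5, e 6] = 0"
      "\<psi> [e 3, e 4, e 5] = 0" "\<psi> [e 3, e 4, e 6] = 0" "\<psi> [e 3, e 5, e 6] = 0" "\<psi> [e 4, e 5, e 6] = 0"

text \<open>Positivity of the metric forces \<open>J\<close> to be a complex structure, for which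
  \<psi> is complex trilinear up to taking real parts. A unitary frame a, b, c then determines
  \<psi> by one complex number, of modulus 1 by the normalisation, and a rotation of a makes it
  1.\<close>

lemma su3_frame_exists:
  fixes \<omega> \<psi> :: "'h::real_vector form"
  assumes dim6: "dim (UNIV :: 'h set) = 6" and su3: "su3_structure \<omega> \<psi>"
  shows "\<exists>e. su3_frame \<omega> \<psi> (su3_J \<omega> \<psi>) e"
proof -
  let ?V = "\<omega> \<and>\<^sub>\<Lambda> \<omega> \<and>\<^sub>\<Lambda> \<omega>"
  let ?S = "hitchin_endo ?V \<psi>" and ?J = "su3_J \<omega> \<psi>" and ?g = "su3_metric \<omega> \<psi>"
  have om: "kform 2 \<omega>" "nondegenerate \<omega>" and ps: "kform 3 \<psi>"
    and norm: "\<And>xs. 3 * (\<psi> \<and>\<^sub>\<Lambda> pullback ?J \<psi>) xs = 2 * ?V xs"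
    and sym: "\<And>v w. ?g v w = ?g w v" and pos: "\<And>v. v \<noteq> 0 \<Longrightarrow> ?g v v > 0"
    using su3 by (auto simp: su3_structure_def definite3_def)
  note V = kform_cube(2)[OF om(1)] nondegenerate_cube[OF dim6 om]
  note linear_S = linear_hitchin_endo[OF dim6 V ps]
  note l = linear_form2[OF om(1)]
  obtain x0 :: 'h where x0: "x0 \<noteq> 0"
    using exists_not_in_span[of "{} :: 'h set"] dim6 by auto
  define P where "P = hitchin_scalar ?V \<psi>"
  have SS: "?S (?S v) = P *\<^sub>R v" for v
  proof -
    obtain P' where P': "\<forall>v. ?S (?S v) = P' *\<^sub>R v" using hitchin_endo_square[OF dim6 V ps] by blast
    have "P = P'"
      unfolding P_def hitchin_scalar_def
    proof (rule the_equality[where P = "\<lambda>P. \<forall>v. ?S (?S v) = P *\<^sub>R v", OF P'])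
      fix Q assume "\<forall>v. ?S (?S v) = Q *\<^sub>R v"
      then have "Q *\<^sub>R x0 = P' *\<^sub>R x0" using P' by metis
      then show "Q = P'" using x0 by simp
    qed
    then show ?thesis using P' by simp
  qed
  define k where "k = 1 / sqrt (- P)"
  have J: "?J v = k *\<^sub>R ?S v" for v by (simp add: hitchin_J_def k_def P_def)
  have linear_J: "linear ?J"
    by (rule linearI) (simp_all add: J linear_add[OF linear_S] linear_scale[OF linear_S] scaleR_add_right)
  have kk: "k * k * P = - 1" if "P < 0"
    using that by (simp add: k_def field_simps)
  \<comment> \<open>The real \<open>sqrt\<close> is extended to negative arguments as an odd
    function, so for P > 0 the rescaled map would square to the identity.\<close>
  have kk': "k * k * P = 1" if "P > 0"
  proof -
    have "sqrt (- P) * sqrt (- P) = P" using that by (simp add: real_sqrt_minus)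
    then show ?thesis using that by (simp add: k_def field_simps)
  qed
  have JJ': "?J (?J v) = (k * k * P) *\<^sub>R v" for v
    by (simp add: J linear_scale[OF linear_S] SS)
  have g: "?g v w = \<omega> [v, ?J w]" for v w by (simp add: su3_metric_def)
  have om0: "\<omega> [v, v] = 0" for v using om(1) by (simp add: kform_def)
  \<comment> \<open>For P = 0, division by zero makes \<open>J\<close> vanish. For P > 0,
    \<open>J\<close> is an involution and has a nonzero w with J w = w or J w = - w, for which g w w
    = 0. Both contradict positivity.\<close>
  have "P < 0"
  proof (rule ccontr)
    assume "\<not> P < 0"
    then consider "P = 0" | "P > 0" by linarith
    then show False
    proof cases
      case 1
      then have "?J v = 0" for v by (simp add: J k_def)
      then show False using pos[OF x0] linear_0[OF l(2)] by (simp add: g)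
    next
      case 2
      then have JJ2: "?J (?J v) = v" for v using kk' JJ' by simp
      have fixed: "w = 0" if "?J w = w \<or> ?J w = - w" for w
      proof -
        have "?g w w = 0" using that om0 linear_neg[OF l(2)] by (auto simp: g)
        then show ?thesis using pos[of w] by fastforce
      qed
      have "?J (x0 + ?J x0) = x0 + ?J x0" by (simp add: linear_add[OF linear_J] JJ2 add.commute)
      then have "x0 + ?J x0 = 0" using fixed by blast
      then have "?J x0 = - x0" by (simp add: eq_neg_iff_add_eq_0 add.commute)
      then show False using fixed x0 by blast
    qed
  qed
  then have JJ: "?J (?J v) = - v" for v using JJ' kk by simp
  have bil: "bilinear ?g"
    unfolding bilinear_def g
    using l linear_compose[OF linear_J l(2)] by (auto simp: o_def)
  have om_g: "\<omega> [v, w] = - ?g v (?J w)" for v w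
    by (simp add: g JJ linear_neg[OF l(2)])
  have gJJ: "?g (?J v) (?J w) = ?g v w" for v w
    using form2_commute[OF om(1), of "?J v" w] sym[of v w]
    by (simp add: g JJ linear_neg[OF l(2)])
  have gJ: "?g (?J v) w = - ?g v (?J w)" for v w
    using gJJ[of v "?J w"] by (simp add: JJ bilinear_rneg[OF bil])
  have gvJv: "?g v (?J v) = 0" for v using om_g[of v v] om0 by simp
  have rep: "\<psi> [w, ?J v, v] = 0" for v w
    using hitchin_endo_repeat[OF dim6 V ps, of w v] linear_scale[OF kform_linear[OF ps, of "[w]" "[v]"]]
    by (simp add: J)
  have s1: "\<psi> [a, b, c] = - \<psi> [b, a, c]" for a b c
    using kform_swap[OF ps, of a b "[c]"] .
  have s2: "\<psi> [a, b, c] = - \<psi> [a, c, b]" for a b c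
    using alternating_swap[OF kform_alternating[OF ps], of "[a]" b c "[]"] by simp
  have l2: "linear (\<lambda>x. \<psi> [a, x, c])" "linear (\<lambda>x. \<psi> [a, c, x])" "linear (\<lambda>x. \<psi> [x, a, c])" for a c
    using kform_linear[OF ps, of "[a]" "[c]"] kform_linear[OF ps, of "[a, c]" "[]"]
      kform_linear[OF ps, of "[]" "[a, c]"] by simp_all
  have J2: "\<psi> [x, ?J y, z] = - \<psi> [x, ?J z, y]" for x y z
    using rep[of x "y + z"] rep[of x y] rep[of x z]
    by (simp add: linear_add[OF linear_J] linear_add[OF l2(1)] linear_add[OF l2(2)])
  \<comment> \<open>By \<open>J2\<close> and alternation \<open>J\<close> passes from the second
    slot to the third; exchanging the slots carries this over to the first.\<close>
  have ps_J2: "\<psi> [x, ?J y, z] = \<psi> [?J x, y, z]" for x y z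
    using J2[of x y z] J2[of z x y] J2[of y z x] s1[of x "?J z" y] s2[of "?J z" x y]
      s1[of "?J z" y x] s1[of z "?J x" y] s2[of "?J x" z y] s1[of y "?J z" x] s1[of z "?J y" x]
      s2[of x "?J y" z] s1[of "?J x" y z] s2[of y "?J x" z] s1[of x "?J y" z] s2[of "?J y" x z]
      s1[of z "?J y" x] s1[of y "?J x" z] s2[of z "?J x" y] s2[of y "?J z" x] s2[of z "?J y" x]
    by linarith
  have ps_J3: "\<psi> [x, y, ?J z] = \<psi> [?J x, y, z]" for x y z
    using ps_J2[of x z y] s2[of x y "?J z"] s2[of "?J x" y z] by simp
  have ps_rep: "\<psi> [?J x, x, y] = 0" "\<psi> [?J x, y, x] = 0" for x y
    using ps_J2[of x x y] s1[of x "?J x" y] s2[of "?J x" x y] by simp_all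
  have neg: "\<psi> [- x, y, z] = - \<psi> [x, y, z]" "\<psi> [x, - y, z] = - \<psi> [x, y, z]"
    "\<psi> [x, y, - z] = - \<psi> [x, y, z]" for x y z
    using linear_neg[OF l2(1)] linear_neg[OF l2(2)] linear_neg[OF l2(3)] by simp_all
  have on_ex: "\<exists>u. ?g u u = 1 \<and> (\<forall>s\<in>set us. ?g u s = 0)" if "length us < 6"
    "\<forall>s\<in>set us. ?g s s = 1" "\<forall>s\<in>set us. \<forall>t\<in>set us. s \<noteq> t \<longrightarrow> ?g s t = 0" for us
    by (rule orthonormal_extend[OF bil pos finite_set])
      (use that card_length[of us] dim6 in auto)
  obtain a where a: "?g a a = 1" using on_ex[of "[]"] by auto
  have aJ: "?g a (?J a) = 0" "?g (?J a) a = 0" "?g (?J a) (?J a) = 1" using gvJv gJJ a sym by auto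
  obtain b where b: "?g b b = 1" "?g b a = 0" "?g b (?J a) = 0"
    using on_ex[of "[a, ?J a]"] a aJ by auto
  have ab: "?g a b = 0" "?g (?J a) b = 0" "?g a (?J b) = 0" "?g (?J a) (?J b) = 0"
    "?g (?J b) a = 0" "?g (?J b) (?J a) = 0" "?g b (?J b) = 0" "?g (?J b) b = 0" "?g (?J b) (?J b) = 1"
    using b sym[of a b] sym[of "?J a" b] gJJ gJ[of b a] sym[of a "?J b"] gvJv sym[of "?J b" b] by auto
  obtain c where c: "?g c c = 1" "?g c a = 0" "?g c (?J a) = 0" "?g c b = 0" "?g c (?J b) = 0"
    using on_ex[of "[a, ?J a, b, ?J b]"] a b aJ ab by auto
  have ac: "?g a c = 0" "?g b c = 0" "?g a (?J c) = 0" "?g b (?J c) = 0"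
    using c sym[of a c] sym[of b c] gJ[of c a] gJ[of c b] sym[of a "?J c"] sym[of b "?J c"] by auto
  define r where "r = \<psi> [a, b, c]"
  define t where "t = \<psi> [?J a, b, c]"
  have cube: "?V [a, ?J a, b, ?J b, c, ?J c] = 6"
    by (rule cube_symplectic_basis[OF om(1)])
      (simp_all add: om_g JJ bilinear_rneg[OF bil] gJJ gJ a b c ab ac aJ gvJv)
  have kp: "kform 3 (pullback ?J \<psi>)" by (rule kform_pullback[OF linear_J ps])
  \<comment> \<open>The normalisation of the SU(3)-structure, evaluated on the unitary frame, where
    the cube of \<omega> is 6.\<close>
  have "3 * (4 * (r * r + t * t)) = (2 * 6 :: real)"
  proof -
    have "(\<psi> \<and>\<^sub>\<Lambda> pullback ?J \<psi>) [a, ?J a, b, ?J b, c, ?J c] = 4 * (r * r + t * t)"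
      by (simp add: wedge_eq_shuffle_sum[OF kform_3_Suc[OF ps] kp] interior_apply pullback_def
          ps_J2 ps_J3 ps_rep JJ neg linear_neg[OF linear_J] kform_repeated[OF ps] r_def t_def)
    then show ?thesis using norm[of "[a, ?J a, b, ?J b, c, ?J c]"] cube by simp
  qed
  then have rt: "r * r + t * t = 1" by simp
  \<comment> \<open>Multiplication of a by the complex number r + i t, of modulus 1. It makes \<psi>
    [a', b, c] = r^2 + t^2 = 1 and \<psi> [J a', b, c] = r t - t r = 0.\<close>
  define a' where "a' = r *\<^sub>R a + t *\<^sub>R ?J a"
  have Ja': "?J a' = r *\<^sub>R ?J a - t *\<^sub>R a"
    by (simp add: a'_def linear_add[OF linear_J] linear_scale[OF linear_J] JJ)
  define e where "e i = [a', ?J a', b, ?J b, c, ?J c] ! (i - 1)" for i :: nat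
  have e: "e 1 = a'" "e 2 = ?J a'" "e 3 = b" "e 4 = ?J b" "e 5 = c" "e 6 = ?J c"
    by (simp_all add: e_def)
  have pa: "\<psi> [a', b, c] = 1" "\<psi> [?J a', b, c] = 0"
    using rt unfolding Ja' unfolding a'_def
    by (simp_all add: linear_add[OF l2(3)] linear_scale[OF l2(3)] linear_diff[OF l2(3)] flip: r_def t_def)
  have ga: "?g a' a' = 1" "?g a' b = 0" "?g a' (?J b) = 0" "?g a' c = 0" "?g a' (?J c) = 0"
    "?g b a' = 0" "?g b (?J a') = 0" "?g c a' = 0" "?g c (?J a') = 0"
    using rt unfolding Ja' unfolding a'_def
    by (simp_all add: bilinear_ladd[OF bil] bilinear_radd[OF bil] bilinear_lmul[OF bil] bilinear_rmul[OF bil]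
        bilinear_rsub[OF bil] bilinear_rneg[OF bil] JJ gJJ gJ a b c ab ac aJ gvJv)
  have mc: "\<omega> [v, ?J w] = \<omega> [w, ?J v]" for v w using sym[of v w] by (simp add: g)
  have "su3_frame \<omega> \<psi> ?J e"
    by (rule su3_frame.intro, fact dim6, fact om(1), fact ps, fact linear_J, rule mc)
      (simp_all add: dim6 om ps linear_J e JJ om_g bilinear_rneg[OF bil] gJJ gJ b c ab ac gvJv ga
        ps_J2 ps_J3 ps_rep neg kform_repeated[OF ps] linear_neg[OF linear_J] pa del: One_nat_def)
  then show ?thesis by blast
qed

section \<open>Adapted frames of \<open>G\<^sub>2\<close>-structures\<close>

text \<open>The standard model \<phi> = e127 + e347 + e567 + e135 - e146 - e236 - e245, that is,
  \<omega> wedged with e7 plus \<psi>.\<close>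

locale g2_frame =
  fixes \<phi> :: "'a::real_vector form" and f :: "nat \<Rightarrow> 'a"
  assumes basis: "basis_list [f 1, f 2, f 3, f 4, f 5, f 6, f 7]"
    and kform_ph: "kform 3 \<phi>"
    and ph_f: "\<phi> [f 1, f 2, f 3] = 0" "\<phi> [f 1, f 2, f 4] = 0" "\<phi> [f 1, f 2, f 5] = 0" "\<phi> [f 1, f 2, f 6] = 0"
      "\<phi> [f 1, f 2, f 7] = 1" "\<phi> [f 1, f 3, f 4] = 0" "\<phi> [f 1, f 3, f 5] = 1" "\<phi> [f 1, f 3, f 6] = 0"
      "\<phi> [f 1, f 3, f 7] = 0" "\<phi> [f 1, f 4, f 5] = 0" "\<phi> [f 1, f 4, f 6] = - 1" "\<phi> [f 1, f 4, f 7] = 0"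
      "\<phi> [f 1, f 5, f 6] = 0" "\<phi> [f 1, f 5, f 7] = 0" "\<phi> [f 1, f 6, f 7] = 0"
      "\<phi> [f 2, f 3, f 4] = 0" "\<phi> [f 2, f 3, f 5] = 0" "\<phi> [f 2, f 3, f 6] = - 1" "\<phi> [f 2, f 3, f 7] = 0"
      "\<phi> [f 2, f 4, f 5] = - 1" "\<phi> [f 2, f 4, f 6] = 0" "\<phi> [f 2, f 4, f 7] = 0"
      "\<phi> [f 2, f 5, f 6] = 0" "\<phi> [f 2, f 5, f 7] = 0" "\<phi> [f 2, f 6, f 7] = 0"
      "\<phi> [f 3, f 4, f 5] = 0" "\<phi> [f 3, f 4, f 6] = 0" "\<phi> [f 3, f 4, f 7] = 1" "\<phi> [f 3, f 5, f 6] = 0"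
      "\<phi> [f 3, f 5, f 7] = 0" "\<phi> [f 3, f 6, f 7] = 0" "\<phi> [f 4, f 5, f 6] = 0" "\<phi> [f 4, f 5, f 7] = 0"
      "\<phi> [f 4, f 6, f 7] = 0" "\<phi> [f 5, f 6, f 7] = 1"
begin

definition "fs = [f 1, f 2, f 3, f 4, f 5, f 6, f 7]"

lemma basis_fs: "basis_list fs"
  unfolding fs_def by (rule basis)

lemma dim7: "dim (UNIV :: 'a set) = 7"
  using basis_list_length[OF basis] by simp

lemma length_fs: "length fs = 7"
  by (simp add: fs_def)

lemma span_fs: "span (set fs) = UNIV"
  using basis_fs by (simp only: basis_list_def)

lemma kform_interior_ph: "kform 2 (interior v \<phi>)"
  using kform_interior[of 2 \<phi>] kform_ph by simp

lemma kform_ph_ph: "kform 4 (interior v \<phi> \<and>\<^sub>\<Lambda> interior w \<phi>)"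
  using kform_wedge[OF kform_interior_ph kform_interior_ph, of v w] by simp

lemma wedge_ph:
  assumes "kform 4 \<beta>"
  shows "(\<beta> \<and>\<^sub>\<Lambda> \<phi>) fs = \<beta> [f 1, f 2, f 3, f 4] + \<beta> [f 1, f 2, f 5, f 6] + \<beta> [f 1, f 3, f 6, f 7] + \<beta> [f 1, f 4, f 5, f 7] + \<beta> [f 2, f 3, f 5, f 7] - \<beta> [f 2, f 4, f 6, f 7] + \<beta> [f 3, f 4, f 5, f 6]"
  by (simp add: wedge_eq_shuffle_sum[OF kform_4_Suc[OF assms] kform_ph] interior_apply ph_f fs_def del: One_nat_def)

lemmas ph_simps = ph_f kform_sort[OF kform_ph, where e = f] kform_repeated[OF kform_ph]

lemma g2_bilin_frame:
  assumes "i \<in> {1, 2, 3, 4, 5, 6, 7}" "j \<in> {1, 2, 3, 4, 5, 6, 7}"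
  shows "g2_bilin \<phi> (f i) (f j) fs = (if i = j then 1 else 0)"
proof -
  note e = g2_bilin_def wedge_ph[OF kform_ph_ph] wedge_22[OF kform_interior_ph kform_interior_ph]
    interior_apply ph_simps
  show ?thesis
    using assms by (elim insertE emptyE) (simp_all add: e del: One_nat_def)
qed

section \<open>Metric and volume form of a G2-structure in its frame\<close>

lemma top7_eqI: "kform 7 \<alpha> \<Longrightarrow> kform 7 \<beta> \<Longrightarrow> \<alpha> fs = \<beta> fs \<Longrightarrow> \<alpha> = \<beta>"
  using top_form_eqI[of fs \<alpha> \<beta>] span_fs unfolding length_fs by blast

definition G :: "'a \<Rightarrow> 'a \<Rightarrow> real" where
  "G v w = (\<Sum>i<7. coord fs i v * coord fs i w)"

text \<open>A top form with value 1 on the frame, obtained without a further construction.\<close>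

definition vol :: "'a form" where
  "vol = g2_bilin \<phi> (f 1) (f 1)"

lemma G_commute: "G v w = G w v"
  by (simp add: G_def mult.commute)

lemma bilinear_G: "bilinear G"
  unfolding bilinear_def
proof (intro conjI allI)
  note l = linear_coord[OF basis_fs]
  show "linear (G x)" for x
    by (rule linearI) (simp_all add: G_def linear_add[OF l] linear_scale[OF l] sum.distrib
        distrib_left sum_distrib_left mult.left_commute)
  show "linear (\<lambda>x. G x y)" for y
    by (rule linearI) (simp_all add: G_def linear_add[OF l] linear_scale[OF l] sum.distrib
        distrib_right sum_distrib_left mult.assoc)
qed

lemma coord_fs_nth: "i < 7 \<Longrightarrow> j < 7 \<Longrightarrow> coord fs i (fs ! j) = (if i = j then 1 else 0)"
  using coord_nth[OF basis_fs] unfolding length_fs by blast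

lemma G_fs: "i < 7 \<Longrightarrow> j < 7 \<Longrightarrow> G (fs ! i) (fs ! j) = (if i = j then 1 else 0)"
proof -
  assume "i < 7" "j < 7"
  then have "G (fs ! i) (fs ! j) = (\<Sum>k<7. if k = i then (if k = j then 1 else 0) else 0)"
    unfolding G_def by (intro sum.cong refl) (simp only: coord_fs_nth lessThan_iff, simp)
  then show ?thesis using \<open>i < 7\<close> by simp
qed

lemma orthonormal_fs: "orthonormal_basis G fs"
  unfolding orthonormal_basis_def length_fs using dim7 G_fs by simp

lemma kform_g2_bilin: "kform 7 (g2_bilin \<phi> v w)"
  unfolding g2_bilin_def using kform_wedge[OF kform_ph_ph kform_ph, of v w] by (intro kform_scale) simp

lemma kform_vol: "kform 7 vol"
  unfolding vol_def by (rule kform_g2_bilin)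

lemma vol_fs: "vol fs = 1"
  unfolding vol_def by (subst g2_bilin_frame) simp_all

lemma g2_bilin_fs_nth:
  assumes "i < 7" "j < 7"
  shows "g2_bilin \<phi> (fs ! i) (fs ! j) fs = (if i = j then 1 else 0)"
proof -
  have n: "fs ! i = f (Suc i)" if "i < 7" for i
  proof -
    have "i \<in> {0, 1, 2, 3, 4, 5, 6}" using that by auto
    then show ?thesis by (auto simp: eval_nat_numeral fs_def)
  qed
  have "Suc i \<in> {1, 2, 3, 4, 5, 6, 7}" "Suc j \<in> {1, 2, 3, 4, 5, 6, 7}" using assms by auto
  from g2_bilin_frame[OF this] show ?thesis unfolding n[OF assms(1)] n[OF assms(2)] by (simp only: nat.inject)
qed

lemma g2_bilin_eq: "g2_bilin \<phi> v w = (\<lambda>xs. G v w * vol xs)"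
proof (rule top7_eqI[OF kform_g2_bilin kform_scale[OF kform_vol]])
  let ?B = "\<lambda>v w. g2_bilin \<phi> v w fs"
  have l: "linear (\<lambda>v. ?B v w)" "linear (?B w)" for w
    unfolding g2_bilin_def by (rule linearI; simp add: interior_add[OF kform_ph] interior_scale[OF kform_ph]
        wedge_linear algebra_simps)+
  have x: "(\<Sum>i<7. coord fs i v *\<^sub>R fs ! i) = v" for v
    using coord_expand[OF basis_fs] unfolding length_fs .
  have "?B v w = ?B (\<Sum>i<7. coord fs i v *\<^sub>R fs ! i) (\<Sum>j<7. coord fs j w *\<^sub>R fs ! j)"
    by (simp only: x)
  also have "\<dots> = (\<Sum>i<7. coord fs i v * ?B (fs ! i) (\<Sum>j<7. coord fs j w *\<^sub>R fs ! j))"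
    by (simp only: linear_sum[OF l(1)] linear_scale[OF l(1)] real_scaleR_def)
  also have "\<dots> = (\<Sum>i<7. coord fs i v * (\<Sum>j<7. coord fs j w * ?B (fs ! i) (fs ! j)))"
    by (simp only: linear_sum[OF l(2)] linear_scale[OF l(2)] real_scaleR_def)
  also have "\<dots> = (\<Sum>i<7. coord fs i v * (\<Sum>j<7. if j = i then coord fs j w else 0))"
    by (intro sum.cong refl arg_cong2[where f = times]) (simp only: g2_bilin_fs_nth lessThan_iff, simp)
  also have "\<dots> = G v w" unfolding G_def by (intro sum.cong refl) simp
  finally show "g2_bilin \<phi> v w fs = G v w * vol fs" using vol_fs by simp
qed

definition coord_matrix :: "'a list \<Rightarrow> real mat" where
  "coord_matrix xs = mat 7 7 (\<lambda>(i, j). coord fs j (xs ! i))"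

text \<open>The determinant of the coordinates is a 7-form with value 1 on the frame, and such a
  form is unique. Linearity in one argument comes from Laplace expansion along its row.\<close>

lemma det_coord_matrix:
  assumes "length xs = 7"
  shows "det (coord_matrix xs) = vol xs"
proof -
  let ?\<gamma> = "\<lambda>xs. if length xs = 7 then det (coord_matrix xs) else 0"
  have c: "coord_matrix xs \<in> carrier_mat 7 7" for xs by (simp add: coord_matrix_def)
  have "kform 7 ?\<gamma>"
    unfolding kform_def
  proof (intro conjI allI impI)
    fix xs ys :: "'a list" assume len: "length xs + length ys + 1 = 7"
    let ?i = "length xs"
    let ?A = "\<lambda>v. coord_matrix (xs @ v # ys)"
    have i: "?i < 7" using len by simp
    \<comment> \<open>The cofactors along row i do not involve the entries of that row, hence not
      v.\<close>
    have d: "mat_delete (?A v) ?i j = mat_delete (?A 0) ?i j" for v j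
      by (rule eq_matI) (auto simp: coord_matrix_def mat_delete_def nth_append nth_Cons')
    have en: "?A v $$ (?i, j) = coord fs j v" if "j < 7" for v j
      using i that by (simp add: coord_matrix_def)
    have "det (?A v) = (\<Sum>j<7. coord fs j v * cofactor (?A 0) ?i j)" for v
    proof -
      have "det (?A v) = (\<Sum>j<7. ?A v $$ (?i, j) * cofactor (?A v) ?i j)"
        by (rule laplace_expansion_row[OF c i])
      also have "\<dots> = (\<Sum>j<7. coord fs j v * cofactor (?A 0) ?i j)"
        by (intro sum.cong refl) (simp only: en lessThan_iff cofactor_def d[of v])
      finally show ?thesis .
    qed
    then show "linear (\<lambda>v. ?\<gamma> (xs @ v # ys))"
      using len
      by (intro linearI) (simp_all add: linear_add[OF linear_coord[OF basis_fs]]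
          linear_scale[OF linear_coord[OF basis_fs]] distrib_right sum.distrib sum_distrib_left mult.assoc)
  next
    fix xs :: "'a list" assume "\<not> distinct xs"
    then obtain i j where ij: "i < length xs" "j < length xs" "i \<noteq> j" "xs ! i = xs ! j"
      by (auto simp: distinct_conv_nth)
    show "?\<gamma> xs = 0"
    proof (cases "length xs = 7")
      case True
      have "row (coord_matrix xs) i = row (coord_matrix xs) j"
        using ij True by (intro eq_vecI) (simp_all add: coord_matrix_def)
      then show ?thesis using det_identical_rows[OF c, of i j] ij True by simp
    qed simp
  qed simp
  moreover have "coord_matrix fs = 1\<^sub>m 7"
    unfolding coord_matrix_def one_mat_def by (intro cong_mat refl) (simp only: coord_fs_nth prod.case, simp)
  then have "?\<gamma> fs = vol fs" unfolding vol_fs length_fs by simp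
  ultimately have "?\<gamma> = vol" using top7_eqI kform_vol by blast
  then have "?\<gamma> xs = vol xs" by (rule fun_cong)
  then show ?thesis using assms by simp
qed

text \<open>On \<open>xs\<close> the matrix of b is vol xs times C C^T, with C the coordinate matrix
  of \<open>xs\<close>. Its determinant is vol xs to the power 7 + 2, which explains the ninth root;
  as 9 is odd the sign survives.\<close>

lemma g2_vol_eq: "g2_vol \<phi> = vol"
proof
  fix xs
  show "g2_vol \<phi> xs = vol xs"
  proof (cases "length xs = 7")
    case True
    have c: "coord_matrix xs \<in> carrier_mat 7 7" by (simp add: coord_matrix_def)
    have "mat 7 7 (\<lambda>(i, j). g2_bilin \<phi> (xs ! i) (xs ! j) xs) =
        vol xs \<cdot>\<^sub>m (coord_matrix xs * (coord_matrix xs)\<^sup>T)"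
      by (rule eq_matI)
        (auto simp: g2_bilin_eq G_def coord_matrix_def scalar_prod_def atLeast0LessThan mult.commute)
    moreover have "det \<dots> = vol xs ^ 7 * (vol xs * vol xs)"
      using c det_mult[OF c, of "(coord_matrix xs)\<^sup>T"] det_transpose[OF c] det_coord_matrix[OF True]
      by (simp add: coord_matrix_def)
    ultimately have "g2_vol \<phi> xs = root 9 (vol xs ^ 9)"
      using True by (simp add: g2_vol_def power_numeral_reduce mult.assoc)
    then show ?thesis by (simp add: odd_real_root_power_cancel)
  next
    case False
    then show ?thesis using kform_length[OF kform_vol] by (simp add: g2_vol_def)
  qed
qed

lemma g2_metric_eq: "g2_metric \<phi> = G"
proof (intro ext)
  fix v w
  show "g2_metric \<phi> v w = G v w"
    unfolding g2_metric_def g2_bilin_eq g2_vol_eq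
  proof (rule the_equality)
    show "(\<lambda>xs. G v w * vol xs) = (\<lambda>xs. G v w * vol xs)" ..
    fix c assume "(\<lambda>xs. G v w * vol xs) = (\<lambda>xs. c * vol xs)"
    then have "G v w * vol fs = c * vol fs" by meson
    then show "c = G v w" using vol_fs by simp
  qed
qed

lemma form_inner_G:
  "kform k \<alpha> \<Longrightarrow> kform k \<beta> \<Longrightarrow> form_inner G \<alpha> \<beta> = list_inner fs \<alpha> \<beta>"
  using form_inner_eq_list_inner[OF bilinear_G G_commute orthonormal_fs] dim7 by simp

text \<open>The listed values are those of e1234 + e1256 + e3456 + e1367 + e1457 + e2357 - e2467. By
  uniqueness of the dual only the product with a general 3-form has to be compared, on the frame
  alone.\<close>

lemma hodge_ph:
  assumes th: "kform 4 \<Theta>"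
    and th_f: "\<Theta> [f 1, f 2, f 3, f 4] = 1" "\<Theta> [f 1, f 2, f 3, f 5] = 0" "\<Theta> [f 1, f 2, f 3, f 6] = 0" "\<Theta> [f 1, f 2, f 3, f 7] = 0"
      "\<Theta> [f 1, f 2, f 4, f 5] = 0" "\<Theta> [f 1, f 2, f 4, f 6] = 0" "\<Theta> [f 1, f 2, f 4, f 7] = 0" "\<Theta> [f 1, f 2, f 5, f 6] = 1"
      "\<Theta> [f 1, f 2, f 5, f 7] = 0" "\<Theta> [f 1, f 2, f 6, f 7] = 0" "\<Theta> [f 1, f 3, f 4, f 5] = 0" "\<Theta> [f 1, f 3, f 4, f 6] = 0"
      "\<Theta> [f 1, f 3, f 4, f 7] = 0" "\<Theta> [f 1, f 3, f 5, f 6] = 0" "\<Theta> [f 1, f 3, f 5, f 7] = 0" "\<Theta> [f 1, f 3, f 6, f 7] = 1"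
      "\<Theta> [f 1, f 4, f 5, f 6] = 0" "\<Theta> [f 1, f 4, f 5, f 7] = 1" "\<Theta> [f 1, f 4, f 6, f 7] = 0" "\<Theta> [f 1, f 5, f 6, f 7] = 0"
      "\<Theta> [f 2, f 3, f 4, f 5] = 0" "\<Theta> [f 2, f 3, f 4, f 6] = 0" "\<Theta> [f 2, f 3, f 4, f 7] = 0" "\<Theta> [f 2, f 3, f 5, f 6] = 0"
      "\<Theta> [f 2, f 3, f 5, f 7] = 1" "\<Theta> [f 2, f 3, f 6, f 7] = 0" "\<Theta> [f 2, f 4, f 5, f 6] = 0" "\<Theta> [f 2, f 4, f 5, f 7] = 0"
      "\<Theta> [f 2, f 4, f 6, f 7] = - 1" "\<Theta> [f 2, f 5, f 6, f 7] = 0" "\<Theta> [f 3, f 4, f 5, f 6] = 1" "\<Theta> [f 3, f 4, f 5, f 7] = 0"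
      "\<Theta> [f 3, f 4, f 6, f 7] = 0" "\<Theta> [f 3, f 5, f 6, f 7] = 0" "\<Theta> [f 4, f 5, f 6, f 7] = 0"
  shows "g2_hodge \<phi> 3 \<phi> = \<Theta>"
proof -
  have "\<alpha> \<and>\<^sub>\<Lambda> \<Theta> = (\<lambda>xs. form_inner G \<alpha> \<phi> * vol xs)" if a: "kform 3 \<alpha>" for \<alpha>
  proof (rule top7_eqI)
    show "kform 7 (\<alpha> \<and>\<^sub>\<Lambda> \<Theta>)" using kform_wedge[OF a th] by simp
    show "kform 7 (\<lambda>xs. form_inner G \<alpha> \<phi> * vol xs)" by (rule kform_scale[OF kform_vol])
    have "(\<alpha> \<and>\<^sub>\<Lambda> \<Theta>) fs = list_inner fs \<alpha> \<phi>"
      by (simp add: wedge_eq_shuffle_sum[OF kform_3_Suc[OF a] th] fs_def interior_apply th_f ph_f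
          kform_length[OF a] kform_length[OF kform_ph] del: One_nat_def)
    then show "(\<alpha> \<and>\<^sub>\<Lambda> \<Theta>) fs = form_inner G \<alpha> \<phi> * vol fs"
      by (simp add: form_inner_G[OF a kform_ph] vol_fs)
  qed
  then show ?thesis
    unfolding g2_metric_eq g2_vol_eq
    using hodge_eqI[OF span_fs, where V = vol and k = 3 and \<beta> = \<phi> and g = G and \<gamma> = \<Theta>] kform_vol vol_fs dim7 kform_ph th
    by (simp add: length_fs)
qed

lemma hodge_vol:
  assumes b: "kform 2 \<beta>"
  shows "\<And>\<alpha>. kform 2 \<alpha> \<Longrightarrow> (\<alpha> \<and>\<^sub>\<Lambda> g2_hodge \<phi> 2 \<beta>) fs = list_inner fs \<alpha> \<beta>"
proof -
  fix \<alpha> :: "'a form" assume a: "kform 2 \<alpha>"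
  have "\<alpha> \<and>\<^sub>\<Lambda> g2_hodge \<phi> 2 \<beta> = (\<lambda>xs. form_inner G \<alpha> \<beta> * vol xs)"
    unfolding g2_metric_eq g2_vol_eq
    by (rule wedge_hodge[OF span_fs, unfolded length_fs, OF kform_vol _ dim7 b _ a]) (simp_all add: vol_fs)
  then show "(\<alpha> \<and>\<^sub>\<Lambda> g2_hodge \<phi> 2 \<beta>) fs = list_inner fs \<alpha> \<beta>"
    by (simp add: form_inner_G[OF a b] vol_fs)
qed

lemma coord_f:
  assumes "i \<in> {1, 2, 3, 4, 5, 6, 7}" "j \<in> {1, 2, 3, 4, 5, 6, 7}"
  shows "coord fs (i - 1) (f j) = (if i = j then 1 else 0)"
proof -
  have "f j = fs ! (j - 1)" using assms(2) by (elim insertE emptyE) (simp_all add: fs_def del: One_nat_def)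
  moreover have "i - 1 < 7" "j - 1 < 7" "i - 1 = j - 1 \<longleftrightarrow> i = j" using assms by auto
  ultimately show ?thesis using coord_fs_nth[of "i - 1" "j - 1"] by simp
qed

text \<open>The Hodge star is an isometry. Testing with the 21 products of two dual covectors
  identifies each component of \<tau>, up to sign, with the component of \<chi> on the complementary
  indices.\<close>

lemma list_inner_hodge_dual:
  assumes t: "kform 2 \<tau>" and x: "kform 5 \<chi>"
    and e: "\<And>\<alpha>. kform 2 \<alpha> \<Longrightarrow> (\<alpha> \<and>\<^sub>\<Lambda> \<chi>) fs = - list_inner fs \<alpha> \<tau>"
  shows "list_inner fs \<tau> \<tau> = list_inner fs \<chi> \<chi>"
proof -
  define c where "c i = coord fs (i - 1)" for i
  have lin: "linear (c i)" for i unfolding c_def by (rule linear_coord[OF basis_fs])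
  note c_f = coord_f[folded c_def]
  have k: "kform 2 (covector (c i) \<and>\<^sub>\<Lambda> covector (c j))" for i j
    using kform_wedge[OF kform_covector[OF lin] kform_covector[OF lin], of i j]
    by (simp add: numeral_2_eq_2)
  have v: "(covector (c i) \<and>\<^sub>\<Lambda> covector (c j)) [x, y] = c i x * c j y - c i y * c j x" for i j x y
    by (rule wedge_11[OF lin lin])
  have X: "\<alpha> [f 1, f 2] * \<chi> [f 3, f 4, f 5, f 6, f 7]
      + (- 1) * \<alpha> [f 1, f 3] * \<chi> [f 2, f 4, f 5, f 6, f 7]
      + \<alpha> [f 1, f 4] * \<chi> [f 2, f 3, f 5, f 6, f 7]
      + (- 1) * \<alpha> [f 1, f 5] * \<chi> [f 2, f 3, f 4, f 6, f 7]
      + \<alpha> [f 1, f 6] * \<chi> [f 2, f 3, f 4, f 5, f 7]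
      + (- 1) * \<alpha> [f 1, f 7] * \<chi> [f 2, f 3, f 4, f 5, f 6]
      + \<alpha> [f 2, f 3] * \<chi> [f 1, f 4, f 5, f 6, f 7]
      + (- 1) * \<alpha> [f 2, f 4] * \<chi> [f 1, f 3, f 5, f 6, f 7]
      + \<alpha> [f 2, f 5] * \<chi> [f 1, f 3, f 4, f 6, f 7]
      + (- 1) * \<alpha> [f 2, f 6] * \<chi> [f 1, f 3, f 4, f 5, f 7]
      + \<alpha> [f 2, f 7] * \<chi> [f 1, f 3, f 4, f 5, f 6]
      + \<alpha> [f 3, f 4] * \<chi> [f 1, f 2, f 5, f 6, f 7]
      + (- 1) * \<alpha> [f 3, f 5] * \<chi> [f 1, f 2, f 4, f 6, f 7]
      + \<alpha> [f 3, f 6] * \<chi> [f 1, f 2, f 4, f 5, f 7]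
      + (- 1) * \<alpha> [f 3, f 7] * \<chi> [f 1, f 2, f 4, f 5, f 6]
      + \<alpha> [f 4, f 5] * \<chi> [f 1, f 2, f 3, f 6, f 7]
      + (- 1) * \<alpha> [f 4, f 6] * \<chi> [f 1, f 2, f 3, f 5, f 7]
      + \<alpha> [f 4, f 7] * \<chi> [f 1, f 2, f 3, f 5, f 6]
      + \<alpha> [f 5, f 6] * \<chi> [f 1, f 2, f 3, f 4, f 7]
      + (- 1) * \<alpha> [f 5, f 7] * \<chi> [f 1, f 2, f 3, f 4, f 6]
      + \<alpha> [f 6, f 7] * \<chi> [f 1, f 2, f 3, f 4, f 5] =
      - (\<alpha> [f 1, f 2] * \<tau> [f 1, f 2] + \<alpha> [f 1, f 3] * \<tau> [f 1, f 3]
      + \<alpha> [f 1, f 4] * \<tau> [f 1, f 4] + \<alpha> [f 1, f 5] * \<tau> [f 1, f 5]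
      + \<alpha> [f 1, f 6] * \<tau> [f 1, f 6] + \<alpha> [f 1, f 7] * \<tau> [f 1, f 7]
      + \<alpha> [f 2, f 3] * \<tau> [f 2, f 3] + \<alpha> [f 2, f 4] * \<tau> [f 2, f 4]
      + \<alpha> [f 2, f 5] * \<tau> [f 2, f 5] + \<alpha> [f 2, f 6] * \<tau> [f 2, f 6]
      + \<alpha> [f 2, f 7] * \<tau> [f 2, f 7] + \<alpha> [f 3, f 4] * \<tau> [f 3, f 4]
      + \<alpha> [f 3, f 5] * \<tau> [f 3, f 5] + \<alpha> [f 3, f 6] * \<tau> [f 3, f 6]
      + \<alpha> [f 3, f 7] * \<tau> [f 3, f 7] + \<alpha> [f 4, f 5] * \<tau> [f 4, f 5]
      + \<alpha> [f 4, f 6] * \<tau> [f 4, f 6] + \<alpha> [f 4, f 7] * \<tau> [f 4, f 7]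
      + \<alpha> [f 5, f 6] * \<tau> [f 5, f 6] + \<alpha> [f 5, f 7] * \<tau> [f 5, f 7]
      + \<alpha> [f 6, f 7] * \<tau> [f 6, f 7])" if a: "kform 2 \<alpha>" for \<alpha>
    using e[OF a] unfolding wedge_eq_shuffle_sum[OF kform_2_Suc[OF a] x]
    by (simp add: fs_def interior_apply kform_length[OF a] kform_length[OF t] del: One_nat_def)
  have "\<tau> [f 1, f 2] = - \<chi> [f 3, f 4, f 5, f 6, f 7]" using X[OF k[of 1 2]] unfolding v by (simp add: c_f del: One_nat_def)
  moreover have "\<tau> [f 1, f 3] = \<chi> [f 2, f 4, f 5, f 6, f 7]" using X[OF k[of 1 3]] unfolding v by (simp add: c_f del: One_nat_def)
  moreover have "\<tau> [f 1, f 4] = - \<chi> [f 2, f 3, f 5, f 6, f 7]" using X[OF k[of 1 4]] unfolding v by (simp add: c_f del: One_nat_def)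
  moreover have "\<tau> [f 1, f 5] = \<chi> [f 2, f 3, f 4, f 6, f 7]" using X[OF k[of 1 5]] unfolding v by (simp add: c_f del: One_nat_def)
  moreover have "\<tau> [f 1, f 6] = - \<chi> [f 2, f 3, f 4, f 5, f 7]" using X[OF k[of 1 6]] unfolding v by (simp add: c_f del: One_nat_def)
  moreover have "\<tau> [f 1, f 7] = \<chi> [f 2, f 3, f 4, f 5, f 6]" using X[OF k[of 1 7]] unfolding v by (simp add: c_f del: One_nat_def)
  moreover have "\<tau> [f 2, f 3] = - \<chi> [f 1, f 4, f 5, f 6, f 7]" using X[OF k[of 2 3]] unfolding v by (simp add: c_f del: One_nat_def)
  moreover have "\<tau> [f 2, f 4] = \<chi> [f 1, f 3, f 5, f 6, f 7]" using X[OF k[of 2 4]] unfolding v by (simp add: c_f del: One_nat_def)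
  moreover have "\<tau> [f 2, f 5] = - \<chi> [f 1, f 3, f 4, f 6, f 7]" using X[OF k[of 2 5]] unfolding v by (simp add: c_f del: One_nat_def)
  moreover have "\<tau> [f 2, f 6] = \<chi> [f 1, f 3, f 4, f 5, f 7]" using X[OF k[of 2 6]] unfolding v by (simp add: c_f del: One_nat_def)
  moreover have "\<tau> [f 2, f 7] = - \<chi> [f 1, f 3, f 4, f 5, f 6]" using X[OF k[of 2 7]] unfolding v by (simp add: c_f del: One_nat_def)
  moreover have "\<tau> [f 3, f 4] = - \<chi> [f 1, f 2, f 5, f 6, f 7]" using X[OF k[of 3 4]] unfolding v by (simp add: c_f del: One_nat_def)
  moreover have "\<tau> [f 3, f 5] = \<chi> [f 1, f 2, f 4, f 6, f 7]" using X[OF k[of 3 5]] unfolding v by (simp add: c_f del: One_nat_def)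
  moreover have "\<tau> [f 3, f 6] = - \<chi> [f 1, f 2, f 4, f 5, f 7]" using X[OF k[of 3 6]] unfolding v by (simp add: c_f del: One_nat_def)
  moreover have "\<tau> [f 3, f 7] = \<chi> [f 1, f 2, f 4, f 5, f 6]" using X[OF k[of 3 7]] unfolding v by (simp add: c_f del: One_nat_def)
  moreover have "\<tau> [f 4, f 5] = - \<chi> [f 1, f 2, f 3, f 6, f 7]" using X[OF k[of 4 5]] unfolding v by (simp add: c_f del: One_nat_def)
  moreover have "\<tau> [f 4, f 6] = \<chi> [f 1, f 2, f 3, f 5, f 7]" using X[OF k[of 4 6]] unfolding v by (simp add: c_f del: One_nat_def)
  moreover have "\<tau> [f 4, f 7] = - \<chi> [f 1, f 2, f 3, f 5, f 6]" using X[OF k[of 4 7]] unfolding v by (simp add: c_f del: One_nat_def)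
  moreover have "\<tau> [f 5, f 6] = - \<chi> [f 1, f 2, f 3, f 4, f 7]" using X[OF k[of 5 6]] unfolding v by (simp add: c_f del: One_nat_def)
  moreover have "\<tau> [f 5, f 7] = \<chi> [f 1, f 2, f 3, f 4, f 6]" using X[OF k[of 5 7]] unfolding v by (simp add: c_f del: One_nat_def)
  moreover have "\<tau> [f 6, f 7] = - \<chi> [f 1, f 2, f 3, f 4, f 5]" using X[OF k[of 6 7]] unfolding v by (simp add: c_f del: One_nat_def)
  ultimately show ?thesis
    by (simp add: fs_def interior_apply kform_length[OF t] kform_length[OF x] del: One_nat_def)
qed

end

section \<open>Torsion of an \<open>SU(3)\<close>-structure in an adapted frame\<close>

context su3_frame
begin

definition "es = [e 1, e 2, e 3, e 4, e 5, e 6]"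

definition g :: "'h \<Rightarrow> 'h \<Rightarrow> real" where
  "g v w = \<omega> [v, J w]"

lemma length_es: "length es = 6"
  by (simp add: es_def)

lemma bilinear_g: "bilinear g"
  using linear_form2[OF kform_om] linear_compose[OF linear_J linear_form2(2)[OF kform_om]]
  by (simp add: bilinear_def g_def o_def)

lemma g_commute: "g v w = g w v"
  by (simp add: g_def metric_commute)

lemma om_neg: "\<omega> [x, - y] = - \<omega> [x, y]"
  by (rule linear_neg[OF linear_form2(2)[OF kform_om]])

lemmas om_simps = om_e om_neg kform_sort[OF kform_om, where e = e] kform_repeated[OF kform_om]

lemma g_es: "i < 6 \<Longrightarrow> j < 6 \<Longrightarrow> g (es ! i) (es ! j) = (if i = j then 1 else 0)"
proof -
  assume "i < 6" "j < 6"
  then have "i \<in> {0, 1, 2, 3, 4, 5}" "j \<in> {0, 1, 2, 3, 4, 5}" by auto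
  then show ?thesis
    by (elim insertE emptyE) (simp_all add: es_def g_def J_e om_simps del: One_nat_def)
qed

lemma orthonormal_es: "orthonormal_basis g es"
  using g_es dim6 by (simp add: orthonormal_basis_def length_es)

lemma basis_es: "basis_list es"
  using orthonormal_basis_basis_list[OF bilinear_g orthonormal_es] dim6 by simp

lemma span_es: "span (set es) = UNIV"
  using basis_es by (simp only: basis_list_def)

lemma form_inner_g:
  "kform k \<alpha> \<Longrightarrow> kform k \<beta> \<Longrightarrow> form_inner g \<alpha> \<beta> = list_inner es \<alpha> \<beta>"
  using form_inner_eq_list_inner[OF bilinear_g g_commute orthonormal_es] dim6 by simp

text \<open>Used to recognise the sum of the (1,2), (3,4) and (5,6) components of
  \<open>endo_act A \<omega>\<close> as the trace of \<open>A\<close>.\<close>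

lemma om_right: "\<omega> [x, e 2] = g x (e 1)" "\<omega> [x, e 4] = g x (e 3)" "\<omega> [x, e 6] = g x (e 5)"
  by (simp_all add: g_def J_e del: One_nat_def)

lemma om_left: "\<omega> [e 1, x] = g x (e 2)" "\<omega> [e 3, x] = g x (e 4)" "\<omega> [e 5, x] = g x (e 6)"
  using form2_commute[OF kform_om, of x] by (simp_all add: g_def J_e om_neg del: One_nat_def)

lemma lin_trace_es:
  assumes "linear A"
  shows "lin_trace A = g (A (e 1)) (e 1) + g (A (e 2)) (e 2) + g (A (e 3)) (e 3)
    + g (A (e 4)) (e 4) + g (A (e 5)) (e 5) + g (A (e 6)) (e 6)"
proof -
  have "coord es i x = g x (es ! i)" if "i < 6" for i x
    using orthonormal_basis_coord[OF bilinear_g orthonormal_es basis_es] that by (simp add: length_es)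
  then have "lin_trace A = (\<Sum>i<6. g (A (es ! i)) (es ! i))"
    by (simp add: lin_trace_basis_list[OF basis_es assms] length_es)
  also have "{..<6} = {0, 1, 2, 3, 4, 5 :: nat}" by auto
  finally show ?thesis by (simp add: es_def)
qed

lemma ps_neg: "\<psi> [- x, y, z] = - \<psi> [x, y, z]" "\<psi> [x, - y, z] = - \<psi> [x, y, z]"
  "\<psi> [x, y, - z] = - \<psi> [x, y, z]"
  using linear_neg[OF kform_linear[OF kform_ps, of "[]" "[y, z]"]]
    linear_neg[OF kform_linear[OF kform_ps, of "[x]" "[z]"]]
    linear_neg[OF kform_linear[OF kform_ps, of "[x, y]" "[]"]] by simp_all

lemma kform_psm: "kform 3 (pullback J \<psi>)"
  by (rule kform_pullback[OF linear_J kform_ps])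

lemma psm_e: "pullback J \<psi> [e 1, e 2, e 3] = 0" "pullback J \<psi> [e 1, e 2, e 4] = 0" "pullback J \<psi> [e 1, e 2, e 5] = 0"
    "pullback J \<psi> [e 1, e 2, e 6] = 0" "pullback J \<psi> [e 1, e 3, e 4] = 0" "pullback J \<psi> [e 1, e 3, e 5] = 0"
    "pullback J \<psi> [e 1, e 3, e 6] = 1" "pullback J \<psi> [e 1, e 4, e 5] = 1" "pullback J \<psi> [e 1, e 4, e 6] = 0"
    "pullback J \<psi> [e 1, e 5, e 6] = 0" "pullback J \<psi> [e 2, e 3, e 4] = 0" "pullback J \<psi> [e 2, e 3, e 5] = 1"
    "pullback J \<psi> [e 2, e 3, e 6] = 0" "pullback J \<psi> [e 2, e 4, e 5] = 0" "pullback J \<psi> [e 2, e 4, e 6] = - 1"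
    "pullback J \<psi> [e 2, e 5, e 6] = 0" "pullback J \<psi> [e 3, e 4, e 5] = 0" "pullback J \<psi> [e 3, e 4, e 6] = 0"
    "pullback J \<psi> [e 3, e 5, e 6] = 0" "pullback J \<psi> [e 4, e 5, e 6] = 0"
  by (simp_all add: pullback_def J_e ps_neg ps_e kform_sort[OF kform_ps, where e = e]
      kform_repeated[OF kform_ps] del: One_nat_def)

lemma wedge_om_om:
  assumes "kform 2 \<beta>"
  shows "(\<beta> \<and>\<^sub>\<Lambda> (\<omega> \<and>\<^sub>\<Lambda> \<omega>)) es = 2 * (\<beta> [e 1, e 2] + \<beta> [e 3, e 4] + \<beta> [e 5, e 6])"
  by (simp add: wedge_eq_shuffle_sum[OF kform_2_Suc[OF assms] kform_cube(1)[OF kform_om]] es_def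
      interior_apply wedge_22[OF kform_om kform_om] om_e del: One_nat_def)

lemma form2_J_neg:
  assumes "kform 2 \<beta>"
  shows "\<beta> [- x, y] = - \<beta> [x, y]" "\<beta> [x, - y] = - \<beta> [x, y]"
  using linear_neg[OF linear_form2(1)[OF assms]] linear_neg[OF linear_form2(2)[OF assms]] by simp_all

text \<open>Seven relations among the 15 components: six from invariance under \<open>J\<close>, one
  from vanishing \<omega>-trace. Eight free components remain.\<close>

lemma primitive_relations:
  assumes b: "kform 2 \<beta>" "pullback J \<beta> = \<beta>" "\<beta> \<and>\<^sub>\<Lambda> (\<omega> \<and>\<^sub>\<Lambda> \<omega>) = (\<lambda>xs. 0)"
  shows "\<beta> [e 2, e 4] = \<beta> [e 1, e 3]" "\<beta> [e 2, e 3] = - \<beta> [e 1, e 4]"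
    "\<beta> [e 2, e 6] = \<beta> [e 1, e 5]" "\<beta> [e 2, e 5] = - \<beta> [e 1, e 6]"
    "\<beta> [e 4, e 6] = \<beta> [e 3, e 5]" "\<beta> [e 4, e 5] = - \<beta> [e 3, e 6]"
    "\<beta> [e 5, e 6] = - \<beta> [e 1, e 2] - \<beta> [e 3, e 4]"
proof -
  have J: "\<beta> [J x, J y] = \<beta> [x, y]" for x y
    using fun_cong[OF b(2), of "[x, y]"] by (simp add: pullback_def)
  show "\<beta> [e 2, e 4] = \<beta> [e 1, e 3]" "\<beta> [e 2, e 3] = - \<beta> [e 1, e 4]"
    "\<beta> [e 2, e 6] = \<beta> [e 1, e 5]" "\<beta> [e 2, e 5] = - \<beta> [e 1, e 6]"
    "\<beta> [e 4, e 6] = \<beta> [e 3, e 5]" "\<beta> [e 4, e 5] = - \<beta> [e 3, e 6]"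
    using J[of "e 1" "e 3"] J[of "e 1" "e 4"] J[of "e 1" "e 5"] J[of "e 1" "e 6"] J[of "e 3" "e 5"]
      J[of "e 3" "e 6"] by (simp_all add: J_e form2_J_neg[OF b(1)] del: One_nat_def)
  show "\<beta> [e 5, e 6] = - \<beta> [e 1, e 2] - \<beta> [e 3, e 4]"
    using wedge_om_om[OF b(1)] fun_cong[OF b(3), of es] by simp
qed

text \<open>Wedging with \<omega> is isometric on the forms \<beta> considered, wedging with \<psi>
  doubles the squared norm of a 1-form, and the two images are orthogonal. In components this is a
  polynomial identity.\<close>

lemma norm_dpsm:
  assumes b: "kform 2 \<beta>" "pullback J \<beta> = \<beta>" "\<beta> \<and>\<^sub>\<Lambda> (\<omega> \<and>\<^sub>\<Lambda> \<omega>) = (\<lambda>xs. 0)" and w: "kform 1 \<alpha>"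
    and k: "kform 4 \<chi>" and x: "\<And>xs. \<chi> xs = (\<beta> \<and>\<^sub>\<Lambda> \<omega>) xs + (pullback J \<alpha> \<and>\<^sub>\<Lambda> \<psi>) xs"
  shows "list_inner es \<chi> \<chi> = list_inner es \<beta> \<beta> + 2 * list_inner es \<alpha> \<alpha>"
proof -
  have Jw: "kform (Suc 0) (pullback J \<alpha>)" using kform_pullback[OF linear_J w] by simp
  have an: "\<alpha> [- v] = - \<alpha> [v]" for v using linear_neg[OF kform_linear_Cons[OF w]] .
  show ?thesis
    by (simp add: es_def interior_apply kform_length[OF w] kform_length[OF b(1)] kform_length[OF k] del: One_nat_def,
        simp add: x wedge_22[OF b(1) kform_om] wedge_eq_shuffle_sum[OF Jw kform_ps] interior_apply om_e ps_e
          J_e pullback_def an primitive_relations[OF b] del: One_nat_def)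
      (simp add: algebra_simps)
qed

text \<open>In dimension six, wedging with \<omega> is injective on 2-forms, so the hypothesis
  determines \<open>F\<close>: a part - \<beta> of type (1,1), which is annihilated by J\<psi>, and
  a part depending on \<alpha>. Each component of the product is therefore twice a component of
  \<alpha>, and squaring gives the 4.\<close>

lemma norm_psm_wedge:
  assumes b: "kform 2 \<beta>" "pullback J \<beta> = \<beta>" "\<beta> \<and>\<^sub>\<Lambda> (\<omega> \<and>\<^sub>\<Lambda> \<omega>) = (\<lambda>xs. 0)" and w: "kform 1 \<alpha>"
    and F: "kform 2 F" and x: "\<And>xs. (\<beta> \<and>\<^sub>\<Lambda> \<omega>) xs + (\<alpha> \<and>\<^sub>\<Lambda> \<psi>) xs = - (\<omega> \<and>\<^sub>\<Lambda> F) xs"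
  shows "list_inner es (pullback J \<psi> \<and>\<^sub>\<Lambda> F) (pullback J \<psi> \<and>\<^sub>\<Lambda> F) = 4 * list_inner es \<alpha> \<alpha>"
proof -
  have w': "kform (Suc 0) \<alpha>" using w by simp
  note q = wedge_22[OF b(1) kform_om] wedge_22[OF kform_om F] wedge_eq_shuffle_sum[OF w' kform_ps]
    interior_apply om_e ps_e primitive_relations[OF b]
  note s = wedge_eq_shuffle_sum[OF kform_3_Suc[OF kform_psm] F] interior_apply psm_e
  note X = x[of "[e 1, e 2, e 3, e 4]"] x[of "[e 1, e 2, e 3, e 5]"] x[of "[e 1, e 2, e 3, e 6]"] x[of "[e 1, e 2, e 4, e 5]"]
    x[of "[e 1, e 2, e 4, e 6]"] x[of "[e 1, e 2, e 5, e 6]"] x[of "[e 1, e 3, e 4, e 5]"] x[of "[e 1, e 3, e 4, e 6]"]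
    x[of "[e 1, e 3, e 5, e 6]"] x[of "[e 1, e 4, e 5, e 6]"] x[of "[e 2, e 3, e 4, e 5]"] x[of "[e 2, e 3, e 4, e 6]"]
    x[of "[e 2, e 3, e 5, e 6]"] x[of "[e 2, e 4, e 5, e 6]"] x[of "[e 3, e 4, e 5, e 6]"]
  have k: "kform 5 (pullback J \<psi> \<and>\<^sub>\<Lambda> F)" using kform_wedge[OF kform_psm F] by simp
  have "(pullback J \<psi> \<and>\<^sub>\<Lambda> F) [e 1, e 2, e 3, e 4, e 5] = 2 * \<alpha> [e 5]"
    by (simp add: s del: One_nat_def) (use X in \<open>simp add: q del: One_nat_def\<close>)
  moreover have "(pullback J \<psi> \<and>\<^sub>\<Lambda> F) [e 1, e 2, e 3, e 4, e 6] = 2 * \<alpha> [e 6]"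
    by (simp add: s del: One_nat_def) (use X in \<open>simp add: q del: One_nat_def\<close>)
  moreover have "(pullback J \<psi> \<and>\<^sub>\<Lambda> F) [e 1, e 2, e 3, e 5, e 6] = 2 * \<alpha> [e 3]"
    by (simp add: s del: One_nat_def) (use X in \<open>simp add: q del: One_nat_def\<close>)
  moreover have "(pullback J \<psi> \<and>\<^sub>\<Lambda> F) [e 1, e 2, e 4, e 5, e 6] = 2 * \<alpha> [e 4]"
    by (simp add: s del: One_nat_def) (use X in \<open>simp add: q del: One_nat_def\<close>)
  moreover have "(pullback J \<psi> \<and>\<^sub>\<Lambda> F) [e 1, e 3, e 4, e 5, e 6] = 2 * \<alpha> [e 1]"
    by (simp add: s del: One_nat_def) (use X in \<open>simp add: q del: One_nat_def\<close>)
  moreover have "(pullback J \<psi> \<and>\<^sub>\<Lambda> F) [e 2, e 3, e 4, e 5, e 6] = 2 * \<alpha> [e 2]"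
    by (simp add: s del: One_nat_def) (use X in \<open>simp add: q del: One_nat_def\<close>)
  ultimately show ?thesis
    by (simp add: es_def interior_apply kform_length[OF w] kform_length[OF k] del: One_nat_def)
qed

text \<open>The Lefschetz map from 2-forms to 4-forms is injective in dimension six; here the linear
  system is solved component by component.\<close>

lemma wedge_om_coefficients:
  assumes b: "kform 2 \<beta>" "pullback J \<beta> = \<beta>" "\<beta> \<and>\<^sub>\<Lambda> (\<omega> \<and>\<^sub>\<Lambda> \<omega>) = (\<lambda>xs. 0)"
    and F: "kform 2 F" and x: "\<And>xs. (\<beta> \<and>\<^sub>\<Lambda> \<omega>) xs = - (\<omega> \<and>\<^sub>\<Lambda> F) xs"
  shows "F = (\<lambda>xs. - \<beta> xs)"
proof (rule kform_eqI[OF F kform_minus[OF b(1)] span_es])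
  note q = wedge_22[OF b(1) kform_om] wedge_22[OF kform_om F] om_e primitive_relations[OF b]
  note X = x[of "[e 1, e 2, e 3, e 4]"] x[of "[e 1, e 2, e 3, e 5]"] x[of "[e 1, e 2, e 3, e 6]"] x[of "[e 1, e 2, e 4, e 5]"]
    x[of "[e 1, e 2, e 4, e 6]"] x[of "[e 1, e 2, e 5, e 6]"] x[of "[e 1, e 3, e 4, e 5]"] x[of "[e 1, e 3, e 4, e 6]"]
    x[of "[e 1, e 3, e 5, e 6]"] x[of "[e 1, e 4, e 5, e 6]"] x[of "[e 2, e 3, e 4, e 5]"] x[of "[e 2, e 3, e 4, e 6]"]
    x[of "[e 2, e 3, e 5, e 6]"] x[of "[e 2, e 4, e 5, e 6]"] x[of "[e 3, e 4, e 5, e 6]"]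
  have "F [e 1, e 2] = - \<beta> [e 1, e 2]" "F [e 1, e 3] = - \<beta> [e 1, e 3]" "F [e 1, e 4] = - \<beta> [e 1, e 4]" "F [e 1, e 5] = - \<beta> [e 1, e 5]"
    "F [e 1, e 6] = - \<beta> [e 1, e 6]" "F [e 2, e 3] = - \<beta> [e 2, e 3]" "F [e 2, e 4] = - \<beta> [e 2, e 4]" "F [e 2, e 5] = - \<beta> [e 2, e 5]"
    "F [e 2, e 6] = - \<beta> [e 2, e 6]" "F [e 3, e 4] = - \<beta> [e 3, e 4]" "F [e 3, e 5] = - \<beta> [e 3, e 5]" "F [e 3, e 6] = - \<beta> [e 3, e 6]"
    "F [e 4, e 5] = - \<beta> [e 4, e 5]" "F [e 4, e 6] = - \<beta> [e 4, e 6]" "F [e 5, e 6] = - \<beta> [e 5, e 6]"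
    using X by (simp_all add: q del: One_nat_def)
  then show "forms_agree es F (\<lambda>xs. - \<beta> xs)"
    by (simp add: es_def interior_apply kform_length[OF F] kform_length[OF b(1)] primitive_relations[OF b] del: One_nat_def)
qed

text \<open>The Hodge-Riemann sign for primitive forms of type (1,1). The definiteness is what makes
  \<beta> vanish when its square wedged with \<omega> does.\<close>

lemma primitive_square:
  assumes b: "kform 2 \<beta>" "pullback J \<beta> = \<beta>" "\<beta> \<and>\<^sub>\<Lambda> (\<omega> \<and>\<^sub>\<Lambda> \<omega>) = (\<lambda>xs. 0)"
  shows "(\<beta> \<and>\<^sub>\<Lambda> \<omega> \<and>\<^sub>\<Lambda> \<beta>) es = - list_inner es \<beta> \<beta>"
proof -
  have k: "kform 4 (\<beta> \<and>\<^sub>\<Lambda> \<omega>)" using kform_wedge[OF b(1) kform_om] by simp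
  show ?thesis
    by (simp add: wedge_eq_shuffle_sum[OF kform_4_Suc[OF k] b(1)] wedge_22[OF b(1) kform_om] interior_apply om_e
        primitive_relations[OF b] es_def kform_length[OF b(1)] del: One_nat_def)
      (simp add: algebra_simps)
qed

end

section \<open>Central extensions\<close>

lemma list_inner_self_nonneg: "list_inner es \<beta> \<beta> \<ge> 0"
  by (induction es arbitrary: \<beta>) simp_all

lemma list_inner_self_eq_0:
  assumes "kform k \<beta>" "list_inner es \<beta> \<beta> = 0" "span (set es) = UNIV"
  shows "\<beta> = (\<lambda>xs. 0)"
proof (rule kform_eqI[OF assms(1) kform_zero assms(3)])
  show "forms_agree es \<beta> (\<lambda>xs. 0)" using assms(2)
  proof (induction es arbitrary: \<beta>)
    case (Cons e es)
    then have "list_inner es \<beta> \<beta> = 0" "list_inner es (interior e \<beta>) (interior e \<beta>) = 0"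
      using list_inner_self_nonneg[of es \<beta>] list_inner_self_nonneg[of es "interior e \<beta>"] by simp_all
    then show ?case using Cons.IH by (simp add: interior_def[of _ "\<lambda>xs. 0"])
  qed simp
qed

lemma lin_trace_prod:
  fixes D :: "'h::real_vector \<times> real \<Rightarrow> 'h \<times> real" and es :: "'h list"
  assumes b: "basis_list es" and D: "linear D"
  shows "lin_trace D = lin_trace (\<lambda>x. fst (D (x, 0))) + snd (D (0, 1))"
proof -
  let ?n = "length es"
  let ?\<epsilon> = "\<lambda>i x. if i < ?n then coord es i (fst x) else snd x"
  let ?b = "\<lambda>i. if i < ?n then (es ! i, 0) else (0, 1 :: real)"
  have lc: "linear (coord es i)" for i by (rule linear_coord[OF b])
  have "lin_trace D = (\<Sum>i<Suc ?n. ?\<epsilon> i (D (?b i)))"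
  proof (rule lin_trace_coords[OF _ D])
    show "linear (?\<epsilon> i)" for i
      using linear_compose[OF linear_fst lc] linear_snd by (cases "i < ?n") (simp_all add: o_def)
    fix x :: "'h \<times> real"
    have "(\<Sum>i<?n. coord es i (fst x) *\<^sub>R (es ! i, 0 :: real)) = (fst x, 0)"
      by (rule prod_eqI) (simp_all add: fst_sum snd_sum coord_expand[OF b])
    then show "(\<Sum>i<Suc ?n. ?\<epsilon> i x *\<^sub>R ?b i) = x" by (cases x) simp
  qed simp
  also have "\<dots> = (\<Sum>i<?n. coord es i (fst (D (es ! i, 0)))) + snd (D (0, 1))" by simp
  also have "(\<Sum>i<?n. coord es i (fst (D (es ! i, 0)))) = lin_trace (\<lambda>x. fst (D (x, 0)))"
  proof (rule lin_trace_basis_list[OF b, symmetric])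
    have "linear (\<lambda>x :: 'h. (x, 0 :: real))" by (rule linearI) simp_all
    from linear_compose[OF linear_compose[OF this D] linear_fst]
    show "linear (\<lambda>x. fst (D (x, 0)))" by (simp add: o_def)
  qed
  finally show ?thesis .
qed

text \<open>The projection \<open>fst\<close> is a homomorphism of the brackets.\<close>

lemma ce_diff_pullback_fst:
  "ce_diff (central_ext br \<omega>\<^sub>0) (pullback fst \<alpha>) = pullback fst (ce_diff br \<alpha>)"
  by (rule ext) (simp add: ce_diff_def pullback_def central_ext_def nths_map)

lemma ce_diff_covector: "ce_diff br (covector h) [x, y] = - h (br x y)"
proof -
  have "nths [x, y] (- {0, 1}) = []" by (simp add: nths_Cons)
  then show ?thesis by (simp add: ce_diff_def numeral_2_eq_2 covector_def)
qed

lemma bilinear_central_ext: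
  assumes "bilinear br" "kform 2 \<omega>\<^sub>0"
  shows "bilinear (central_ext br \<omega>\<^sub>0)"
  unfolding bilinear_def
  by (auto intro!: linearI simp: central_ext_def bilinear_ladd[OF assms(1)] bilinear_radd[OF assms(1)]
      bilinear_lmul[OF assms(1)] bilinear_rmul[OF assms(1)] linear_add[OF linear_form2(1)[OF assms(2)]]
      linear_add[OF linear_form2(2)[OF assms(2)]] linear_scale[OF linear_form2(1)[OF assms(2)]]
      linear_scale[OF linear_form2(2)[OF assms(2)]])

lemma central_ext_self: "br (fst x) (fst x) = 0 \<Longrightarrow> kform 2 \<omega>\<^sub>0 \<Longrightarrow> central_ext br \<omega>\<^sub>0 x x = 0"
  by (simp add: central_ext_def kform_def zero_prod_def)

lemma linear_embed: "linear (\<lambda>x :: 'h::real_vector. (x, 0 :: real))"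
  by (rule linearI) simp_all

text \<open>Each ad x annihilates the central vector, so only the trace on the base remains.\<close>

lemma unimodular_central_ext:
  fixes br :: "'h::real_vector \<Rightarrow> 'h \<Rightarrow> 'h"
  assumes "bilinear br" "kform 2 \<omega>\<^sub>0" "unimodular br" "basis_list (es :: 'h list)"
  shows "unimodular (central_ext br \<omega>\<^sub>0)"
  unfolding unimodular_def
proof
  fix x :: "'h \<times> real"
  have "linear (central_ext br \<omega>\<^sub>0 x)" by (rule linear_right_bilinear[OF bilinear_central_ext[OF assms(1,2)]])
  from lin_trace_prod[OF assms(4) this] show "lin_trace (central_ext br \<omega>\<^sub>0 x) = 0"
    using assms(3) linear_0[OF linear_form2(2)[OF assms(2)]]
    by (simp add: central_ext_def unimodular_def)
qed

text \<open>The functional \<open>\<epsilon> = u \<eta>\<close> is linear because \<open>\<phi>\<close> is multilinear and \<open>\<omega>\<close> does not vanish;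
  this does not use any property of the metric of \<open>\<phi>\<close>.\<close>

lemma induced_su3_decomposition:
  fixes \<phi> :: "('h::real_vector \<times> real) form"
  assumes dim6: "dim (UNIV :: 'h set) = 6" and ph: "g2_structure \<phi>" and ind: "induced_su3 \<phi> \<omega> \<psi>"
  shows "\<exists>\<epsilon>. linear \<epsilon> \<and> \<epsilon> central_vec \<noteq> 0 \<and>
    \<phi> = (\<lambda>xs. (pullback fst \<omega> \<and>\<^sub>\<Lambda> covector \<epsilon>) xs + pullback fst \<psi> xs)"
proof -
  define u where "u = sqrt (g2_metric \<phi> central_vec central_vec)"
  define \<epsilon> where "\<epsilon> v = u * (g2_metric \<phi> central_vec v / g2_metric \<phi> central_vec central_vec)" for v
  have om: "kform 2 \<omega>" "nondegenerate \<omega>" and ps: "kform 3 \<psi>"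
    using ind by (auto simp: induced_su3_def su3_structure_def definite3_def)
  have kph: "kform 3 \<phi>" using ph by (simp add: g2_structure_def)
  have pom: "kform 2 (pullback fst \<omega> :: ('h \<times> real) form)" by (rule kform_pullback[OF linear_fst om(1)])
  have pps: "kform 3 (pullback fst \<psi> :: ('h \<times> real) form)" by (rule kform_pullback[OF linear_fst ps])
  have "covector \<epsilon> = (\<lambda>xs. u * g2_eta \<phi> xs)"
    by (simp add: fun_eq_iff covector_def g2_eta_def \<epsilon>_def)
  then have c: "pullback fst \<omega> \<and>\<^sub>\<Lambda> covector \<epsilon> = (\<lambda>xs. u * (pullback fst \<omega> \<and>\<^sub>\<Lambda> g2_eta \<phi>) xs)"
    by (simp add: wedge_scale_right)
  have eq: "\<phi> = (\<lambda>xs. (pullback fst \<omega> \<and>\<^sub>\<Lambda> covector \<epsilon>) xs + pullback fst \<psi> xs)"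
    unfolding c using ind by (simp add: fun_eq_iff induced_su3_def u_def)
  have ph3: "\<phi> [x, y, z] = \<omega> [fst x, fst y] * \<epsilon> z - \<omega> [fst x, fst z] * \<epsilon> y + \<omega> [fst y, fst z] * \<epsilon> x
      + \<psi> [fst x, fst y, fst z]" for x y z
    by (subst eq) (simp add: wedge_covector_2[OF kform_alternating[OF pom]] pullback_def)
  obtain x0 :: 'h where "x0 \<noteq> 0"
    using exists_not_in_span[of "{} :: 'h set"] dim6 by auto
  then obtain y0 where y0: "\<omega> [x0, y0] \<noteq> 0" using om(2) by (auto simp: nondegenerate_def)
  have lin: "linear \<epsilon>"
  proof -
    define a b c d where "a = (\<lambda>v. \<phi> [(x0, 0), (y0, 0), v])" and "b = (\<lambda>v. pullback fst \<omega> [(x0, 0 :: real), v])"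
      and "c = (\<lambda>v. pullback fst \<omega> [(y0, 0 :: real), v])" and "d = (\<lambda>v. pullback fst \<psi> [(x0, 0), (y0, 0 :: real), v])"
    \<comment> \<open>The value of \<phi> on (x0, y0, v) is solved for \<epsilon> v, which is
      possible as \<omega> [x0, y0] is nonzero.\<close>
    have e: "\<epsilon> v = (a v + b v * \<epsilon> (y0, 0) - c v * \<epsilon> (x0, 0) - d v) / \<omega> [x0, y0]" for v
      using y0 by (simp add: ph3 pullback_def a_def b_def c_def d_def)
    have l: "linear a" "linear b" "linear c" "linear d"
      using kform_linear[OF kph, of "[(x0, 0), (y0, 0)]" "[]"] kform_linear[OF pps, of "[(x0, 0), (y0, 0)]" "[]"]
        linear_form2(2)[OF pom] by (simp_all add: a_def b_def c_def d_def)
    define s t where "s = \<epsilon> (y0, 0)" and "t = \<epsilon> (x0, 0)"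
    show ?thesis
      by (rule linearI)
        (simp_all add: e[folded s_def t_def] linear_add[OF l(1)] linear_add[OF l(2)] linear_add[OF l(3)] linear_add[OF l(4)]
          linear_scale[OF l(1)] linear_scale[OF l(2)] linear_scale[OF l(3)] linear_scale[OF l(4)]
          add_divide_distrib diff_divide_distrib algebra_simps)
  qed
  \<comment> \<open>Otherwise \<phi> would be pulled back from the base, and its contraction with
    the central vector would have rank 0 instead of 6.\<close>
  have "u \<noteq> 0"
  proof
    assume "u = 0"
    then have "\<epsilon> = (\<lambda>v. 0)" by (simp add: \<epsilon>_def fun_eq_iff)
    moreover have "covector (\<lambda>v :: 'h \<times> real. 0) = (\<lambda>xs. 0)" by (simp add: covector_def fun_eq_iff)
    ultimately have "\<phi> = pullback fst \<psi>" using eq by simp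
    then have "interior central_vec \<phi> = (\<lambda>xs. 0)"
      using linear_0[OF kform_linear_Cons[OF ps]] by (simp add: interior_def pullback_def fun_eq_iff)
    then have "form_rank (interior central_vec \<phi>) = 0" by (simp add: form_rank_def)
    moreover have "(central_vec :: 'h \<times> real) \<noteq> 0" by (simp add: zero_prod_def)
    then have "form_rank (interior central_vec \<phi>) = 6" using ph unfolding g2_structure_def by blast
    ultimately show False by simp
  qed
  \<comment> \<open>A nonzero \<open>u\<close> means that g (z, z) is nonzero, so the quotient in
    \<epsilon> is 1 at z and \<epsilon> z = u.\<close>
  then have "\<epsilon> central_vec \<noteq> 0" by (auto simp: \<epsilon>_def u_def)
  then show ?thesis using lin eq by blast
qed

section \<open>Pairings with \<phi> and uniqueness of the torsion form\<close>

context g2_frame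
begin

lemma coordinates_expand:
  assumes "linear L"
  shows "L x = coord fs 0 x * L (f 1) + coord fs 1 x * L (f 2) + coord fs 2 x * L (f 3) + coord fs 3 x * L (f 4)
    + coord fs 4 x * L (f 5) + coord fs 5 x * L (f 6) + coord fs 6 x * (L (f 7) :: real)"
proof -
  have "L x = L (\<Sum>i<7. coord fs i x *\<^sub>R fs ! i)"
    using coord_expand[OF basis_fs, of x] unfolding length_fs by simp
  also have "\<dots> = (\<Sum>i<7. coord fs i x * L (fs ! i))"
    by (simp add: linear_sum[OF assms] linear_scale[OF assms])
  also have "{..<7} = {0, 1, 2, 3, 4, 5, 6 :: nat}" by auto
  finally show ?thesis by (simp add: fs_def)
qed

lemma list_inner_ph: "list_inner fs \<phi> \<phi> = 7"
  by (simp add: fs_def interior_apply ph_f kform_length[OF kform_ph] del: One_nat_def)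

text \<open>The seven monomials of \<phi> form a Fano plane. Two indices determine the third, so
  off-diagonal entries of \<open>D\<close> do not contribute; every index lies on three lines, so
  each diagonal entry is counted three times.\<close>

lemma list_inner_endo_ph:
  assumes D: "linear D"
  shows "list_inner fs (endo_act D \<phi>) \<phi> = 3 * lin_trace D"
proof -
  have l: "linear (\<lambda>x. \<phi> [x, y, z])" "linear (\<lambda>x. \<phi> [y, x, z])" "linear (\<lambda>x. \<phi> [y, z, x])" for y z
    using kform_linear[OF kform_ph, of "[]" "[y, z]"] kform_linear[OF kform_ph, of "[y]" "[z]"]
      kform_linear[OF kform_ph, of "[y, z]" "[]"] by simp_all
  have P: "endo_act D \<phi> [x, y, z] = \<phi> [D x, y, z] + \<phi> [x, D y, z] + \<phi> [x, y, D z]" for x y z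
    by (simp add: endo_act_Cons endo_act_Nil interior_apply)
  have T: "lin_trace D = coord fs 0 (D (f 1)) + coord fs 1 (D (f 2)) + coord fs 2 (D (f 3)) + coord fs 3 (D (f 4))
    + coord fs 4 (D (f 5)) + coord fs 5 (D (f 6)) + coord fs 6 (D (f 7))"
  proof -
    have "{..<7} = {0, 1, 2, 3, 4, 5, 6 :: nat}" by auto
    then have "lin_trace D = (\<Sum>i\<in>{0, 1, 2, 3, 4, 5, 6}. coord fs i (D (fs ! i)))"
      using lin_trace_basis_list[OF basis_fs D] unfolding length_fs by simp
    then show ?thesis by (simp add: fs_def)
  qed
  define c where "c = coord fs"
  have E: "\<phi> [D x, y, z] = c 0 (D x) * \<phi> [f 1, y, z] + c 1 (D x) * \<phi> [f 2, y, z] + c 2 (D x) * \<phi> [f 3, y, z]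
      + c 3 (D x) * \<phi> [f 4, y, z] + c 4 (D x) * \<phi> [f 5, y, z] + c 5 (D x) * \<phi> [f 6, y, z] + c 6 (D x) * \<phi> [f 7, y, z]"
    "\<phi> [y, D x, z] = c 0 (D x) * \<phi> [y, f 1, z] + c 1 (D x) * \<phi> [y, f 2, z] + c 2 (D x) * \<phi> [y, f 3, z]
      + c 3 (D x) * \<phi> [y, f 4, z] + c 4 (D x) * \<phi> [y, f 5, z] + c 5 (D x) * \<phi> [y, f 6, z] + c 6 (D x) * \<phi> [y, f 7, z]"
    "\<phi> [y, z, D x] = c 0 (D x) * \<phi> [y, z, f 1] + c 1 (D x) * \<phi> [y, z, f 2] + c 2 (D x) * \<phi> [y, z, f 3]
      + c 3 (D x) * \<phi> [y, z, f 4] + c 4 (D x) * \<phi> [y, z, f 5] + c 5 (D x) * \<phi> [y, z, f 6] + c 6 (D x) * \<phi> [y, z, f 7]"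
    for x y z
    unfolding c_def by (rule coordinates_expand[OF l(1)], rule coordinates_expand[OF l(2)], rule coordinates_expand[OF l(3)])
  have kl: "length xs \<noteq> 3 \<Longrightarrow> endo_act D \<phi> xs = 0" for xs
    by (rule kform_length[OF kform_endo_act[OF D kform_ph]])
  have "list_inner fs (endo_act D \<phi>) \<phi> =
      endo_act D \<phi> [f 1, f 2, f 7] + endo_act D \<phi> [f 3, f 4, f 7] + endo_act D \<phi> [f 5, f 6, f 7]
      + endo_act D \<phi> [f 1, f 3, f 5] - endo_act D \<phi> [f 1, f 4, f 6]
      - endo_act D \<phi> [f 2, f 3, f 6] - endo_act D \<phi> [f 2, f 4, f 5]"
    by (simp add: fs_def interior_apply ph_f kl kform_length[OF kform_ph] del: One_nat_def)
  then show ?thesis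
    unfolding P E T[folded c_def] by (simp add: ph_simps del: One_nat_def)
qed

lemma wedge_ph_dual:
  assumes th: "g2_hodge \<phi> 3 \<phi> = \<Theta>" and a: "kform 3 \<alpha>"
  shows "(\<alpha> \<and>\<^sub>\<Lambda> \<Theta>) fs = list_inner fs \<alpha> \<phi>"
proof -
  have "\<alpha> \<and>\<^sub>\<Lambda> g2_hodge \<phi> 3 \<phi> = (\<lambda>xs. form_inner G \<alpha> \<phi> * vol xs)"
    unfolding g2_metric_eq g2_vol_eq
    by (rule wedge_hodge[OF span_fs, unfolded length_fs, OF kform_vol _ dim7 kform_ph _ a]) (simp_all add: vol_fs)
  then show ?thesis by (simp add: th form_inner_G[OF a kform_ph] vol_fs)
qed

lemma torsion_pairing:
  assumes "g2_torsion_form br \<phi> \<tau>" "kform 2 \<alpha>"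
  shows "(\<alpha> \<and>\<^sub>\<Lambda> (\<tau> \<and>\<^sub>\<Lambda> \<phi>)) fs = - list_inner fs \<alpha> \<tau>"
  using assms hodge_vol[of \<tau> \<alpha>] by (simp add: g2_torsion_form_def wedge_minus_right)

text \<open>The product with \<phi> is the same for both forms, so by \<open>torsion_pairing\<close>
  their difference is orthogonal to itself. This resolves the description in
  \<open>g2_laplacian\<close>.\<close>

lemma torsion_unique:
  assumes "g2_torsion_form br \<phi> \<tau>" "g2_torsion_form br \<phi> \<tau>'"
  shows "\<tau> = \<tau>'"
proof -
  let ?\<beta> = "\<lambda>xs. \<tau> xs - \<tau>' xs"
  have k: "kform 2 ?\<beta>" using assms by (simp add: g2_torsion_form_def kform_diff)
  have "\<tau> \<and>\<^sub>\<Lambda> \<phi> = \<tau>' \<and>\<^sub>\<Lambda> \<phi>" using assms by (simp add: g2_torsion_form_def)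
  then have "list_inner fs ?\<beta> \<tau> = list_inner fs ?\<beta> \<tau>'"
    using torsion_pairing[OF assms(1) k] torsion_pairing[OF assms(2) k] by simp
  then have "list_inner fs ?\<beta> ?\<beta> = 0"
    using list_inner_add_right[of fs ?\<beta> \<tau> "\<lambda>xs. - 1 * \<tau>' xs"] list_inner_scale_right[of fs ?\<beta> "- 1" \<tau>'] by simp
  then have "?\<beta> = (\<lambda>xs. 0)" by (rule list_inner_self_eq_0[OF k _ span_fs])
  then show ?thesis by (simp add: fun_eq_iff)
qed

lemma laplacian_eq: "g2_torsion_form br \<phi> \<tau> \<Longrightarrow> g2_laplacian br \<phi> = ce_diff br \<tau>"
  unfolding g2_laplacian_def using torsion_unique by (metis the_equality)

lemma form_norm_G: "kform k \<beta> \<Longrightarrow> (form_norm (g2_metric \<phi>) \<beta>)\<^sup>2 = list_inner fs \<beta> \<beta>"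
  by (simp add: form_norm_def g2_metric_eq form_inner_G list_inner_self_nonneg)

end

lemma (in su3_frame) form_norm_g: "kform k \<beta> \<Longrightarrow> (form_norm g \<beta>)\<^sup>2 = list_inner es \<beta> \<beta>"
  by (simp add: form_norm_def form_inner_g list_inner_self_nonneg)

section \<open>The induced structure on a contactization\<close>

locale contact_frame = su3_frame \<omega> \<psi> J e
  for \<omega> \<psi> :: "'h::real_vector form" and J e +
  fixes br :: "'h \<Rightarrow> 'h \<Rightarrow> 'h" and \<omega>\<^sub>0 :: "'h form" and \<phi> :: "('h \<times> real) form" and \<epsilon> :: "'h \<times> real \<Rightarrow> real"
  assumes lie: "lie_algebra br" and unimod: "unimodular br" and symp: "symplectic_form br \<omega>\<^sub>0"
    and linear_eps: "linear \<epsilon>" and eps_central: "\<epsilon> central_vec \<noteq> 0"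
    and ph_eq: "\<phi> = (\<lambda>xs. (pullback fst \<omega> \<and>\<^sub>\<Lambda> covector \<epsilon>) xs + pullback fst \<psi> xs)"
    and closed: "ce_diff (central_ext br \<omega>\<^sub>0) \<phi> = (\<lambda>xs. 0)"
begin

abbreviation "cb \<equiv> central_ext br \<omega>\<^sub>0"

definition u where "u = \<epsilon> central_vec"

text \<open>The vectors e i are corrected by multiples of z so that \<epsilon> vanishes on them; the
  seventh vector is z scaled to \<epsilon> = 1.\<close>

definition fr :: "nat \<Rightarrow> 'h \<times> real" where
  "fr i = (if i = 7 then (0, 1 / u) else (e i, - \<epsilon> (e i, 0) / u))"

lemma u_nonzero: "u \<noteq> 0"
  using eps_central by (simp add: u_def)

lemma eps_split: "\<epsilon> (x, t) = \<epsilon> (x, 0) + t * u"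
proof -
  have "(x, t) = (x, 0) + t *\<^sub>R central_vec" by simp
  then show ?thesis using linear_add[OF linear_eps] linear_scale[OF linear_eps] by (metis real_scaleR_def u_def)
qed

lemma fst_fr: "fst (fr 1) = e 1" "fst (fr 2) = e 2" "fst (fr 3) = e 3" "fst (fr 4) = e 4" "fst (fr 5) = e 5"
  "fst (fr 6) = e 6" "fst (fr 7) = 0"
  by (simp_all add: fr_def)

lemma eps_fr: "\<epsilon> (fr 1) = 0" "\<epsilon> (fr 2) = 0" "\<epsilon> (fr 3) = 0" "\<epsilon> (fr 4) = 0" "\<epsilon> (fr 5) = 0"
  "\<epsilon> (fr 6) = 0" "\<epsilon> (fr 7) = 1"
proof -
  have "\<epsilon> (e i, - \<epsilon> (e i, 0) / u) = 0" for i
    using eps_split[of "e i" "- \<epsilon> (e i, 0) / u"] u_nonzero by simp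
  moreover have "\<epsilon> (0, 1 / u) = 1"
    using eps_split[of 0 "1 / u"] u_nonzero linear_0[OF linear_eps] by (simp add: zero_prod_def)
  ultimately show "\<epsilon> (fr 1) = 0" "\<epsilon> (fr 2) = 0" "\<epsilon> (fr 3) = 0" "\<epsilon> (fr 4) = 0" "\<epsilon> (fr 5) = 0"
    "\<epsilon> (fr 6) = 0" "\<epsilon> (fr 7) = 1"
    by (simp_all add: fr_def)
qed

lemma kform_pom: "kform 2 (pullback fst \<omega> :: ('h \<times> real) form)"
  by (rule kform_pullback[OF linear_fst kform_om])

lemma kform_ph: "kform 3 \<phi>"
proof -
  have "kform 3 (pullback fst \<omega> \<and>\<^sub>\<Lambda> covector \<epsilon>)"
    using kform_wedge[OF kform_pom kform_covector[OF linear_eps]] by simp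
  then show ?thesis
    unfolding ph_eq by (intro kform_add kform_pullback[OF linear_fst kform_ps])
qed

lemma ph3: "\<phi> [x, y, z] = \<omega> [fst x, fst y] * \<epsilon> z - \<omega> [fst x, fst z] * \<epsilon> y + \<omega> [fst y, fst z] * \<epsilon> x
    + \<psi> [fst x, fst y, fst z]"
  by (subst ph_eq) (simp add: wedge_covector_2[OF kform_alternating[OF kform_pom]] pullback_def)

lemma expand_es: "x = g x (e 1) *\<^sub>R e 1 + g x (e 2) *\<^sub>R e 2 + g x (e 3) *\<^sub>R e 3 + g x (e 4) *\<^sub>R e 4
    + g x (e 5) *\<^sub>R e 5 + g x (e 6) *\<^sub>R e 6"
proof -
  have "coord es i x = g x (es ! i)" if "i < 6" for i
    using orthonormal_basis_coord[OF bilinear_g orthonormal_es basis_es] that by (simp add: length_es)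
  then have "x = (\<Sum>i<6. g x (es ! i) *\<^sub>R es ! i)"
    using coord_expand[OF basis_es, of x] by (simp add: length_es)
  also have "{..<6} = {0, 1, 2, 3, 4, 5 :: nat}" by auto
  finally show ?thesis by (simp add: es_def add.assoc)
qed

lemma frame_basis: "basis_list [fr 1, fr 2, fr 3, fr 4, fr 5, fr 6, fr 7]"
proof -
  let ?fs = "[fr 1, fr 2, fr 3, fr 4, fr 5, fr 6, fr 7]"
  \<comment> \<open>An auxiliary inner product, for which the lifted frame is orthonormal; it yields
    independence. Its agreement with the metric of \<phi> is a consequence of the frame.\<close>
  let ?B = "\<lambda>x y. g (fst x) (fst y) + \<epsilon> x * \<epsilon> y"
  have B: "bilinear ?B"
    unfolding bilinear_def
    by (intro conjI allI linearI)
      (simp_all add: bilinear_ladd[OF bilinear_g] bilinear_radd[OF bilinear_g] bilinear_lmul[OF bilinear_g]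
        bilinear_rmul[OF bilinear_g] linear_add[OF linear_eps] linear_scale[OF linear_eps] algebra_simps)
  have ge: "g (e i) (e j) = (if i = j then 1 else 0)" if "i \<in> {1, 2, 3, 4, 5, 6}" "j \<in> {1, 2, 3, 4, 5, 6}" for i j
    using that by (elim insertE emptyE) (simp_all add: g_def J_e om_simps del: One_nat_def)
  have on: "?B (?fs ! i) (?fs ! j) = (if i = j then 1 else 0)" if "i < length ?fs" "j < length ?fs" for i j
  proof -
    have "i \<in> {0, 1, 2, 3, 4, 5, 6}" "j \<in> {0, 1, 2, 3, 4, 5, 6}" using that by auto
    then show ?thesis
      by (elim insertE emptyE)
        (simp_all add: fst_fr eps_fr ge bilinear_lzero[OF bilinear_g] bilinear_rzero[OF bilinear_g] del: One_nat_def)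
  qed
  have "x \<in> span (set ?fs)" for x
  proof -
    define y where "y = g (fst x) (e 1) *\<^sub>R fr 1 + g (fst x) (e 2) *\<^sub>R fr 2 + g (fst x) (e 3) *\<^sub>R fr 3
      + g (fst x) (e 4) *\<^sub>R fr 4 + g (fst x) (e 5) *\<^sub>R fr 5 + g (fst x) (e 6) *\<^sub>R fr 6 + \<epsilon> x *\<^sub>R fr 7"
    have f: "fst x = fst y"
      using expand_es[of "fst x"] by (simp add: y_def fst_fr del: One_nat_def)
    have "\<epsilon> x = \<epsilon> y"
      by (simp add: y_def linear_add[OF linear_eps] linear_scale[OF linear_eps] eps_fr del: One_nat_def)
    moreover have "\<epsilon> x = \<epsilon> (fst x, 0) + snd x * u" "\<epsilon> y = \<epsilon> (fst y, 0) + snd y * u"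
      using eps_split[of "fst x" "snd x"] eps_split[of "fst y" "snd y"] by simp_all
    ultimately have "snd x * u = snd y * u" using f by simp
    then have "snd x = snd y" using u_nonzero by simp
    with f have "x = y" by (rule prod_eqI)
    moreover have "y \<in> span (set ?fs)"
      unfolding y_def by (intro real_vector.span_add real_vector.span_scale real_vector.span_base) simp_all
    ultimately show ?thesis by metis
  qed
  then have "span (set ?fs) = UNIV" by blast
  then show ?thesis
    using orthonormal_list_independent[OF B on] unfolding basis_list_def by blast
qed

sublocale g2: g2_frame \<phi> fr
proof (rule g2_frame.intro[OF frame_basis kform_ph])
qed (simp_all add: ph3 fst_fr eps_fr om_e ps_e linear_0[OF linear_form2(2)[OF kform_om]]
    linear_0[OF kform_linear[OF kform_ps, of "[_, _]" "[]", simplified]] del: One_nat_def)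

lemma bilinear_br: "bilinear br" and br_self: "br x x = 0"
  and jacobi: "br x (br y z) + br y (br z x) + br z (br x y) = 0"
  using lie by (auto simp: lie_algebra_def)

lemma kform_om0: "kform 2 \<omega>\<^sub>0" and closed_om0: "ce_diff br \<omega>\<^sub>0 = (\<lambda>xs. 0)" and nondeg_om0: "nondegenerate \<omega>\<^sub>0"
  using symp by (auto simp: symplectic_form_def)

lemma bilinear_cb: "bilinear cb"
  by (rule bilinear_central_ext[OF bilinear_br kform_om0])

lemma cb_self: "cb x x = 0"
  by (rule central_ext_self[OF br_self kform_om0])

text \<open>The cube of \<open>\<omega>\<^sub>0\<close> supplies the nonzero top form.\<close>

lemma exact_h:
  assumes "kform 5 \<beta>"
  shows "ce_diff br \<beta> = (\<lambda>xs. 0)"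
proof -
  have V: "kform (length es) (\<omega>\<^sub>0 \<and>\<^sub>\<Lambda> \<omega>\<^sub>0 \<and>\<^sub>\<Lambda> \<omega>\<^sub>0)" unfolding length_es by (rule kform_cube(2)[OF kform_om0])
  obtain xs where "(\<omega>\<^sub>0 \<and>\<^sub>\<Lambda> \<omega>\<^sub>0 \<and>\<^sub>\<Lambda> \<omega>\<^sub>0) xs \<noteq> 0"
    using nondegenerate_cube[OF dim6 kform_om0 nondeg_om0] by blast
  from top_form_nonzero_basis[OF basis_es V this] show ?thesis
    by (rule ce_diff_top_exact[OF bilinear_br br_self unimod basis_es V _ assms]) (simp add: length_es)
qed

lemma exact_g:
  assumes "kform 6 \<beta>"
  shows "ce_diff cb \<beta> = (\<lambda>xs. 0)"
proof (rule ce_diff_top_exact[OF bilinear_cb cb_self _ g2.basis_fs])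
  show "unimodular cb" by (rule unimodular_central_ext[OF bilinear_br kform_om0 unimod basis_es])
  show "kform (length g2.fs) g2.vol" unfolding g2.length_fs by (rule g2.kform_vol)
qed (use assms in \<open>simp_all add: g2.vol_fs g2.length_fs\<close>)

section \<open>Structure equations of the contactization\<close>

definition F :: "'h form" where
  "F = pullback (\<lambda>x. (x, 0)) (ce_diff cb (covector \<epsilon>))"

lemma kform_F: "kform 2 F"
  unfolding F_def
  using kform_pullback[OF linear_embed kform_ce_diff[OF bilinear_cb cb_self kform_covector[OF linear_eps]]]
  by (simp add: numeral_2_eq_2)

lemma F2: "F [x, y] = - \<epsilon> (br x y, 0) + u * \<omega>\<^sub>0 [x, y]"
  using eps_split[of "br x y" "- \<omega>\<^sub>0 [x, y]"]
  by (simp add: F_def pullback_def ce_diff_covector central_ext_def)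

lemma form2_eqI:
  assumes "kform 2 \<alpha>" "kform 2 \<beta>" "\<And>x y. \<alpha> [x, y] = \<beta> [x, y]"
  shows "\<alpha> = \<beta>"
proof
  fix xs show "\<alpha> xs = \<beta> xs"
  proof (cases "length xs = 2")
    case True
    then obtain x y where "xs = [x, y]" by (auto simp: numeral_2_eq_2 length_Suc_conv)
    then show ?thesis using assms(3) by simp
  qed (simp add: kform_length[OF assms(1)] kform_length[OF assms(2)])
qed

lemma ce_diff_eps: "ce_diff cb (covector \<epsilon>) = pullback fst F"
proof (rule form2_eqI)
  show "kform 2 (ce_diff cb (covector \<epsilon>))"
    using kform_ce_diff[OF bilinear_cb cb_self kform_covector[OF linear_eps]] by (simp add: numeral_2_eq_2)
  show "kform 2 (pullback fst F :: ('h \<times> real) form)" by (rule kform_pullback[OF linear_fst kform_F])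
qed (simp add: F_def pullback_def ce_diff_covector central_ext_def)

text \<open>\<open>F\<close> is the differential on the base of \<epsilon> restricted to it, plus u
  times the closed form \<open>\<omega>\<^sub>0\<close>. The square of the differential is needed on
  1-forms, where its vanishing is the Jacobi identity.\<close>

lemma ce_diff_F: "ce_diff br F = (\<lambda>xs. 0)"
proof -
  let ?\<eta> = "covector (\<lambda>x. \<epsilon> (x, 0))"
  have le: "linear (\<lambda>x. \<epsilon> (x, 0))"
    using linear_compose[OF linear_embed linear_eps] by (simp add: o_def)
  have k: "kform 2 (ce_diff br ?\<eta>)"
    using kform_ce_diff[OF bilinear_br br_self kform_covector[OF le]] by (simp add: numeral_2_eq_2)
  have F: "F = (\<lambda>xs. ce_diff br ?\<eta> xs + u * \<omega>\<^sub>0 xs)"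
    by (rule form2_eqI[OF kform_F kform_add[OF k kform_scale[OF kform_om0]]]) (simp add: F2 ce_diff_covector)
  have "ce_diff br (ce_diff br ?\<eta>) = (\<lambda>xs. 0)"
  proof
    fix xs show "ce_diff br (ce_diff br ?\<eta>) xs = 0"
    proof (cases "length xs = 3")
      case True
      then obtain x y z where xs: "xs = [x, y, z]" by (auto simp: numeral_3_eq_3 length_Suc_conv)
      have n: "nths [x, y, z] (- {0, 1}) = [z]" "nths [x, y, z] (- {0, 2}) = [y]" "nths [x, y, z] (- {1, 2}) = [x]"
        by (simp_all add: nths_Cons)
      have "ce_diff br (ce_diff br ?\<eta>) [x, y, z] =
          - ce_diff br ?\<eta> [br x y, z] + ce_diff br ?\<eta> [br x z, y] - ce_diff br ?\<eta> [br y z, x]"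
        using n by (simp add: ce_diff_def[of _ "ce_diff br ?\<eta>"] eval_nat_numeral)
      also have "\<dots> = \<epsilon> (br (br x y) z - br (br x z) y + br (br y z) x, 0)"
        unfolding ce_diff_covector linear_add[OF le] linear_diff[OF le] by simp
      also have "br (br x y) z - br (br x z) y + br (br y z) x = 0"
      proof -
        have anti: "br a b = - br b a" for a b
          using br_self[of "a + b"] br_self[of a] br_self[of b]
          by (simp add: bilinear_ladd[OF bilinear_br] bilinear_radd[OF bilinear_br] eq_neg_iff_add_eq_0 add.commute)
        show ?thesis
          using jacobi[of x y z] anti[of "br x y" z] anti[of "br x z" y] anti[of "br y z" x] anti[of z x]
          by (simp add: bilinear_rneg[OF bilinear_br] algebra_simps)
      qed
      finally show ?thesis using xs linear_0[OF le] by simp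
    qed (use kform_length[OF kform_ce_diff[OF bilinear_br br_self k]] in simp)
  qed
  then show ?thesis unfolding F by (simp add: ce_diff_add ce_diff_scale closed_om0)
qed

lemma ce_diff_phi: "(pullback fst (ce_diff br \<omega>) \<and>\<^sub>\<Lambda> covector \<epsilon>) xs + pullback fst (\<omega> \<and>\<^sub>\<Lambda> F) xs
    + pullback fst (ce_diff br \<psi>) xs = 0"
proof -
  have "0 = ce_diff cb \<phi> xs" by (simp add: closed)
  also have "ce_diff cb \<phi> = (\<lambda>xs. ce_diff cb (pullback fst \<omega> \<and>\<^sub>\<Lambda> covector \<epsilon>) xs + pullback fst (ce_diff br \<psi>) xs)"
    by (subst ph_eq) (simp add: ce_diff_add ce_diff_pullback_fst)
  finally show ?thesis
    by (simp add: ce_diff_wedge[OF bilinear_cb cb_self kform_pom kform_covector[OF linear_eps]]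
        ce_diff_pullback_fst ce_diff_eps pullback_wedge)
qed

lemma kform_ce_diff_omega: "kform 3 (ce_diff br \<omega>)"
  using kform_ce_diff[OF bilinear_br br_self kform_om] by (simp add: numeral_3_eq_3)

text \<open>In d\<phi> = 0 only d\<omega> wedged with \<epsilon> survives contraction with z, and it
  gives - u d\<omega>.\<close>

lemma ce_diff_omega: "ce_diff br \<omega> = (\<lambda>xs. 0)"
proof
  fix xs :: "'h list"
  let ?A = "pullback fst (ce_diff br \<omega>) :: ('h \<times> real) form"
  let ?xs = "map (\<lambda>x. (x, 0 :: real)) xs"
  have A: "kform 3 ?A" by (rule kform_pullback[OF linear_fst kform_ce_diff_omega])
  have m: "map fst ?xs = xs" by (simp add: o_def)
  have z: "interior central_vec (pullback fst \<beta>) = (\<lambda>xs. 0)" if "kform k \<beta>" for k and \<beta> :: "'h form"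
    using linear_0[OF kform_linear_Cons[OF that]] by (simp add: interior_def pullback_def)
  have c0: "kform 0 (interior central_vec (covector \<epsilon>))"
    using kform_interior[of 0 "covector \<epsilon>"] kform_covector[OF linear_eps] by simp
  have "(?A \<and>\<^sub>\<Lambda> covector \<epsilon>) (central_vec # ?xs) = - u * ?A ?xs"
    using fun_cong[OF interior_wedge[OF A kform_covector[OF linear_eps], of central_vec], of ?xs]
    by (simp add: z[OF kform_ce_diff_omega] wedge_0_right[OF A c0] interior_apply) (simp add: covector_def u_def)
  moreover have "pullback fst (\<omega> \<and>\<^sub>\<Lambda> F) (central_vec # ?xs) = 0" "pullback fst (ce_diff br \<psi>) (central_vec # ?xs) = 0"
    using z[OF kform_wedge[OF kform_om kform_F]] z[OF kform_ce_diff[OF bilinear_br br_self kform_ps]]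
    by (simp_all add: interior_def fun_eq_iff)
  ultimately have "?A ?xs = 0" using ce_diff_phi[of "central_vec # ?xs"] u_nonzero by simp
  then show "ce_diff br \<omega> xs = 0" using m by (simp add: pullback_def del: map_map)
qed

lemma ce_diff_psi: "ce_diff br \<psi> xs = - (\<omega> \<and>\<^sub>\<Lambda> F) xs"
proof -
  have "map fst (map (\<lambda>x. (x, 0 :: real)) xs) = xs" by (simp add: o_def)
  moreover have "pullback fst (\<lambda>xs :: 'h list. 0 :: real) = (\<lambda>xs :: ('h \<times> real) list. 0)" by (simp add: pullback_def fun_eq_iff)
  ultimately show ?thesis
    using ce_diff_phi[of "map (\<lambda>x. (x, 0)) xs"] by (simp add: ce_diff_omega pullback_def del: map_map)
qed

end

section \<open>The soliton constant\<close>

context contact_frame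
begin

definition Theta :: "('h \<times> real) form" where
  "Theta = (\<lambda>xs. 1 / 2 * pullback fst (\<omega> \<and>\<^sub>\<Lambda> \<omega>) xs + (pullback fst (pullback J \<psi>) \<and>\<^sub>\<Lambda> covector \<epsilon>) xs)"

lemma kform_ppsm: "kform 3 (pullback fst (pullback J \<psi>) :: ('h \<times> real) form)"
  by (rule kform_pullback[OF linear_fst kform_psm])

lemma kform_Theta: "kform 4 Theta"
  unfolding Theta_def
  using kform_wedge[OF kform_ppsm kform_covector[OF linear_eps]]
  by (intro kform_add kform_scale kform_pullback[OF linear_fst kform_cube(1)[OF kform_om]]) simp

lemma hodge_Theta: "g2_hodge \<phi> 3 \<phi> = Theta"
  by (rule g2.hodge_ph[OF kform_Theta])
    (simp_all add: Theta_def wedge_covector_3[OF kform_ppsm linear_eps] pullback_def[of fst] fst_fr eps_fr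
      wedge_22[OF kform_om kform_om] om_e psm_e linear_0[OF linear_form2(2)[OF kform_om]] del: One_nat_def)

lemma ce_diff_om_om: "ce_diff br (\<omega> \<and>\<^sub>\<Lambda> \<omega>) = (\<lambda>xs. 0)"
  by (simp add: ce_diff_wedge[OF bilinear_br br_self kform_om kform_om] ce_diff_omega)

lemma ce_diff_Theta: "ce_diff cb Theta =
  (\<lambda>xs. (pullback fst (ce_diff br (pullback J \<psi>)) \<and>\<^sub>\<Lambda> covector \<epsilon>) xs - (pullback J \<psi> \<and>\<^sub>\<Lambda> F) (map fst xs))"
proof -
  have z: "pullback fst (\<lambda>xs :: 'h list. 0 :: real) = (\<lambda>xs :: ('h \<times> real) list. 0)"
    by (simp add: pullback_def fun_eq_iff)
  have p: "(pullback J \<psi> \<and>\<^sub>\<Lambda> F) (map fst xs) = (pullback fst (pullback J \<psi>) \<and>\<^sub>\<Lambda> pullback fst F) xs"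
    for xs :: "('h \<times> real) list"
    unfolding pullback_wedge[symmetric] by (simp add: pullback_def[of fst])
  show ?thesis
    unfolding Theta_def ce_diff_add ce_diff_scale ce_diff_pullback_fst ce_diff_om_om p
      ce_diff_wedge[OF bilinear_cb cb_self kform_ppsm kform_covector[OF linear_eps]] ce_diff_eps z
    by simp
qed

context
  fixes \<tau> :: "('h \<times> real) form"
  assumes torsion: "g2_torsion_form cb \<phi> \<tau>"
begin

lemma kform_tau: "kform 2 \<tau>"
  using torsion by (simp add: g2_torsion_form_def)

lemma tau_wedge_ph: "\<tau> \<and>\<^sub>\<Lambda> \<phi> = ce_diff cb Theta"
  using torsion by (simp add: g2_torsion_form_def hodge_Theta)

lemma kform_dTheta: "kform 5 (ce_diff cb Theta)"
  using kform_ce_diff[OF bilinear_cb cb_self kform_Theta] by simp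

text \<open>The components of \<tau> wedged with \<phi> split by whether \<open>fr 7\<close> occurs
  among the arguments. Those with it are components of d(J\<psi>) and contribute 2 |w_1|^2 besides
  |w_2^-|^2; those without it come from J\<psi> wedged with \<open>F\<close> and contribute 4
  |w_1|^2.\<close>

lemma norm_tau:
  assumes w1: "kform 1 w\<^sub>1" and wp: "w\<^sub>2p \<in> Lambda2_8 \<omega> \<psi>" and wm: "w\<^sub>2m \<in> Lambda2_8 \<omega> \<psi>"
    and J: "J = su3_J \<omega> \<psi>"
    and dp: "\<And>xs. ce_diff br \<psi> xs = (w\<^sub>2p \<and>\<^sub>\<Lambda> \<omega>) xs + (w\<^sub>1 \<and>\<^sub>\<Lambda> \<psi>) xs"
    and dm: "\<And>xs. ce_diff br (pullback J \<psi>) xs = (w\<^sub>2m \<and>\<^sub>\<Lambda> \<omega>) xs + (pullback J w\<^sub>1 \<and>\<^sub>\<Lambda> \<psi>) xs"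
  shows "list_inner g2.fs \<tau> \<tau> = list_inner es w\<^sub>2m w\<^sub>2m + 6 * list_inner es w\<^sub>1 w\<^sub>1"
proof -
  have p: "kform 2 w\<^sub>2p" "pullback J w\<^sub>2p = w\<^sub>2p" "w\<^sub>2p \<and>\<^sub>\<Lambda> (\<omega> \<and>\<^sub>\<Lambda> \<omega>) = (\<lambda>xs. 0)"
    and m: "kform 2 w\<^sub>2m" "pullback J w\<^sub>2m = w\<^sub>2m" "w\<^sub>2m \<and>\<^sub>\<Lambda> (\<omega> \<and>\<^sub>\<Lambda> \<omega>) = (\<lambda>xs. 0)"
    using wp wm by (auto simp: Lambda2_8_def J)
  have k4: "kform 4 (ce_diff br (pullback J \<psi>))"
    using kform_ce_diff[OF bilinear_br br_self kform_psm] by simp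
  have pk4: "kform 4 (pullback fst (ce_diff br (pullback J \<psi>)) :: ('h \<times> real) form)"
    by (rule kform_pullback[OF linear_fst k4])
  have z: "(pullback J \<psi> \<and>\<^sub>\<Lambda> F) [a, b, c, d, 0] = 0" for a b c d
    using linear_0[OF kform_linear[OF kform_wedge[OF kform_psm kform_F], of "[a, b, c, d]" "[]"]] by simp
  have x4: "ce_diff cb Theta [a, b, c, d, fr 7] = ce_diff br (pullback J \<psi>) [fst a, fst b, fst c, fst d]"
    if "\<epsilon> a = 0" "\<epsilon> b = 0" "\<epsilon> c = 0" "\<epsilon> d = 0" for a b c d
    using that by (simp add: ce_diff_Theta wedge_covector_4[OF pk4 linear_eps] fst_fr eps_fr z pullback_def[of fst])
  have x5: "ce_diff cb Theta [a, b, c, d, q] = - (pullback J \<psi> \<and>\<^sub>\<Lambda> F) [fst a, fst b, fst c, fst d, fst q]"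
    if "\<epsilon> a = 0" "\<epsilon> b = 0" "\<epsilon> c = 0" "\<epsilon> d = 0" "\<epsilon> q = 0" for a b c d q
    using that by (simp add: ce_diff_Theta wedge_covector_4[OF pk4 linear_eps])
  have k5: "kform 5 (pullback J \<psi> \<and>\<^sub>\<Lambda> F)" using kform_wedge[OF kform_psm kform_F] by simp
  have "list_inner g2.fs \<tau> \<tau> = list_inner g2.fs (ce_diff cb Theta) (ce_diff cb Theta)"
    by (rule g2.list_inner_hodge_dual[OF kform_tau kform_dTheta g2.torsion_pairing[OF torsion, unfolded tau_wedge_ph]])
  also have "\<dots> = list_inner es (ce_diff br (pullback J \<psi>)) (ce_diff br (pullback J \<psi>)) +
      list_inner es (pullback J \<psi> \<and>\<^sub>\<Lambda> F) (pullback J \<psi> \<and>\<^sub>\<Lambda> F)"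
    by (simp add: g2.fs_def es_def interior_apply kform_length[OF kform_dTheta] kform_length[OF k4]
        kform_length[OF k5] x4 x5 eps_fr fst_fr del: One_nat_def)
  also have "list_inner es (ce_diff br (pullback J \<psi>)) (ce_diff br (pullback J \<psi>)) =
      list_inner es w\<^sub>2m w\<^sub>2m + 2 * list_inner es w\<^sub>1 w\<^sub>1"
    by (rule norm_dpsm[OF m w1 k4 dm])
  also have "list_inner es (pullback J \<psi> \<and>\<^sub>\<Lambda> F) (pullback J \<psi> \<and>\<^sub>\<Lambda> F) = 4 * list_inner es w\<^sub>1 w\<^sub>1"
    by (rule norm_psm_wedge[OF p w1 kform_F]) (simp add: ce_diff_psi flip: dp)
  finally show ?thesis by simp
qed

text \<open>The source of the strict inequality: w_1 cannot vanish.\<close>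

lemma torsion_norm_positive:
  assumes w1: "kform 1 w\<^sub>1" and wp: "w\<^sub>2p \<in> Lambda2_8 \<omega> \<psi>" and J: "J = su3_J \<omega> \<psi>"
    and dp: "\<And>xs. ce_diff br \<psi> xs = (w\<^sub>2p \<and>\<^sub>\<Lambda> \<omega>) xs + (w\<^sub>1 \<and>\<^sub>\<Lambda> \<psi>) xs"
  shows "list_inner es w\<^sub>1 w\<^sub>1 > 0"
proof (rule ccontr)
  assume "\<not> list_inner es w\<^sub>1 w\<^sub>1 > 0"
  then have "list_inner es w\<^sub>1 w\<^sub>1 = 0" using list_inner_self_nonneg[of es w\<^sub>1] by linarith
  then have w0: "w\<^sub>1 = (\<lambda>xs. 0)" by (rule list_inner_self_eq_0[OF w1 _ span_es])
  have p: "kform 2 w\<^sub>2p" "pullback J w\<^sub>2p = w\<^sub>2p" "w\<^sub>2p \<and>\<^sub>\<Lambda> (\<omega> \<and>\<^sub>\<Lambda> \<omega>) = (\<lambda>xs. 0)"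
    using wp by (auto simp: Lambda2_8_def J)
  have dp': "(w\<^sub>2p \<and>\<^sub>\<Lambda> \<omega>) xs = - (\<omega> \<and>\<^sub>\<Lambda> F) xs" for xs
    using dp[of xs] ce_diff_psi[of xs] by (simp add: w0)
  have F: "F = (\<lambda>xs. - w\<^sub>2p xs)" by (rule wedge_om_coefficients[OF p kform_F dp'])
  have "kform 5 (\<psi> \<and>\<^sub>\<Lambda> F)" using kform_wedge[OF kform_ps kform_F] by simp
  \<comment> \<open>The term with dF drops out. With d\<psi> and \<open>F\<close> expressed by
    w_2^+, \<open>primitive_square\<close> turns the remaining product into the squared norm of
    w_2^+.\<close>
  from exact_h[OF this] have "(ce_diff br \<psi> \<and>\<^sub>\<Lambda> F) es = 0"
    by (simp add: ce_diff_wedge[OF bilinear_br br_self kform_ps kform_F] ce_diff_F fun_eq_iff)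
  moreover have "ce_diff br \<psi> = w\<^sub>2p \<and>\<^sub>\<Lambda> \<omega>" using dp by (simp add: w0 fun_eq_iff)
  ultimately have "(w\<^sub>2p \<and>\<^sub>\<Lambda> \<omega> \<and>\<^sub>\<Lambda> w\<^sub>2p) es = 0" by (simp add: F wedge_minus_right)
  then have "list_inner es w\<^sub>2p w\<^sub>2p = 0" by (simp add: primitive_square[OF p])
  then have "w\<^sub>2p = (\<lambda>xs. 0)" by (rule list_inner_self_eq_0[OF p(1) _ span_es])
  then have "F = (\<lambda>xs. 0)" using F by simp
  \<comment> \<open>The restriction of \<epsilon> / u to the base. By \<open>F2\<close>, F = 0 says
    that \<open>\<omega>\<^sub>0\<close> is minus its differential.\<close>
  let ?\<eta> = "covector (\<lambda>x. \<epsilon> (x, 0) / u)"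
  have "linear (\<lambda>x. \<epsilon> (x, 0) / u)"
    using linear_compose[OF linear_embed linear_eps]
    by (intro linearI) (simp_all add: o_def linear_iff add_divide_distrib)
  then have ke: "kform 1 ?\<eta>" by (rule kform_covector)
  have om0: "\<omega>\<^sub>0 = (\<lambda>xs. - ce_diff br ?\<eta> xs)"
  proof (rule form2_eqI[OF kform_om0])
    show "kform 2 (\<lambda>xs. - ce_diff br ?\<eta> xs)"
      using kform_ce_diff[OF bilinear_br br_self ke] by (intro kform_minus) (simp add: numeral_2_eq_2)
    show "\<omega>\<^sub>0 [x, y] = - ce_diff br ?\<eta> [x, y]" for x y
      using F2[of x y] u_nonzero by (simp add: \<open>F = (\<lambda>xs. 0)\<close> ce_diff_covector field_simps)
  qed
  have k: "kform 3 (?\<eta> \<and>\<^sub>\<Lambda> \<omega>\<^sub>0)" "kform 5 (?\<eta> \<and>\<^sub>\<Lambda> \<omega>\<^sub>0 \<and>\<^sub>\<Lambda> \<omega>\<^sub>0)"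
    using kform_wedge[OF ke kform_om0] kform_wedge[OF kform_wedge[OF ke kform_om0] kform_om0]
    by (simp_all add: eval_nat_numeral)
  have "ce_diff br (?\<eta> \<and>\<^sub>\<Lambda> \<omega>\<^sub>0 \<and>\<^sub>\<Lambda> \<omega>\<^sub>0) = ce_diff br ?\<eta> \<and>\<^sub>\<Lambda> \<omega>\<^sub>0 \<and>\<^sub>\<Lambda> \<omega>\<^sub>0"
    by (simp add: ce_diff_wedge[OF bilinear_br br_self k(1) kform_om0]
        ce_diff_wedge[OF bilinear_br br_self ke kform_om0] closed_om0)
  then have "ce_diff br ?\<eta> \<and>\<^sub>\<Lambda> \<omega>\<^sub>0 \<and>\<^sub>\<Lambda> \<omega>\<^sub>0 = (\<lambda>xs. 0)" using exact_h[OF k(2)] by simp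
  moreover have "\<omega>\<^sub>0 \<and>\<^sub>\<Lambda> \<omega>\<^sub>0 \<and>\<^sub>\<Lambda> \<omega>\<^sub>0 = (\<lambda>xs. - (ce_diff br ?\<eta> \<and>\<^sub>\<Lambda> \<omega>\<^sub>0 \<and>\<^sub>\<Lambda> \<omega>\<^sub>0) xs)"
    by (subst (1) om0) (simp add: wedge_minus_left)
  ultimately show False using nondegenerate_cube[OF dim6 kform_om0 nondeg_om0] by simp
qed

context
  fixes lam :: real and D :: "'h \<times> real \<Rightarrow> 'h \<times> real"
  assumes der: "derivation cb D"
    and soliton: "g2_laplacian cb \<phi> = (\<lambda>xs. lam * \<phi> xs + endo_act D \<phi> xs)"
begin

lemma linear_D: "linear D"
  using der by (simp add: derivation_def)

lemma ce_diff_tau: "ce_diff cb \<tau> = (\<lambda>xs. lam * \<phi> xs + endo_act D \<phi> xs)"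
  using g2.laplacian_eq[OF torsion] soliton by simp

text \<open>The Leibniz rule for \<tau> wedged with \<open>Theta\<close> gives two terms. The one
  with d\<tau> is the inner product of d\<tau> and \<phi>, evaluated by the soliton equation; the
  one with dTheta is \<tau> wedged twice into \<phi>, equal to - |\<tau>|^2.\<close>

lemma norm_tau_trace: "list_inner g2.fs \<tau> \<tau> = 7 * lam + 3 * lin_trace D"
proof -
  have kd: "kform 3 (ce_diff cb \<tau>)"
    using kform_ce_diff[OF bilinear_cb cb_self kform_tau] by (simp add: numeral_3_eq_3)
  have "kform 6 (\<tau> \<and>\<^sub>\<Lambda> Theta)" using kform_wedge[OF kform_tau kform_Theta] by simp
  from exact_g[OF this]
  have "(ce_diff cb \<tau> \<and>\<^sub>\<Lambda> Theta) g2.fs + (\<tau> \<and>\<^sub>\<Lambda> ce_diff cb Theta) g2.fs = 0"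
    by (simp add: ce_diff_wedge[OF bilinear_cb cb_self kform_tau kform_Theta] fun_eq_iff)
  moreover have "(\<tau> \<and>\<^sub>\<Lambda> ce_diff cb Theta) g2.fs = - list_inner g2.fs \<tau> \<tau>"
    using g2.torsion_pairing[OF torsion kform_tau] by (simp add: tau_wedge_ph)
  moreover have "(ce_diff cb \<tau> \<and>\<^sub>\<Lambda> Theta) g2.fs = list_inner g2.fs (ce_diff cb \<tau>) \<phi>"
    by (rule g2.wedge_ph_dual[OF hodge_Theta kd])
  moreover have "list_inner g2.fs (ce_diff cb \<tau>) \<phi> = 7 * lam + 3 * lin_trace D"
    by (simp add: ce_diff_tau list_inner_add_left list_inner_scale_left g2.list_inner_ph g2.list_inner_endo_ph[OF linear_D])
  ultimately show ?thesis by simp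
qed

section \<open>The derivation on the centre and on the base\<close>

definition Dh where "Dh x = fst (D (x, 0))"

definition c where "c = snd (D central_vec)"

lemma linear_Dh: "linear Dh"
  using linear_compose[OF linear_compose[OF linear_embed linear_D] linear_fst] by (simp add: Dh_def[abs_def] o_def)

text \<open>Applying \<open>D\<close> to [x, z] = 0 gives [x, D z] = 0 for all x. The central
  component of this bracket pairs x with the base part of D z under \<open>\<omega>\<^sub>0\<close>,
  which is nondegenerate.\<close>

lemma D_central: "D central_vec = c *\<^sub>R central_vec"
proof -
  have "cb x (D central_vec) = 0" for x
  proof -
    have "cb y central_vec = 0" for y
      using bilinear_rzero[OF bilinear_br] linear_0[OF linear_form2(2)[OF kform_om0]]
      by (simp add: central_ext_def zero_prod_def)
    moreover have "D (cb x central_vec) = cb (D x) central_vec + cb x (D central_vec)"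
      using der unfolding derivation_def by blast
    ultimately show ?thesis using linear_0[OF linear_D] by simp
  qed
  then have "snd (cb (x, 0) (D central_vec)) = 0" for x by simp
  then have "\<omega>\<^sub>0 [x, fst (D central_vec)] = 0" for x by (simp add: central_ext_def)
  then have "\<omega>\<^sub>0 [fst (D central_vec), x] = 0" for x
    using form2_commute[OF kform_om0, of x "fst (D central_vec)"] by simp
  then have "fst (D central_vec) = 0"
    using nondeg_om0 unfolding nondegenerate_def by blast
  then show ?thesis by (intro prod_eqI) (simp_all add: c_def)
qed

lemma lin_trace_D: "lin_trace D = lin_trace Dh + c"
  using lin_trace_prod[OF basis_es linear_D] by (simp add: Dh_def[abs_def] c_def)

text \<open>\<open>D\<close> acts on \<open>\<omega>\<^sub>0\<close> as the scalar \<open>c\<close> up to an exact form, so it acts on \<open>\<omega>\<^sub>0\<^sup>3\<close> as \<open>3 c\<close>.\<close>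

lemma lin_trace_Dh: "lin_trace Dh = 3 * c"
proof -
  let ?\<delta> = "covector (\<lambda>x. snd (D (x, 0)))"
  let ?W = "\<omega>\<^sub>0 \<and>\<^sub>\<Lambda> \<omega>\<^sub>0 \<and>\<^sub>\<Lambda> \<omega>\<^sub>0"
  have "linear (\<lambda>x. snd (D (x, 0)))"
    using linear_compose[OF linear_compose[OF linear_embed linear_D] linear_snd] by (simp add: o_def)
  then have kd: "kform 1 ?\<delta>" by (rule kform_covector)
  have kdd: "kform 2 (ce_diff br ?\<delta>)"
    using kform_ce_diff[OF bilinear_br br_self kd] by (simp add: numeral_2_eq_2)
  \<comment> \<open>This is the central component of D [x, y] = [D x, y] + [x, D y]; \<delta> is the
    central part of \<open>D\<close> on the base.\<close>
  have act: "endo_act Dh \<omega>\<^sub>0 = (\<lambda>xs. c * \<omega>\<^sub>0 xs + ce_diff br ?\<delta> xs)"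
  proof (rule form2_eqI)
    show "kform 2 (endo_act Dh \<omega>\<^sub>0)" by (rule kform_endo_act[OF linear_Dh kform_om0])
    show "kform 2 (\<lambda>xs. c * \<omega>\<^sub>0 xs + ce_diff br ?\<delta> xs)" by (intro kform_add kform_scale kform_om0 kdd)
    fix x y
    have "D (x', t) = D (x', 0) + t *\<^sub>R D central_vec" for x' t
    proof -
      have "(x', t) = (x', 0) + t *\<^sub>R central_vec" by simp
      then show ?thesis using linear_add[OF linear_D] linear_scale[OF linear_D] by metis
    qed
    from this[of "br x y" "- \<omega>\<^sub>0 [x, y]"]
    have "snd (D (cb (x, 0) (y, 0))) = snd (D (br x y, 0)) - \<omega>\<^sub>0 [x, y] * c"
      by (simp add: central_ext_def D_central)
    moreover have "D (cb (x, 0) (y, 0)) = cb (D (x, 0)) (y, 0) + cb (x, 0) (D (y, 0))"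
      using der by (simp add: derivation_def)
    ultimately show "endo_act Dh \<omega>\<^sub>0 [x, y] = c * \<omega>\<^sub>0 [x, y] + ce_diff br ?\<delta> [x, y]"
      by (simp add: endo_act_Cons endo_act_Nil interior_apply ce_diff_covector central_ext_def Dh_def algebra_simps)
  qed
  note k22 = kform_wedge[OF kform_om0 kform_om0, simplified]
  note k12 = kform_wedge[OF kd kform_om0, simplified] and k21 = kform_wedge[OF kform_om0 kd, simplified]
  \<comment> \<open>The exact term occurs in each of the three slots of the cube, and each product
    is the differential of the 5-form that has \<delta> in that slot.\<close>
  have e1: "(ce_diff br ?\<delta> \<and>\<^sub>\<Lambda> \<omega>\<^sub>0) \<and>\<^sub>\<Lambda> \<omega>\<^sub>0 = (\<lambda>xs. 0)"
  proof -
    have "kform 5 ((?\<delta> \<and>\<^sub>\<Lambda> \<omega>\<^sub>0) \<and>\<^sub>\<Lambda> \<omega>\<^sub>0)" using kform_wedge[OF k12 kform_om0] by (simp add: eval_nat_numeral)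
    from exact_h[OF this] show ?thesis
      by (simp add: ce_diff_wedge[OF bilinear_br br_self k12 kform_om0]
          ce_diff_wedge[OF bilinear_br br_self kd kform_om0] closed_om0)
  qed
  have e2: "(\<omega>\<^sub>0 \<and>\<^sub>\<Lambda> ce_diff br ?\<delta>) \<and>\<^sub>\<Lambda> \<omega>\<^sub>0 = (\<lambda>xs. 0)"
  proof -
    have "kform 5 ((\<omega>\<^sub>0 \<and>\<^sub>\<Lambda> ?\<delta>) \<and>\<^sub>\<Lambda> \<omega>\<^sub>0)" using kform_wedge[OF k21 kform_om0] by simp
    from exact_h[OF this] show ?thesis
      by (simp add: ce_diff_wedge[OF bilinear_br br_self k21 kform_om0]
          ce_diff_wedge[OF bilinear_br br_self kform_om0 kd] closed_om0)
  qed
  have e3: "(\<omega>\<^sub>0 \<and>\<^sub>\<Lambda> \<omega>\<^sub>0) \<and>\<^sub>\<Lambda> ce_diff br ?\<delta> = (\<lambda>xs. 0)"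
  proof -
    have "kform 5 ((\<omega>\<^sub>0 \<and>\<^sub>\<Lambda> \<omega>\<^sub>0) \<and>\<^sub>\<Lambda> ?\<delta>)" using kform_wedge[OF k22 kd] by simp
    from exact_h[OF this] show ?thesis
      by (simp add: ce_diff_wedge[OF bilinear_br br_self k22 kd]
          ce_diff_wedge[OF bilinear_br br_self kform_om0 kform_om0] closed_om0)
  qed
  have "endo_act Dh ?W = (\<lambda>xs. 3 * c * ?W xs)"
    unfolding endo_act_wedge[OF linear_Dh k22 kform_om0] endo_act_wedge[OF linear_Dh kform_om0 kform_om0] act
      wedge_linear e1 e2 e3 by (simp add: algebra_simps)
  moreover have "endo_act Dh ?W = (\<lambda>xs. lin_trace Dh * ?W xs)"
    by (rule endo_act_top[OF basis_es linear_Dh]) (unfold length_es, rule kform_cube(2)[OF kform_om0])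
  moreover obtain xs where "?W xs \<noteq> 0"
    using nondegenerate_cube[OF dim6 kform_om0 nondeg_om0] by blast
  ultimately show ?thesis by (metis mult_right_cancel)
qed

text \<open>As z is central, Cartan's formula makes the contraction of d\<tau> with z exact, so on
  the base its product with the closed form \<omega>^2 is exact of top degree and vanishes. The
  soliton equation turns this into 3 (lam + c) + tr Dh = 0, where tr Dh = 3 c.\<close>

lemma lam_c: "lam = - 2 * c"
proof -
  let ?\<alpha> = "covector (\<lambda>x. \<tau> [central_vec, (x, 0)])"
  \<comment> \<open>The contraction of the right side of the soliton equation with z, divided by u:
    D z = c z accounts for the summand c, and the other two slots for the action of
    \<open>Dh\<close>.\<close>
  let ?\<beta> = "\<lambda>xs. (lam + c) * \<omega> xs + endo_act Dh \<omega> xs"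
  have "linear (\<lambda>x. \<tau> [central_vec, (x, 0)])"
    using linear_compose[OF linear_embed linear_form2(2)[OF kform_tau]] by (simp add: o_def)
  then have ka: "kform 1 ?\<alpha>" by (rule kform_covector)
  have kda: "kform 2 (ce_diff br ?\<alpha>)"
    using kform_ce_diff[OF bilinear_br br_self ka] by (simp add: numeral_2_eq_2)
  have kb: "kform 2 ?\<beta>"
    by (intro kform_add kform_scale kform_om kform_endo_act[OF linear_Dh])
  have da: "ce_diff br ?\<alpha> = (\<lambda>xs. - u * ?\<beta> xs)"
  proof (rule form2_eqI[OF kda kform_scale[OF kb]])
    fix x y
    have cz: "cb central_vec y = 0" for y
      using bilinear_lzero[OF bilinear_br] linear_0[OF linear_form2(1)[OF kform_om0]]
      by (simp add: central_ext_def zero_prod_def)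
    have t0: "\<tau> [0, a] = 0" "\<tau> [a, 0] = 0" for a
      using linear_0[OF linear_form2(1)[OF kform_tau]] linear_0[OF linear_form2(2)[OF kform_tau]] by simp_all
    have tz: "\<tau> [central_vec, (a, t)] = \<tau> [central_vec, (a, 0)]" for a t
    proof -
      have "(a, t) = (a, 0) + t *\<^sub>R central_vec" by simp
      moreover have "\<tau> [central_vec, central_vec] = 0" using kform_tau by (simp add: kform_def)
      ultimately show ?thesis
        using linear_add[OF linear_form2(2)[OF kform_tau]] linear_scale[OF linear_form2(2)[OF kform_tau]]
        by (metis add.right_neutral mult_zero_right real_scaleR_def)
    qed
    have kz: "kform 1 (interior central_vec \<tau>)" using kform_interior[of 1 \<tau>] kform_tau by (simp add: numeral_2_eq_2)
    have iz: "interior central_vec \<tau> = covector (\<lambda>v. \<tau> [central_vec, v])"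
    proof
      fix xs show "interior central_vec \<tau> xs = covector (\<lambda>v. \<tau> [central_vec, v]) xs"
        using kform_length[OF kz, of xs] by (cases xs rule: list.exhaust) (auto simp: covector_def interior_apply)
    qed
    have "ce_diff cb \<tau> [central_vec, (x, 0), (y, 0)] = - ce_diff cb (interior central_vec \<tau>) [(x, 0), (y, 0)]"
      using fun_cong[OF interior_ce_diff[OF kform_tau, of central_vec cb], of "[(x, 0), (y, 0)]"]
      by (simp add: interior_apply[of central_vec "ce_diff cb \<tau>"] endo_act_Cons endo_act_Nil cz t0 interior_apply[of _ \<tau>])
    also have "\<dots> = \<tau> [central_vec, (br x y, 0)]"
      by (simp add: iz ce_diff_covector central_ext_def) (rule tz)
    finally have l: "ce_diff cb \<tau> [central_vec, (x, 0), (y, 0)] = \<tau> [central_vec, (br x y, 0)]" .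
    have ph_z: "\<phi> [central_vec, v, w] = u * \<omega> [fst v, fst w]" for v w
      using linear_0[OF linear_form2(1)[OF kform_om]] linear_0[OF kform_linear_Cons[OF kform_ps]]
      by (simp add: ph3 u_def)
    have "\<phi> [D central_vec, v, w] = c * \<phi> [central_vec, v, w]" for v w
      using linear_scale[OF kform_linear_Cons[OF kform_ph, where xs = "[v, w]"], of c central_vec]
      by (simp only: D_central real_scaleR_def)
    then have "lam * \<phi> [central_vec, (x, 0), (y, 0)] + endo_act D \<phi> [central_vec, (x, 0), (y, 0)] =
        u * ?\<beta> [x, y]"
      by (simp add: endo_act_Cons endo_act_Nil interior_apply ph_z Dh_def algebra_simps)
    then show "ce_diff br ?\<alpha> [x, y] = - u * ?\<beta> [x, y]"
      using l by (simp add: ce_diff_tau ce_diff_covector)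
  qed
  have "ce_diff br (?\<alpha> \<and>\<^sub>\<Lambda> (\<omega> \<and>\<^sub>\<Lambda> \<omega>)) = (\<lambda>xs. 0)"
    using kform_wedge[OF ka kform_cube(1)[OF kform_om]] by (intro exact_h) simp
  then have "(ce_diff br ?\<alpha> \<and>\<^sub>\<Lambda> (\<omega> \<and>\<^sub>\<Lambda> \<omega>)) es = 0"
    by (simp add: ce_diff_wedge[OF bilinear_br br_self ka kform_cube(1)[OF kform_om]] ce_diff_om_om fun_eq_iff)
  then have "(?\<beta> \<and>\<^sub>\<Lambda> (\<omega> \<and>\<^sub>\<Lambda> \<omega>)) es = 0"
    unfolding da wedge_scale_left using u_nonzero by simp
  moreover have "g (e 1) (e 1) = 1" "g (e 3) (e 3) = 1" "g (e 5) (e 5) = 1"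
    by (simp_all add: g_def J_e om_e del: One_nat_def)
  \<comment> \<open>The \<omega>-trace of \<omega> is 3, and that of
    \<open>endo_act Dh \<omega>\<close> is the trace of \<open>Dh\<close> by \<open>om_left\<close>
    and \<open>om_right\<close>.\<close>
  then have "?\<beta> [e 1, e 2] + ?\<beta> [e 3, e 4] + ?\<beta> [e 5, e 6] = 3 * (lam + c) + lin_trace Dh"
    by (simp add: endo_act_Cons endo_act_Nil interior_apply om_e om_left om_right lin_trace_es[OF linear_Dh] del: One_nat_def)
  ultimately have "3 * (lam + c) + lin_trace Dh = 0" by (simp add: wedge_om_om[OF kb] del: One_nat_def)
  then show ?thesis by (simp add: lin_trace_Dh)
qed

text \<open>With tr D = 4 c and c = - lam / 2, the expression 7 lam + 3 tr D becomes 7 lam - 6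
  lam.\<close>

lemma lam_eq_norm_tau: "lam = list_inner g2.fs \<tau> \<tau>"
  using norm_tau_trace lin_trace_D lin_trace_Dh lam_c by simp

end

end

end

theorem corollary5p3:
  fixes br :: "'h::real_vector \<Rightarrow> 'h \<Rightarrow> 'h"
    and \<omega>\<^sub>0 \<omega> \<psi> w\<^sub>1 w\<^sub>2p w\<^sub>2m :: "'h form"
    and \<phi> \<tau> :: "('h \<times> real) form"
    and D :: "'h \<times> real \<Rightarrow> 'h \<times> real"
    and lam :: real
  assumes "dim (UNIV :: 'h set) = 6"
    and "lie_algebra br"
    and "unimodular br"
    and "symplectic_form br \<omega>\<^sub>0"
    and "semi_algebraic_soliton (central_ext br \<omega>\<^sub>0) \<phi> lam D"
    and "g2_torsion_form (central_ext br \<omega>\<^sub>0) \<phi> \<tau>"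
    and "induced_su3 \<phi> \<omega> \<psi>"
    and "su3_torsion_forms br \<omega> \<psi> w\<^sub>1 w\<^sub>2p w\<^sub>2m"
  shows "lam = (form_norm (su3_metric \<omega> \<psi>) w\<^sub>2m)\<^sup>2 + 6 * (form_norm (su3_metric \<omega> \<psi>) w\<^sub>1)\<^sup>2 \<and>
         lam = (form_norm (g2_metric \<phi>) \<tau>)\<^sup>2 \<and>
         lam > 0"
proof -
  have sol: "g2_structure \<phi>" "ce_diff (central_ext br \<omega>\<^sub>0) \<phi> = (\<lambda>xs. 0)"
    "derivation (central_ext br \<omega>\<^sub>0) D"
    "g2_laplacian (central_ext br \<omega>\<^sub>0) \<phi> = (\<lambda>xs. lam * \<phi> xs + endo_act D \<phi> xs)"
    using assms(5) by (auto simp: semi_algebraic_soliton_def closed_g2_structure_def)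
  obtain \<epsilon> where eps: "linear \<epsilon>" "\<epsilon> central_vec \<noteq> 0"
    "\<phi> = (\<lambda>xs. (pullback fst \<omega> \<and>\<^sub>\<Lambda> covector \<epsilon>) xs + pullback fst \<psi> xs)"
    using induced_su3_decomposition[OF assms(1) sol(1) assms(7)] by blast
  obtain e where "su3_frame \<omega> \<psi> (su3_J \<omega> \<psi>) e"
    using su3_frame_exists[OF assms(1)] assms(7) unfolding induced_su3_def by blast
  then interpret su3_frame \<omega> \<psi> "su3_J \<omega> \<psi>" e .
  interpret contact_frame \<omega> \<psi> "su3_J \<omega> \<psi>" e br \<omega>\<^sub>0 \<phi> \<epsilon>
    by (rule contact_frame.intro[OF su3_frame_axioms contact_frame_axioms.intro]) (fact assms eps sol(2))+
  have w: "kform 1 w\<^sub>1" "w\<^sub>2p \<in> Lambda2_8 \<omega> \<psi>" "w\<^sub>2m \<in> Lambda2_8 \<omega> \<psi>"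
    "\<And>xs. ce_diff br \<psi> xs = (w\<^sub>2p \<and>\<^sub>\<Lambda> \<omega>) xs + (w\<^sub>1 \<and>\<^sub>\<Lambda> \<psi>) xs"
    "\<And>xs. ce_diff br (pullback (su3_J \<omega> \<psi>) \<psi>) xs = (w\<^sub>2m \<and>\<^sub>\<Lambda> \<omega>) xs + (pullback (su3_J \<omega> \<psi>) w\<^sub>1 \<and>\<^sub>\<Lambda> \<psi>) xs"
    using assms(8) by (auto simp: su3_torsion_forms_def)
  have m: "kform 2 w\<^sub>2m" using w(3) by (simp add: Lambda2_8_def)
  have g: "su3_metric \<omega> \<psi> = g" by (intro ext) (simp add: su3_metric_def g_def)
  have "lam = list_inner g2.fs \<tau> \<tau>" by (rule lam_eq_norm_tau[OF assms(6) sol(3,4)])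
  moreover have "list_inner g2.fs \<tau> \<tau> = list_inner es w\<^sub>2m w\<^sub>2m + 6 * list_inner es w\<^sub>1 w\<^sub>1"
    by (rule norm_tau[OF assms(6) w(1-3) refl w(4,5)])
  moreover have "list_inner es w\<^sub>1 w\<^sub>1 > 0" by (rule torsion_norm_positive[OF assms(6) w(1,2) refl w(4)])
  ultimately show ?thesis
    using list_inner_self_nonneg[of es w\<^sub>2m]
    unfolding g form_norm_g[OF w(1)] form_norm_g[OF m] g2.form_norm_G[OF kform_tau[OF assms(6)]] by simp
qed

end
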